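(* Let $0<\sigma<\rho$ and let $\mathcal C^{\{\rho\}}$ be a complex cell of length $\ell$ in $\mathcal S_{\mathcal F,\mathcal D}$. Then there exists a cellular cover $\{f_j:\mathcal C_j^{\{\sigma\}}\to\mathcal C^{\{\rho\}}\}$ of size $\mathrm{poly}_\ell(\rho,1/\sigma)$ such that each $f_j$ is a translate map and belongs to $\mathcal S_{O_{\mathcal F}(1),\mathrm{poly}_{\mathcal F}(\mathcal D)}$.
   Context: Sharply o-minimal setting. Fix an o-minimal expansion $\mathcal S$ of the real field with a format–degree filtration $\{\mathcal S_{\mathcal F,\mathcal D}\}$ (collections of definable sets, increasing in both indices, exhausting all definable sets, subsets of $\mathbb R^n$ only in $\mathcal S_{\mathcal F,\mathcal D}$ with $\mathcal F\ge n$) that is sharply o-minimal (subsets of $\mathbb R$ in $\mathcal S_{\mathcal F,\mathcal D}$ have at most $P_{\mathcal F}(\mathcal D)$ components for fixed polynomials $P_{\mathcal F}$), sharply compatible ($A\in\mathcal S_{\mathcal F,\mathcal D}\Rightarrow A\times\mathbb R,\mathbb R\times A\in\mathcal S_{\mathcal F+1,\mathcal D}$, complement and coordinate projection of $A$ in $\mathcal S_{\mathcal F,\mathcal D}$; finite unions/intersections of sets in $\mathcal S_{\mathcal F,\mathcal D_i}$ are in $\mathcal S_{\mathcal F,\sum\mathcal D_i}$; $\{P=0\}\in\mathcal S_{n,\deg P}$), and has sharp cell decomposition (any $k$ sets in $\mathcal S_{\mathcal F,\mathcal D}$ in $\mathbb R^n$ admit a compatible cell decomposition with $\mathrm{poly}_{\mathcal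 F}(\mathcal D,k)$ cells each in $\mathcal S_{O_{\mathcal F}(1),\mathrm{poly}_{\mathcal F}(\mathcal D)}$). $\mathrm{poly}_a(b)$: bounded by a polynomial in $b$ depending only on $a$; $\mathcal S_{O_{\mathcal F}(1),\mathrm{poly}_{\mathcal F}(\mathcal D)}$: $\mathcal S_{\mathcal F',\mathcal D'}$ with $\mathcal F'\le C_{\mathcal F}$, $\mathcal D'\le p_{\mathcal F}(\mathcal D)$. $\mathbb C^\ell\cong\mathbb R^{2\ell}$. Complex cells: fibers $*=\{0\}$, $D(r)=\{|z|<|r|\}$, $D_\circ(r)=\{0<|z|<|r|\}$, $D_\infty(r)=\{|z|>|r|\}$, $A(r_1,r_2)=\{|r_1|<|z|<|r_2|\}$ with nonzero radii; cells of length $\ell+1$ are $\mathcal C\odot\mathcal F=\{(x,y):x\in\mathcal C,y\in\mathcal F(x)\}$ for a cell $\mathcal C\subset\mathbb C^\ell$ ($\mathbb C^0$ in length 0) and a fiber whose radii are holomorphic nowhere vanishing on $\mathcal C$ (inner radius of smaller modulus for $A$). $\delta$-extensions ($0<\delta<1$): $*^\delta=*$, $D(r)^\delta=D(r/\delta)$, $D_\circ(r)^\delta=D_\circ(r/\delta)$, $D_\infty(r)^\delta=D_\infty(\delta r)$, $A(r_1,r_2)^\delta=A(\delta r_1,r_2/\delta)$, applied inductively to cells where radii must continue holomorphically to the extended base keeping fibers well defined. The $\{\rho\}$-extension $\mathcal C^{\{\rho\}}$ uses $\delta=(\sqrt{\pi^2+\rho^2}-\pi)/\rho$ for type $D$ and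 $\delta=e^{-\pi^2/(2\rho)}$ for $D_\circ,D_\infty,A$ (smaller $\rho$ = larger extension); writing $\mathcal C^{\{\rho\}}$ presupposes it exists. Cellular map $f:\mathcal C\to\mathbb C^\ell$: holomorphic, $f_j$ depends only on $z_1,\dots,z_j$, $\partial f_j/\partial z_j\ne0$ on $\mathcal C$ when coordinate $j$ is not of type $*$. It is a translate map if $f_j(\mathbf z)=\pm z_j+g_j(z_1,\dots,z_{j-1})$ with $g_j$ holomorphic, for every $j$. A cellular cover of $\mathcal C^{\{\rho\}}$: finitely many cellular maps $f_j:\mathcal C_j^{\{\sigma\}}\to\mathcal C^{\{\rho\}}$ with $\mathcal C\subset\bigcup_jf_j(\mathcal C_j)$. Complexity: a cell is in $\mathcal S_{\mathcal F,\mathcal D}$ if it and the graphs of its radii are; a cellular map is if its graph, domain and target cells are. *)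

theory Defs
  imports "HOL-Analysis.Analysis" "HOL-Computational_Algebra.Polynomial"
begin

section \<open>Sharply o-minimal structures\<close>

text \<open>Points of \<open>\<real>\<^sup>n\<close> and \<open>\<complex>\<^sup>n\<close> are lists of length \<open>n\<close>. A structure is a family \<open>Def n\<close> of
  collections of subsets of \<open>\<real>\<^sup>n\<close>; a filtration is a family \<open>S n F D\<close>, the collection of those
  subsets of \<open>\<real>\<^sup>n\<close> that have format \<open>F\<close> and degree \<open>D\<close>. Recording \<open>n\<close> keeps the empty subsets
  of the various \<open>\<real>\<^sup>n\<close> apart.\<close>

definition Rn :: "nat \<Rightarrow> real list set" where
  "Rn n = {x. length x = n}"

definition ominimal_expansion :: "(nat \<Rightarrow> real list set set) \<Rightarrow> bool" where
  "ominimal_expansion Def \<longleftrightarrow>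
     (\<forall>n. Def n \<subseteq> Pow (Rn n) \<and> {} \<in> Def n \<and>
        (\<forall>A\<in>Def n. Rn n - A \<in> Def n) \<and>
        (\<forall>A\<in>Def n. \<forall>B\<in>Def n. A \<union> B \<in> Def n)) \<and>
     (\<forall>n. \<forall>A\<in>Def n. {x @ [t] |x t. x \<in> A} \<in> Def (Suc n) \<and> {t # x |x t. x \<in> A} \<in> Def (Suc n)) \<and>
     (\<forall>n i j. i < n \<longrightarrow> j < n \<longrightarrow> {x \<in> Rn n. x ! i = x ! j} \<in> Def n) \<and>
     (\<forall>n. \<forall>A\<in>Def (Suc n). butlast ` A \<in> Def n) \<and>
     (\<forall>r. {[r]} \<in> Def 1) \<and>
     {[x, y] |x y. x < y} \<in> Def 2 \<and>
     {[x, y, x + y] |x y. True} \<in> Def 3 \<and>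
     {[x, y, x * y] |x y. True} \<in> Def 3 \<and>
     (\<forall>A\<in>Def 1. \<exists>I. finite I \<and> (\<forall>J\<in>I. is_interval J) \<and> hd ` A = \<Union>I)"

definition FD_filtration ::
    "(nat \<Rightarrow> real list set set) \<Rightarrow> (nat \<Rightarrow> nat \<Rightarrow> nat \<Rightarrow> real list set set) \<Rightarrow> bool" where
  "FD_filtration Def S \<longleftrightarrow>
     (\<forall>n F F' D D'. F \<le> F' \<longrightarrow> D \<le> D' \<longrightarrow> S n F D \<subseteq> S n F' D') \<and>
     (\<forall>n. (\<Union>F D. S n F D) = Def n) \<and>
     (\<forall>n F D. S n F D \<noteq> {} \<longrightarrow> n \<le> F)"

definition sharply_ominimal :: "(nat \<Rightarrow> nat \<Rightarrow> nat \<Rightarrow> real list set set) \<Rightarrow> bool" where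
  "sharply_ominimal S \<longleftrightarrow>
     (\<exists>P :: nat \<Rightarrow> real poly. \<forall>F D. \<forall>A\<in>S 1 F D.
        finite (components (hd ` A)) \<and>
        real (card (components (hd ` A))) \<le> poly (P F) (real D))"

text \<open>A real polynomial in \<open>n\<close> variables is given by its finitely supported coefficient function
  on exponent vectors of length \<open>n\<close>.\<close>

definition is_mpoly :: "nat \<Rightarrow> (nat list \<Rightarrow> real) \<Rightarrow> bool" where
  "is_mpoly n c \<longleftrightarrow> finite {\<alpha>. c \<alpha> \<noteq> 0} \<and> (\<forall>\<alpha>. c \<alpha> \<noteq> 0 \<longrightarrow> length \<alpha> = n)"

definition mpoly_eval :: "(nat list \<Rightarrow> real) \<Rightarrow> real list \<Rightarrow> real" where
  "mpoly_eval c x = (\<Sum>\<alpha> | c \<alpha> \<noteq> 0. c \<alpha> * (\<Prod>i<length x. (x ! i) ^ (\<alpha> ! i)))"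

definition mpoly_degree :: "(nat list \<Rightarrow> real) \<Rightarrow> nat" where
  "mpoly_degree c = Max (insert 0 (sum_list ` {\<alpha>. c \<alpha> \<noteq> 0}))"

text \<open>In the clause on unions and intersections the number \<open>k\<close> of sets is positive: an empty
  intersection would be \<open>\<real>\<^sup>n\<close> and lie in format smaller than \<open>n\<close>.\<close>

definition sharply_compatible :: "(nat \<Rightarrow> nat \<Rightarrow> nat \<Rightarrow> real list set set) \<Rightarrow> bool" where
  "sharply_compatible S \<longleftrightarrow>
     (\<forall>n F D. \<forall>A\<in>S n F D.
        {x @ [t] |x t. x \<in> A} \<in> S (Suc n) (F + 1) D \<and>
        {t # x |x t. x \<in> A} \<in> S (Suc n) (F + 1) D \<and>
        Rn n - A \<in> S n F D) \<and>
     (\<forall>n F D. \<forall>A\<in>S (Suc n) F D. butlast ` A \<in> S n F D) \<and>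
     (\<forall>n F (k::nat) A d. 1 \<le> k \<longrightarrow> (\<forall>i<k. A i \<in> S n F (d i)) \<longrightarrow>
        (\<Union>i<k. A i) \<in> S n F (\<Sum>i<k. d i) \<and> (\<Inter>i<k. A i) \<in> S n F (\<Sum>i<k. d i)) \<and>
     (\<forall>n c. is_mpoly n c \<longrightarrow> {x \<in> Rn n. mpoly_eval c x = 0} \<in> S n n (mpoly_degree c))"

subsection \<open>Cell decomposition\<close>

definition list_graph :: "'a list set \<Rightarrow> ('a list \<Rightarrow> 'a) \<Rightarrow> 'a list set" where
  "list_graph X f = {x @ [f x] |x. x \<in> X}"

definition list_continuous_on :: "real list set \<Rightarrow> (real list \<Rightarrow> real) \<Rightarrow> bool" where
  "list_continuous_on X f \<longleftrightarrow>
     (\<forall>x\<in>X. \<forall>e>0. \<exists>d>0. \<forall>y\<in>X. (\<forall>i<length x. \<bar>y ! i - x ! i\<bar> < d) \<longrightarrow> \<bar>f y - f x\<bar> < e)"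

definition cont_definable ::
    "(nat \<Rightarrow> real list set set) \<Rightarrow> nat \<Rightarrow> real list set \<Rightarrow> (real list \<Rightarrow> real) \<Rightarrow> bool" where
  "cont_definable Def n X f \<longleftrightarrow> list_graph X f \<in> Def (Suc n) \<and> list_continuous_on X f"

inductive real_cell :: "(nat \<Rightarrow> real list set set) \<Rightarrow> nat \<Rightarrow> real list set \<Rightarrow> bool"
  for Def where
  point: "real_cell Def 0 {[]}"
| graph: "\<lbrakk>real_cell Def n X; cont_definable Def n X f\<rbrakk> \<Longrightarrow> real_cell Def (Suc n) (list_graph X f)"
| band: "\<lbrakk>real_cell Def n X; cont_definable Def n X f; cont_definable Def n X g; \<forall>x\<in>X. f x < g x\<rbrakk>
    \<Longrightarrow> real_cell Def (Suc n) {x @ [t] |x t. x \<in> X \<and> f x < t \<and> t < g x}"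
| below: "\<lbrakk>real_cell Def n X; cont_definable Def n X g\<rbrakk>
    \<Longrightarrow> real_cell Def (Suc n) {x @ [t] |x t. x \<in> X \<and> t < g x}"
| above: "\<lbrakk>real_cell Def n X; cont_definable Def n X f\<rbrakk>
    \<Longrightarrow> real_cell Def (Suc n) {x @ [t] |x t. x \<in> X \<and> f x < t}"
| cylinder: "real_cell Def n X \<Longrightarrow> real_cell Def (Suc n) {x @ [t] |x t. x \<in> X}"

primrec cell_decomposition ::
    "(nat \<Rightarrow> real list set set) \<Rightarrow> nat \<Rightarrow> real list set set \<Rightarrow> bool" where
  "cell_decomposition Def 0 P \<longleftrightarrow> P = {{[]}}"
| "cell_decomposition Def (Suc n) P \<longleftrightarrow>
     finite P \<and> partition_on (Rn (Suc n)) P \<and> (\<forall>X\<in>P. real_cell Def (Suc n) X) \<and>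
     cell_decomposition Def n ((\<lambda>X. butlast ` X) ` P)"

definition compatible_with :: "real list set set \<Rightarrow> real list set set \<Rightarrow> bool" where
  "compatible_with P As \<longleftrightarrow> (\<forall>X\<in>P. \<forall>A\<in>As. X \<subseteq> A \<or> X \<inter> A = {})"

definition poly2 :: "real poly poly \<Rightarrow> real \<Rightarrow> real \<Rightarrow> real" where
  "poly2 p x y = poly (poly p [:y:]) x"

definition sharp_cell_decomposition ::
    "(nat \<Rightarrow> real list set set) \<Rightarrow> (nat \<Rightarrow> nat \<Rightarrow> nat \<Rightarrow> real list set set) \<Rightarrow> bool" where
  "sharp_cell_decomposition Def S \<longleftrightarrow>
     (\<exists>(N :: nat \<Rightarrow> real poly poly) (C :: nat \<Rightarrow> nat) (q :: nat \<Rightarrow> real poly).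
        \<forall>n F D As. finite As \<longrightarrow> As \<noteq> {} \<longrightarrow> As \<subseteq> S n F D \<longrightarrow>
          (\<exists>P. cell_decomposition Def n P \<and> compatible_with P As \<and>
             real (card P) \<le> poly2 (N F) (real D) (real (card As)) \<and>
             (\<forall>X\<in>P. \<exists>F' D'. F' \<le> C F \<and> real D' \<le> poly (q F) (real D) \<and> X \<in> S n F' D')))"

section \<open>Complex cells\<close>

text \<open>Complex Frechet differentiability relative to \<open>X\<close> at every point of \<open>X\<close>. It is only applied
  to complex cells, which are open in the coordinate subspace where the coordinates of
  type \<open>*\<close> vanish; there it is holomorphy in the remaining coordinates.\<close>

definition holo_on :: "complex list set \<Rightarrow> (complex list \<Rightarrow> complex) \<Rightarrow> bool" where
  "holo_on X f \<longleftrightarrow>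
     (\<forall>z\<in>X. \<exists>a :: nat \<Rightarrow> complex. \<forall>e>0. \<exists>d>0. \<forall>w\<in>X.
        (\<Sum>i<length z. cmod (w ! i - z ! i)) < d \<longrightarrow>
        cmod (f w - f z - (\<Sum>i<length z. a i * (w ! i - z ! i)))
          \<le> e * (\<Sum>i<length z. cmod (w ! i - z ! i)))"

text \<open>Fibers \<open>*\<close>, \<open>D(r)\<close>, \<open>D\<^sub>\<circ>(r)\<close>, \<open>D\<^sub>\<infinity>(r)\<close>, \<open>A(r\<^sub>1, r\<^sub>2)\<close>. Radii are total functions; only their
  values on the base cell are relevant.\<close>

datatype fiber =
    Star
  | Disc "complex list \<Rightarrow> complex"
  | PDisc "complex list \<Rightarrow> complex"
  | IDisc "complex list \<Rightarrow> complex"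
  | Annulus "complex list \<Rightarrow> complex" "complex list \<Rightarrow> complex"

primrec radii :: "fiber \<Rightarrow> (complex list \<Rightarrow> complex) set" where
  "radii Star = {}"
| "radii (Disc r) = {r}"
| "radii (PDisc r) = {r}"
| "radii (IDisc r) = {r}"
| "radii (Annulus r1 r2) = {r1, r2}"

primrec fiber_set :: "fiber \<Rightarrow> complex list \<Rightarrow> complex set" where
  "fiber_set Star x = {0}"
| "fiber_set (Disc r) x = {z. cmod z < cmod (r x)}"
| "fiber_set (PDisc r) x = {z. 0 < cmod z \<and> cmod z < cmod (r x)}"
| "fiber_set (IDisc r) x = {z. cmod z > cmod (r x)}"
| "fiber_set (Annulus r1 r2) x = {z. cmod (r1 x) < cmod z \<and> cmod z < cmod (r2 x)}"

datatype ccell = Unit | Odot ccell fiber (infixl "\<odot>" 65)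

primrec cell_length :: "ccell \<Rightarrow> nat" where
  "cell_length Unit = 0"
| "cell_length (C \<odot> \<Phi>) = Suc (cell_length C)"

primrec fibers :: "ccell \<Rightarrow> fiber list" where
  "fibers Unit = []"
| "fibers (C \<odot> \<Phi>) = fibers C @ [\<Phi>]"

primrec cell_set :: "ccell \<Rightarrow> complex list set" where
  "cell_set Unit = {[]}"
| "cell_set (C \<odot> \<Phi>) = {x @ [y] |x y. x \<in> cell_set C \<and> y \<in> fiber_set \<Phi> x}"

definition fiber_over :: "complex list set \<Rightarrow> fiber \<Rightarrow> bool" where
  "fiber_over X \<Phi> \<longleftrightarrow>
     (\<forall>r\<in>radii \<Phi>. holo_on X r \<and> (\<forall>x\<in>X. r x \<noteq> 0)) \<and>
     (\<forall>r1 r2. \<Phi> = Annulus r1 r2 \<longrightarrow> (\<forall>x\<in>X. cmod (r1 x) < cmod (r2 x)))"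

primrec is_ccell :: "ccell \<Rightarrow> bool" where
  "is_ccell Unit \<longleftrightarrow> True"
| "is_ccell (C \<odot> \<Phi>) \<longleftrightarrow> is_ccell C \<and> fiber_over (cell_set C) \<Phi>"

subsection \<open>Extensions\<close>

text \<open>\<open>\<Phi>'\<close> is of the same type as \<open>\<Phi>\<close> and its radii restrict on \<open>X\<close> to those of the
  \<open>\<delta>\<close>-extension of \<open>\<Phi>\<close>.\<close>

fun fiber_extension :: "real \<Rightarrow> complex list set \<Rightarrow> fiber \<Rightarrow> fiber \<Rightarrow> bool" where
  "fiber_extension \<delta> X Star Star \<longleftrightarrow> True"
| "fiber_extension \<delta> X (Disc r) (Disc r') \<longleftrightarrow> (\<forall>x\<in>X. r' x = r x / of_real \<delta>)"
| "fiber_extension \<delta> X (PDisc r) (PDisc r') \<longleftrightarrow> (\<forall>x\<in>X. r' x = r x / of_real \<delta>)"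
| "fiber_extension \<delta> X (IDisc r) (IDisc r') \<longleftrightarrow> (\<forall>x\<in>X. r' x = of_real \<delta> * r x)"
| "fiber_extension \<delta> X (Annulus r1 r2) (Annulus r1' r2') \<longleftrightarrow>
     (\<forall>x\<in>X. r1' x = of_real \<delta> * r1 x \<and> r2' x = r2 x / of_real \<delta>)"
| "fiber_extension \<delta> X \<Phi> \<Phi>' \<longleftrightarrow> False"

primrec ext_delta :: "real \<Rightarrow> fiber \<Rightarrow> real" where
  "ext_delta \<rho> Star = 1"
| "ext_delta \<rho> (Disc r) = (sqrt (pi\<^sup>2 + \<rho>\<^sup>2) - pi) / \<rho>"
| "ext_delta \<rho> (PDisc r) = exp (- (pi\<^sup>2 / (2 * \<rho>)))"
| "ext_delta \<rho> (IDisc r) = exp (- (pi\<^sup>2 / (2 * \<rho>)))"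
| "ext_delta \<rho> (Annulus r1 r2) = exp (- (pi\<^sup>2 / (2 * \<rho>)))"

fun extends_cell :: "real \<Rightarrow> ccell \<Rightarrow> ccell \<Rightarrow> bool" where
  "extends_cell \<rho> Unit Unit \<longleftrightarrow> True"
| "extends_cell \<rho> (C \<odot> \<Phi>) (C' \<odot> \<Phi>') \<longleftrightarrow>
     extends_cell \<rho> C C' \<and> fiber_extension (ext_delta \<rho> \<Phi>) (cell_set C) \<Phi> \<Phi>'"
| "extends_cell \<rho> C C' \<longleftrightarrow> False"

text \<open>\<open>is_extension \<rho> C C'\<close> says that the cell \<open>C\<close> admits a \<open>{\<rho>}\<close>-extension and that \<open>C'\<close> is this
  extension: the radii of \<open>C'\<close> are holomorphic on the extended bases (as \<open>C'\<close> is a cell) and on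
  the original bases they are the rescaled radii of \<open>C\<close>, so they are built from holomorphic
  continuations of the latter.\<close>

definition is_extension :: "real \<Rightarrow> ccell \<Rightarrow> ccell \<Rightarrow> bool" where
  "is_extension \<rho> C C' \<longleftrightarrow> is_ccell C \<and> is_ccell C' \<and> extends_cell \<rho> C C'"

subsection \<open>Cellular maps and covers\<close>

text \<open>In a coordinate that is not of type \<open>*\<close> a cell is open, so the partial derivative below only
  involves values of \<open>f\<close> on the cell.\<close>

definition cellular_map :: "ccell \<Rightarrow> (complex list \<Rightarrow> complex list) \<Rightarrow> bool" where
  "cellular_map C f \<longleftrightarrow>
     (\<forall>z\<in>cell_set C. length (f z) = cell_length C) \<and>
     (\<forall>j<cell_length C.
        holo_on (cell_set C) (\<lambda>z. f z ! j) \<and>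
        (\<forall>z\<in>cell_set C. \<forall>w\<in>cell_set C. take (Suc j) z = take (Suc j) w \<longrightarrow> f z ! j = f w ! j) \<and>
        (fibers C ! j \<noteq> Star \<longrightarrow>
           (\<forall>z\<in>cell_set C. deriv (\<lambda>t. f (z[j := t]) ! j) (z ! j) \<noteq> 0)))"

definition translate_map :: "ccell \<Rightarrow> (complex list \<Rightarrow> complex list) \<Rightarrow> bool" where
  "translate_map C f \<longleftrightarrow>
     (\<forall>j<cell_length C. \<exists>s g. (s = 1 \<or> s = -1) \<and> holo_on (take j ` cell_set C) g \<and>
        (\<forall>z\<in>cell_set C. f z ! j = s * z ! j + g (take j z)))"

text \<open>\<open>f 0, \<dots>, f (N - 1)\<close> is a cellular cover, of size \<open>N\<close>, of the \<open>{\<rho>}\<close>-extension \<open>C\<^sub>\<rho>\<close> of \<open>C\<close>,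
  where \<open>f j\<close> is defined on the \<open>{\<sigma>}\<close>-extension \<open>B\<^sub>\<sigma> j\<close> of \<open>B j\<close>.\<close>

definition cellular_cover ::
    "real \<Rightarrow> real \<Rightarrow> ccell \<Rightarrow> ccell \<Rightarrow> nat \<Rightarrow> (nat \<Rightarrow> ccell) \<Rightarrow> (nat \<Rightarrow> ccell) \<Rightarrow>
      (nat \<Rightarrow> complex list \<Rightarrow> complex list) \<Rightarrow> bool" where
  "cellular_cover \<rho> \<sigma> C C\<^sub>\<rho> N B B\<^sub>\<sigma> f \<longleftrightarrow>
     is_extension \<rho> C C\<^sub>\<rho> \<and>
     (\<forall>j<N. cell_length (B j) = cell_length C \<and> is_extension \<sigma> (B j) (B\<^sub>\<sigma> j) \<and>
        cellular_map (B\<^sub>\<sigma> j) (f j) \<and> f j ` cell_set (B\<^sub>\<sigma> j) \<subseteq> cell_set C\<^sub>\<rho>) \<and>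
     cell_set C \<subseteq> (\<Union>j<N. f j ` cell_set (B j))"

subsection \<open>Complexity\<close>

text \<open>The identification of \<open>\<complex>\<^sup>n\<close> with \<open>\<real>\<^bsup>2n\<^esup>\<close>.\<close>

definition realify :: "complex list \<Rightarrow> real list" where
  "realify z = concat (map (\<lambda>w. [Re w, Im w]) z)"

primrec radii_in ::
    "(nat \<Rightarrow> nat \<Rightarrow> nat \<Rightarrow> real list set set) \<Rightarrow> nat \<Rightarrow> nat \<Rightarrow> ccell \<Rightarrow> bool" where
  "radii_in S F D Unit \<longleftrightarrow> True"
| "radii_in S F D (C \<odot> \<Phi>) \<longleftrightarrow> radii_in S F D C \<and>
     (\<forall>r\<in>radii \<Phi>. realify ` list_graph (cell_set C) r \<in> S (2 * (cell_length C + 1)) F D)"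

definition cell_in ::
    "(nat \<Rightarrow> nat \<Rightarrow> nat \<Rightarrow> real list set set) \<Rightarrow> nat \<Rightarrow> nat \<Rightarrow> ccell \<Rightarrow> bool" where
  "cell_in S F D C \<longleftrightarrow> realify ` cell_set C \<in> S (2 * cell_length C) F D \<and> radii_in S F D C"

definition map_in ::
    "(nat \<Rightarrow> nat \<Rightarrow> nat \<Rightarrow> real list set set) \<Rightarrow> nat \<Rightarrow> nat \<Rightarrow> ccell \<Rightarrow> ccell \<Rightarrow>
      (complex list \<Rightarrow> complex list) \<Rightarrow> bool" where
  "map_in S F D B C f \<longleftrightarrow>
     realify ` {z @ f z |z. z \<in> cell_set B} \<in> S (2 * (cell_length B + cell_length C)) F D \<and>
     cell_in S F D B \<and> cell_in S F D C"

end

theory Submission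
  imports Defs "HOL-Complex_Analysis.Complex_Analysis" "HOL-Library.Landau_Symbols"
begin

text \<open>
  Induction on the length, covering a fiber over a refined base by smaller fibers of the same type
  and by discs whose centers are constant multiples of a radius. This is immediate unless the fiber
  is an annulus \<open>A(R\<^sub>1, R\<^sub>2)\<close> whose width varies over the base: a smaller annulus with the required
  extension exists only where \<open>u = ln \<bar>R\<^sub>2 / R\<^sub>1\<bar>\<close> is large, and discs with centers proportional to
  \<open>R\<^sub>1\<close> work only where \<open>u\<close> is bounded and almost constant. As \<open>u\<close> is positive and pluriharmonic
  on the extended base, it satisfies a Harnack inequality on the base, with a constant close to \<open>1\<close>
  if the extension is large, except that around a circle where \<open>R\<^sub>1 / R\<^sub>2\<close> has nonzero winding number
  \<open>u\<close> is only known to be large. So after refining the base with a small parameter \<open>\<sigma>'\<close>, where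
  \<open>1 / \<sigma>'\<close> is polynomial in \<open>\<rho>\<close> and \<open>1 / \<sigma>\<close>, one of the two alternatives holds over each piece.

  Each piece arises by a number of first-order operations that depends only on the length, with
  arbitrary real constants, so its format and degree do not depend on \<open>\<rho>\<close> and \<open>\<sigma>\<close>.
\<close>

section \<open>Harnack inequalities in one variable\<close>

text \<open>Discs along an annulus have centers tied to \<open>R1\<close>, so one family serves all
  base points only if the variation of \<open>u\<close> is absorbed by the collar between the
  \<rho>-core and the fiber. This collar has logarithmic width \<open>pi^2 / (2 * \<rho>)\<close>:
  one half is granted to the variation of \<open>u\<close>, the other half to the radii of the
  discs. Discs are needed only on pieces with a point where \<open>u\<close> is at most
  \<open>pi^2 / \<sigma>\<close>, so a Harnack constant exceeding 1 by the order of \<sigma> /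
  \<rho> is enough, and the parameters are tuned to this. The inequality is stated for
  \<open>min u T\<close>, because nonzero winding only gives the lower bound \<open>T\<close>; with
  \<open>T\<close> at least \<open>2 * pi^2 / \<sigma>\<close> the truncation is inactive where
  discs are needed. Constant multiples of given radii are holomorphic and definable at a cost that
  ignores the constant. Every cell is built as an extended cell and shrunk afterwards, so no radius
  ever has to be continued analytically.\<close>

lemma Borel_Caratheodory_halfplane:
  assumes "G holomorphic_on ball w R" "\<And>z. z \<in> ball w R \<Longrightarrow> 0 < Re (G z)"
    and "z \<in> ball w R"
  shows "cmod (G z - G w) \<le> 2 * Re (G w) * dist w z / (R - dist w z)"
proof -
  have R: "R > 0" using assms(3) by (metis mem_ball zero_le_dist le_less_trans)
  \<comment> \<open>The Cayley transform that sends the right half plane to the unit disc and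
    \<open>G w\<close> to 0, after rescaling the ball to the unit disc; the Schwarz lemma applies to
    it.\<close>
  define h where "h = (\<lambda>t. (G (w + of_real R * t) - G w) / (G (w + of_real R * t) + cnj (G w)))"
  have inb: "w + of_real R * t \<in> ball w R" if "cmod t < 1" for t
    using that R by (simp add: dist_norm norm_mult)
  have rep: "0 < Re (G w)" using assms(2) R by simp
  have nz: "G (w + of_real R * t) + cnj (G w) \<noteq> 0" if "cmod t < 1" for t
  proof
    assume "G (w + of_real R * t) + cnj (G w) = 0"
    then have "Re (G (w + of_real R * t)) + Re (G w) = 0" by (metis plus_complex.sel(1) cnj.sel(1) zero_complex.sel(1))
    then show False using assms(2)[OF inb[OF that]] rep by simp
  qed
  have "(G \<circ> (\<lambda>t. w + of_real R * t)) holomorphic_on ball 0 1"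
    by (rule holomorphic_on_compose_gen[OF _ assms(1)]) (use inb in \<open>auto intro!: holomorphic_intros\<close>)
  then have "(\<lambda>t. G (w + of_real R * t)) holomorphic_on ball 0 1" by (simp add: o_def)
  then have "h holomorphic_on ball 0 1"
    unfolding h_def using nz by (intro holomorphic_on_divide holomorphic_on_diff holomorphic_on_add holomorphic_on_const) auto
  moreover have "h 0 = 0" by (simp add: h_def)
  moreover have "cmod (h t) < 1" if "cmod t < 1" for t
  proof -
    let ?g = "G (w + of_real R * t)"
    have g: "0 < Re ?g" using assms(2)[OF inb[OF that]] .
    have "(cmod (?g - G w))\<^sup>2 < (cmod (?g + cnj (G w)))\<^sup>2"
      unfolding cmod_power2 using mult_pos_pos[OF g rep] by (simp add: power2_eq_square algebra_simps)
    then have "cmod (?g - G w) < cmod (?g + cnj (G w))"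
      by (rule power_less_imp_less_base) simp
    then show ?thesis using nz[OF that] by (simp add: h_def norm_divide)
  qed
  ultimately have sch: "cmod (h t) \<le> cmod t" if "cmod t < 1" for t
    using Schwarz_Lemma(1) that by blast
  define t where "t = (z - w) / of_real R"
  have t: "cmod t = dist w z / R" using R by (simp add: t_def norm_divide dist_norm norm_minus_commute)
  have t1: "cmod t < 1" using assms(3) R unfolding t by simp
  have wz: "w + of_real R * t = z" using R by (simp add: t_def)
  have "cmod (G z - G w) \<le> cmod t * cmod (G z + cnj (G w))"
    using sch[OF t1] nz[OF t1] by (simp add: h_def wz norm_divide divide_le_eq)
  \<comment> \<open>\<open>G z + cnj (G w)\<close> differs from \<open>G z - G w\<close> by
    \<open>2 * Re (G w)\<close>, so the unknown difference occurs on both sides and can be solved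
    for.\<close>
  also have "\<dots> \<le> cmod t * (cmod (G z - G w) + 2 * Re (G w))"
  proof (rule mult_left_mono)
    have "G z + cnj (G w) = (G z - G w) + of_real (2 * Re (G w))"
      by (simp add: complex_eq_iff)
    moreover have "cmod (of_real (2 * Re (G w))) = 2 * Re (G w)" using rep by (simp del: of_real_mult)
    ultimately show "cmod (G z + cnj (G w)) \<le> cmod (G z - G w) + 2 * Re (G w)"
      by (metis norm_triangle_ineq)
  qed simp
  finally have "cmod (G z - G w) \<le> dist w z / R * (cmod (G z - G w) + 2 * Re (G w))"
    by (simp add: t)
  then have "R * cmod (G z - G w) \<le> dist w z * (cmod (G z - G w) + 2 * Re (G w))"
    using R by (simp add: field_simps)
  then have "cmod (G z - G w) * (R - dist w z) \<le> 2 * Re (G w) * dist w z"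
    by (simp add: algebra_simps)
  then show ?thesis using assms(3) by (simp add: pos_le_divide_eq)
qed

lemma holomorphic_neg_log:
  assumes "convex W" "h holomorphic_on W" "\<And>z. z \<in> W \<Longrightarrow> 0 < cmod (h z) \<and> cmod (h z) < 1"
  obtains G where "G holomorphic_on W" "\<And>z. z \<in> W \<Longrightarrow> h z = exp (- G z)"
    "\<And>z. z \<in> W \<Longrightarrow> Re (G z) = - ln (cmod (h z))" "\<And>z. z \<in> W \<Longrightarrow> 0 < Re (G z)"
proof -
  have "\<And>z. z \<in> W \<Longrightarrow> h z \<noteq> 0" using assms(3) by force
  then obtain g where g: "g holomorphic_on W" "\<And>z. z \<in> W \<Longrightarrow> h z = exp (g z)"
    using contractible_imp_holomorphic_log[OF assms(2) convex_imp_contractible[OF assms(1)]]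
    by metis
  have r: "Re (g z) = ln (cmod (h z))" if "z \<in> W" for z
    using g(2)[OF that] by (simp add: norm_exp_eq_Re)
  show thesis
    by (rule that[of "\<lambda>z. - g z"])
       (use g r assms(3) in \<open>auto intro!: holomorphic_intros simp: norm_exp_eq_Re ln_less_zero\<close>)
qed

text \<open>The largest ratio of two positive numbers that agree with a common third one up to
  relative error \<eta>, whether the error is relative to the third number or to each of the
  two.\<close>

definition harnack_factor :: "real \<Rightarrow> real" where
  "harnack_factor \<eta> = (1 + \<eta>) / (1 - \<eta>)"

lemma harnack_factor_ge_1: "0 \<le> \<eta> \<Longrightarrow> \<eta> < 1 \<Longrightarrow> 1 \<le> harnack_factor \<eta>"
  by (simp add: harnack_factor_def)

lemma le_harnack_factor:
  assumes "0 \<le> \<eta>" "\<eta> < 1" "\<bar>M - u\<bar> \<le> \<eta> * u" "\<bar>M - v\<bar> \<le> \<eta> * v"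
  shows "u \<le> harnack_factor \<eta> * (v::real)"
proof -
  have "u * (1 - \<eta>) \<le> M" "M \<le> (1 + \<eta>) * v" using assms by (auto simp: algebra_simps abs_le_iff)
  then have "u * (1 - \<eta>) \<le> (1 + \<eta>) * v" by simp
  then show ?thesis using assms by (simp add: harnack_factor_def field_simps)
qed

text \<open>Both points are compared with the center, where the half-plane estimate has relative
  error \<open>2 * t / (1 - t)\<close>. It tends to 0 with \<open>t\<close>, so a large extension
  yields a constant close to 1.\<close>

lemma harnack_disc:
  assumes "h holomorphic_on ball 0 r" "\<And>z. z \<in> ball 0 r \<Longrightarrow> 0 < cmod (h z) \<and> cmod (h z) < 1"
    and "0 < r" "0 \<le> t" "t < 1" "2 * t / (1 - t) \<le> \<eta>" "\<eta> < 1"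
    and "cmod x \<le> t * r" "cmod y \<le> t * r"
  shows "- ln (cmod (h x)) \<le> harnack_factor \<eta> * - ln (cmod (h y))"
proof -
  obtain G where G: "G holomorphic_on ball 0 r"
    "\<And>z. z \<in> ball 0 r \<Longrightarrow> Re (G z) = - ln (cmod (h z))" "\<And>z. z \<in> ball 0 r \<Longrightarrow> 0 < Re (G z)"
    using holomorphic_neg_log[OF convex_ball assms(1,2)] by metis
  have \<eta>: "0 \<le> \<eta>" using assms(4,5,6) by (smt (verit) divide_nonneg_pos)
  have tr: "t * r < r" using assms by simp
  have near: "cmod (G z - G 0) \<le> \<eta> * Re (G 0)" if "cmod z \<le> t * r" for z
  proof -
    have zb: "z \<in> ball 0 r" using that tr by simp
    have g0: "0 < Re (G 0)" using G(3) assms(3) by simp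
    have "cmod (G z - G 0) \<le> 2 * Re (G 0) * cmod z / (r - cmod z)"
      using Borel_Caratheodory_halfplane[OF G(1,3) zb] by (simp add: dist_norm)
    also have "\<dots> \<le> 2 * Re (G 0) * (t * r) / (r - t * r)"
      using that tr g0 assms(3,4) by (intro frac_le mult_left_mono) auto
    also have "\<dots> = Re (G 0) * (2 * t / (1 - t))"
    proof -
      have "r - t * r = (1 - t) * r" by (simp add: algebra_simps)
      then show ?thesis using assms(3,5) by (simp add: field_simps)
    qed
    also have "\<dots> \<le> Re (G 0) * \<eta>" using g0 assms(6) by (intro mult_left_mono) auto
    finally show ?thesis by (simp add: mult.commute)
  qed
  have "\<bar>Re (G x) - Re (G 0)\<bar> \<le> \<eta> * Re (G 0)" "\<bar>Re (G y) - Re (G 0)\<bar> \<le> \<eta> * Re (G 0)"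
    using near[OF assms(8)] near[OF assms(9)] abs_Re_le_cmod[of "G x - G 0"] abs_Re_le_cmod[of "G y - G 0"]
    by simp_all
  then have "Re (G x) \<le> (1 + \<eta>) * Re (G 0)" "(1 - \<eta>) * Re (G 0) \<le> Re (G y)"
    by (auto simp: algebra_simps abs_le_iff)
  then have "Re (G x) * (1 - \<eta>) \<le> (1 + \<eta>) * Re (G 0) * (1 - \<eta>)" "(1 + \<eta>) * ((1 - \<eta>) * Re (G 0)) \<le> (1 + \<eta>) * Re (G y)"
    using \<eta> assms(7) by (auto intro!: mult_right_mono mult_left_mono)
  then have "Re (G x) * (1 - \<eta>) \<le> (1 + \<eta>) * Re (G y)" by (simp add: algebra_simps)
  then have "Re (G x) \<le> harnack_factor \<eta> * Re (G y)"
    using \<eta> assms(7) by (simp add: harnack_factor_def field_simps)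
  then show ?thesis using G(2)[of x] G(2)[of y] assms(8,9) tr by simp
qed

text \<open>Either the winding number of \<open>h\<close> is nonzero, and then \<open>- ln \<bar>h\<bar>\<close> is at least \<open>T\<close> deep inside
  the annulus, or \<open>- ln h\<close> is single valued and its mean over circles does not depend on the circle.\<close>

lemma harnack_annulus:
  assumes "convex W" "open W"
    and per: "\<And>z. z \<in> W \<Longrightarrow> z + of_real (2 * pi) * \<i> \<in> W"
    and "h holomorphic_on exp ` W" "\<And>z. z \<in> W \<Longrightarrow> 0 < cmod (h (exp z)) \<and> cmod (h (exp z)) < 1"
    and "0 < T" "2 * pi + 2 * T \<le> R" "2 * pi / T \<le> \<eta>" "\<eta> < 1"
    and xy: "ball x R \<subseteq> W" "ball y R \<subseteq> W"
  shows "min (- ln (cmod (h (exp x)))) T \<le> harnack_factor \<eta> * - ln (cmod (h (exp y)))"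
proof -
  let ?p = "of_real (2 * pi) * \<i> :: complex"
  have np: "cmod ?p = 2 * pi" by (simp add: norm_mult)
  have "(h \<circ> exp) holomorphic_on W"
    using assms(4) by (intro holomorphic_on_compose holomorphic_intros)
  then obtain G where G: "G holomorphic_on W" "\<And>z. z \<in> W \<Longrightarrow> h (exp z) = exp (- G z)"
    "\<And>z. z \<in> W \<Longrightarrow> Re (G z) = - ln (cmod (h (exp z)))" "\<And>z. z \<in> W \<Longrightarrow> 0 < Re (G z)"
    using holomorphic_neg_log[OF assms(1), of "h \<circ> exp"] assms(5) by (metis comp_apply)
  have \<eta>: "0 < \<eta>" using assms(6,8) pi_gt_zero by (smt (verit) divide_pos_pos)
  have R: "0 < R" "2 * pi < R" using assms(6,7) pi_gt_zero by linarith+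
  \<comment> \<open>One full turn is a displacement by \<open>2 * pi\<close>. The room
    \<open>2 * T\<close> that remains in the ball makes the relative change of \<open>G\<close> at
    most \<open>2 * pi / T\<close>.\<close>
  have near: "cmod (G z - G w) \<le> \<eta> * Re (G w)" if "ball w R \<subseteq> W" "dist w z \<le> 2 * pi" for w z
  proof -
    have b: "z \<in> ball w R" using that R by simp
    have gw: "0 < Re (G w)" using G(4) that(1) R(1) by (meson centre_in_ball subsetD)
    have "cmod (G z - G w) \<le> 2 * Re (G w) * dist w z / (R - dist w z)"
      using that(1) b G(1,4) by (intro Borel_Caratheodory_halfplane) (auto intro: holomorphic_on_subset)
    also have "\<dots> \<le> 2 * Re (G w) * (2 * pi) / (2 * T)"
      using that(2) R gw assms(6,7) by (intro frac_le mult_left_mono) auto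
    also have "\<dots> = Re (G w) * (2 * pi / T)" by (simp add: field_simps)
    also have "\<dots> \<le> Re (G w) * \<eta>" using gw assms(8) by (intro mult_left_mono) auto
    finally show ?thesis by (simp add: mult.commute)
  qed
  have xW: "x \<in> W" and yW: "y \<in> W" using xy R by auto
  have k1: "1 \<le> harnack_factor \<eta>" using \<eta> assms(9) by (simp add: harnack_factor_ge_1)
  \<comment> \<open>The monodromy of \<open>G\<close>. Its values are integer multiples of
    \<open>2 * pi * \<i>\<close>, so it is constant on \<open>W\<close>; up to sign it is the
    winding number of \<open>h\<close>.\<close>
  define d where "d = (\<lambda>z. G (z + ?p) - G z)"
  have d_hol: "d holomorphic_on W"
  proof -
    have "(G \<circ> (\<lambda>z. z + ?p)) holomorphic_on W"
      by (rule holomorphic_on_compose_gen[OF _ G(1)]) (use per in \<open>auto intro!: holomorphic_intros\<close>)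
    then show ?thesis unfolding d_def o_def using G(1) by (rule holomorphic_on_diff)
  qed
  have d_int: "\<exists>n::int. d z = of_int (2 * n) * of_real pi * \<i>" if "z \<in> W" for z
  proof -
    have "exp (- G (z + ?p)) = exp (- G z)"
      using G(2)[OF that] G(2)[OF per[OF that]] by (simp add: exp_plus_2pin exp_add)
    then obtain n :: int where "- G (z + ?p) = - G z + of_real (real_of_int (2 * n) * pi) * \<i>"
      unfolding exp_eq by blast
    then have "d z = of_int (2 * (-n)) * of_real pi * \<i>" by (simp add: d_def algebra_simps)
    then show ?thesis by blast
  qed
  have d_const: "d z = d y" if "z \<in> W" for z
  proof -
    have "d constant_on W"
    proof (rule continuous_discrete_range_constant)
      show "connected W" using assms(1) convex_connected by blast
      show "continuous_on W d" using d_hol holomorphic_on_imp_continuous_on by blast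
      fix z assume z: "z \<in> W"
      show "\<exists>e>0. \<forall>v. v \<in> W \<and> d v \<noteq> d z \<longrightarrow> e \<le> norm (d v - d z)"
      proof (intro exI[of _ "2*pi"] conjI allI impI)
        fix v assume v: "v \<in> W \<and> d v \<noteq> d z"
        obtain m n :: int where mn: "d v = of_int (2 * m) * of_real pi * \<i>" "d z = of_int (2 * n) * of_real pi * \<i>"
          using d_int v z by meson
        then have "d v - d z = of_real (2 * pi * of_int (m - n)) * \<i>" by (simp add: algebra_simps)
        then have "norm (d v - d z) = 2 * pi * \<bar>real_of_int (m - n)\<bar>"
          by (simp only: norm_mult norm_of_real norm_ii) (simp add: abs_mult)
        moreover have "m \<noteq> n" using mn v by auto
        then have "1 \<le> \<bar>real_of_int (m - n)\<bar>" by linarith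
        ultimately show "2 * pi \<le> norm (d v - d z)" using pi_gt_zero by (simp add: mult_le_cancel_left1)
      qed simp
    qed
    then show ?thesis using that yW unfolding constant_on_def by metis
  qed
  show ?thesis
  proof (cases "d y = 0")
    \<comment> \<open>A jump of at least \<open>2 * pi\<close> over one turn is compatible with the
      relative error \<open>2 * pi / T\<close> only if \<open>Re (G y)\<close> is at least
      \<open>T\<close>.\<close>
    case False
    obtain n :: int where n: "d y = of_int (2 * n) * of_real pi * \<i>" using d_int yW by blast
    then have "d y = of_real (2 * pi * of_int n) * \<i>" by (simp add: algebra_simps)
    then have nd: "cmod (d y) = 2 * pi * \<bar>real_of_int n\<bar>"
      by (simp only: norm_mult norm_of_real norm_ii) (simp add: abs_mult)
    have "n \<noteq> 0" using n False by auto
    then have "2 * pi \<le> cmod (d y)" using nd pi_gt_zero by (simp add: mult_le_cancel_left1)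
    also have "\<dots> \<le> 2 * pi / T * Re (G y)"
    proof -
      have "dist y (y + ?p) = 2 * pi" using np by (simp add: dist_norm)
      moreover have "cmod (G (y + ?p) - G y) \<le> 2 * Re (G y) * dist y (y + ?p) / (R - dist y (y + ?p))"
        using xy(2) R G(1,4) calculation
        by (intro Borel_Caratheodory_halfplane) (auto intro: holomorphic_on_subset)
      moreover have "2 * Re (G y) * (2 * pi) / (R - 2 * pi) \<le> 2 * Re (G y) * (2 * pi) / (2 * T)"
        using R G(4)[OF yW] assms(6,7) by (intro frac_le mult_left_mono) auto
      ultimately show ?thesis by (simp add: d_def field_simps)
    qed
    finally have "T \<le> Re (G y)" using assms(6) by (simp add: field_simps)
    also have "\<dots> \<le> harnack_factor \<eta> * Re (G y)" using k1 G(4)[OF yW] by (simp add: mult_le_cancel_right1)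
    finally show ?thesis using G(3)[OF yW] by simp
  next
    case True
    then have Gper: "G (z + ?p) = G z" if "z \<in> W" for z using d_const[OF that] by (simp add: d_def)
    \<comment> \<open>By periodicity of \<open>G\<close> the increment of a primitive over one
      period is a constant \<open>M\<close>, and \<open>M / ?p\<close> is the mean of
      \<open>G\<close> over any period segment. It is the common value with which both points are
      compared.\<close>
    obtain P where P: "\<And>z. z \<in> W \<Longrightarrow> (P has_field_derivative G z) (at z)"
      using holomorphic_convex_primitive'[OF assms(1,2) G(1)] at_within_open[OF _ assms(2)] by metis
    have Pd: "((\<lambda>z. P (z + ?p) - P z) has_field_derivative 0) (at z within W)" if "z \<in> W" for z
    proof -
      have "((\<lambda>z. P (z + ?p) - P z) has_field_derivative G (z + ?p) * 1 - G z) (at z)"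
        by (intro derivative_intros DERIV_chain2[of P] P that per) (auto intro!: derivative_eq_intros)
      then show ?thesis using Gper[OF that] by (simp add: has_field_derivative_at_within)
    qed
    obtain M where M: "\<And>z. z \<in> W \<Longrightarrow> P (z + ?p) - P z = M"
      using has_field_derivative_zero_constant[OF assms(1) Pd] by metis
    have mean: "\<bar>Re (M / ?p) - Re (G w)\<bar> \<le> \<eta> * Re (G w)" if w: "ball w R \<subseteq> W" for w
    proof -
      have wW: "w \<in> W" using w R by auto
      have sub: "cball w (2*pi) \<subseteq> W" using w R by (auto simp: subset_iff)
      \<comment> \<open>\<open>P z - z * G w\<close> has derivative \<open>G z - G w\<close>, so the
        mean value estimate along one period carries the bound on \<open>G\<close> over to its
        mean.\<close>
      have "norm ((P (w + ?p) - (w + ?p) * G w) - (P w - w * G w)) \<le> \<eta> * Re (G w) * norm ((w + ?p) - w)"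
      proof (rule field_differentiable_bound[of "cball w (2*pi)"])
        fix z assume z: "z \<in> cball w (2*pi)"
        have "(P has_field_derivative G z) (at z)" using P sub z by blast
        then have "((\<lambda>z. P z - z * G w) has_field_derivative G z - 1 * G w) (at z)"
          by (intro DERIV_diff DERIV_cmult_right DERIV_ident)
        then show "((\<lambda>z. P z - z * G w) has_field_derivative G z - G w) (at z within cball w (2*pi))"
          by (simp add: has_field_derivative_at_within)
        show "cmod (G z - G w) \<le> \<eta> * Re (G w)" using near[OF w] z by simp
      qed (use np in \<open>auto simp: dist_norm\<close>)
      then have "cmod (M - ?p * G w) \<le> \<eta> * Re (G w) * (2 * pi)"
        using M[OF wW] np by (simp add: algebra_simps)
      moreover have "M - ?p * G w = ?p * (M / ?p - G w)" by (simp add: field_simps)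
      ultimately have "2 * pi * cmod (M / ?p - G w) \<le> \<eta> * Re (G w) * (2 * pi)"
        by (metis norm_mult np)
      then have "cmod (M / ?p - G w) \<le> \<eta> * Re (G w)" by (simp add: mult.commute mult_le_cancel_left_pos)
      then show ?thesis using abs_Re_le_cmod[of "M / ?p - G w"] by (simp only: minus_complex.sel)
    qed
    have "Re (G x) \<le> harnack_factor \<eta> * Re (G y)"
      using le_harnack_factor[OF _ assms(9) mean[OF xy(1)] mean[OF xy(2)]] \<eta> by simp
    then show ?thesis using G(3)[OF xW] G(3)[OF yW] by simp
  qed
qed

section \<open>Holomorphic functions on sets of lists\<close>

definition l1_dist :: "complex list \<Rightarrow> complex list \<Rightarrow> real" where
  "l1_dist z w = (\<Sum>i<length z. cmod (w ! i - z ! i))"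

text \<open>The point \<open>z\<close> is not removed from its neighborhoods, because
  \<open>holo_on\<close> compares the error with a multiple of the distance instead of dividing by
  it.\<close>

definition near_in :: "complex list set \<Rightarrow> complex list \<Rightarrow> complex list filter" where
  "near_in X z = inf (filtercomap (l1_dist z) (nhds 0)) (principal X)"

lemma l1_dist_nonneg: "0 \<le> l1_dist z w"
  by (simp add: l1_dist_def sum_nonneg)

lemma eventually_near_in:
  "eventually P (near_in X z) \<longleftrightarrow> (\<exists>d>0. \<forall>w\<in>X. l1_dist z w < d \<longrightarrow> P w)"
proof -
  have "eventually P (near_in X z) \<longleftrightarrow> (\<exists>d>0. \<forall>w. dist (l1_dist z w) 0 < d \<longrightarrow> w \<in> X \<longrightarrow> P w)"
    unfolding near_in_def eventually_inf_principal eventually_filtercomap eventually_nhds_metric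
    by (rule iffI, blast, elim exE, rule_tac x = "\<lambda>t. dist t 0 < d" in exI) auto
  then show ?thesis using l1_dist_nonneg by (auto simp: dist_real_def)
qed

definition lin_part :: "(nat \<Rightarrow> complex) \<Rightarrow> complex list \<Rightarrow> complex list \<Rightarrow> complex" where
  "lin_part a z w = (\<Sum>i<length z. a i * (w ! i - z ! i))"

text \<open>With differentiability as a Landau estimate, sums, multiples and the chain rule reduce
  to the calculus of little-o and big-O.\<close>

lemma holo_on_iff:
  "holo_on X f \<longleftrightarrow> (\<forall>z\<in>X. \<exists>a. (\<lambda>w. f w - f z - lin_part a z w) \<in> o[near_in X z](l1_dist z))"
  unfolding holo_on_def smallo_def eventually_near_in lin_part_def
  using l1_dist_nonneg by (simp add: l1_dist_def[symmetric])

lemma holo_on_subset: "holo_on X f \<Longrightarrow> Y \<subseteq> X \<Longrightarrow> holo_on Y f"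
  unfolding holo_on_iff
proof
  fix z assume X: "\<forall>z\<in>X. \<exists>a. (\<lambda>w. f w - f z - lin_part a z w) \<in> o[near_in X z](l1_dist z)"
    and YX: "Y \<subseteq> X" and "z \<in> Y"
  then obtain a where a: "(\<lambda>w. f w - f z - lin_part a z w) \<in> o[near_in X z](l1_dist z)" by blast
  have "near_in Y z \<le> near_in X z"
    unfolding near_in_def using YX by (intro inf_mono) auto
  then show "\<exists>a. (\<lambda>w. f w - f z - lin_part a z w) \<in> o[near_in Y z](l1_dist z)"
    using a landau_o.small.filter_mono by blast
qed

lemma holo_on_cong:
  assumes "\<And>x. x \<in> X \<Longrightarrow> f x = g x"
  shows "holo_on X f \<longleftrightarrow> holo_on X g"
  unfolding holo_on_def using assms by (simp cong: ball_cong)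

lemma lin_part_zero: "lin_part (\<lambda>i. 0) z w = 0"
  by (simp add: lin_part_def)

lemma lin_part_add: "lin_part (\<lambda>i. a i + b i) z w = lin_part a z w + lin_part b z w"
  by (simp add: lin_part_def sum.distrib distrib_right)

lemma lin_part_cmult: "lin_part (\<lambda>i. c * a i) z w = c * lin_part a z w"
  by (simp add: lin_part_def sum_distrib_left algebra_simps)

lemma lin_part_sum: "lin_part (\<lambda>i. \<Sum>j\<in>J. a j i) z w = (\<Sum>j\<in>J. lin_part (a j) z w)"
  unfolding lin_part_def by (simp add: sum_distrib_right) (rule sum.swap)

lemma lin_part_bigo: "lin_part a z \<in> O[near_in X z](l1_dist z)"
proof (rule bigoI[where c = "\<Sum>i<length z. cmod (a i)"], rule always_eventually, rule allI)
  fix w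
  have le: "cmod (w ! i - z ! i) \<le> l1_dist z w" if "i < length z" for i
    unfolding l1_dist_def using that by (intro member_le_sum) auto
  have "cmod (lin_part a z w) \<le> (\<Sum>i<length z. cmod (a i) * l1_dist z w)"
    unfolding lin_part_def by (intro sum_norm_le) (auto simp: norm_mult intro!: mult_left_mono le)
  then show "cmod (lin_part a z w) \<le> (\<Sum>i<length z. cmod (a i)) * norm (complex_of_real (l1_dist z w))"
    by (simp add: sum_distrib_right l1_dist_nonneg)
qed

lemma holo_on_const: "holo_on X (\<lambda>_. c)"
  unfolding holo_on_iff by (auto intro!: exI[of _ "\<lambda>_. 0"] simp: lin_part_zero)

lemma holo_on_add:
  assumes "holo_on X f" "holo_on X g"
  shows "holo_on X (\<lambda>z. f z + g z)"
  unfolding holo_on_iff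
proof
  fix z assume "z \<in> X"
  then obtain a b where ab: "(\<lambda>w. f w - f z - lin_part a z w) \<in> o[near_in X z](l1_dist z)"
    "(\<lambda>w. g w - g z - lin_part b z w) \<in> o[near_in X z](l1_dist z)"
    using assms unfolding holo_on_iff by meson
  show "\<exists>a. (\<lambda>w. f w + g w - (f z + g z) - lin_part a z w) \<in> o[near_in X z](l1_dist z)"
    by (rule exI[of _ "\<lambda>i. a i + b i"])
       (use sum_in_smallo(1)[OF ab] in \<open>simp add: lin_part_add algebra_simps\<close>)
qed

lemma holo_on_cmult:
  assumes "holo_on X f"
  shows "holo_on X (\<lambda>z. c * f z)"
  unfolding holo_on_iff
proof
  fix z assume "z \<in> X"
  then obtain a where a: "(\<lambda>w. f w - f z - lin_part a z w) \<in> o[near_in X z](l1_dist z)"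
    using assms unfolding holo_on_iff by meson
  have "(\<lambda>w. c * (f w - f z - lin_part a z w)) \<in> o[near_in X z](l1_dist z)"
    using a by (cases "c = 0") auto
  then show "\<exists>a. (\<lambda>w. c * f w - c * f z - lin_part a z w) \<in> o[near_in X z](l1_dist z)"
    by (intro exI[of _ "\<lambda>i. c * a i"]) (simp add: lin_part_cmult algebra_simps)
qed

lemma holo_on_divide_const: "holo_on X f \<Longrightarrow> holo_on X (\<lambda>z. f z / c)"
  using holo_on_cmult[of X f "inverse c"] by (simp add: field_simps)

lemma holo_on_nth:
  assumes "\<And>z. z \<in> X \<Longrightarrow> i < length z"
  shows "holo_on X (\<lambda>z. z ! i)"
  unfolding holo_on_iff
proof
  fix z assume z: "z \<in> X"
  have "lin_part (\<lambda>k. if k = i then 1 else 0) z w = w ! i - z ! i" for w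
    using assms[OF z] by (simp add: lin_part_def if_distrib[of "\<lambda>x. x * _"] sum.delta cong: if_cong)
  then show "\<exists>a. (\<lambda>w. w ! i - z ! i - lin_part a z w) \<in> o[near_in X z](l1_dist z)"
    by (intro exI[of _ "\<lambda>k. if k = i then 1 else 0"]) simp
qed

text \<open>Chain rule relative to a set. It also covers sections of a cell, whose image has empty
  interior; the differential of \<open>h\<close> is combined with those of the components of
  \<open>\<phi>\<close>.\<close>

lemma holo_on_compose:
  assumes h: "holo_on Y h" and maps: "\<And>z. z \<in> X \<Longrightarrow> \<phi> z \<in> Y"
    and len: "\<And>z. z \<in> X \<Longrightarrow> length (\<phi> z) = m"
    and \<phi>: "\<And>j. j < m \<Longrightarrow> holo_on X (\<lambda>z. \<phi> z ! j)"
  shows "holo_on X (\<lambda>z. h (\<phi> z))"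
  unfolding holo_on_iff
proof
  fix z assume z: "z \<in> X"
  let ?F = "near_in X z"
  have inX: "eventually (\<lambda>w. w \<in> X) ?F" unfolding eventually_near_in by (auto intro: exI[of _ 1])
  have "\<forall>j<m. \<exists>a. (\<lambda>w. \<phi> w ! j - \<phi> z ! j - lin_part a z w) \<in> o[?F](l1_dist z)"
    using \<phi> z unfolding holo_on_iff by blast
  then obtain A where A: "\<And>j. j < m \<Longrightarrow> (\<lambda>w. \<phi> w ! j - \<phi> z ! j - lin_part (A j) z w) \<in> o[?F](l1_dist z)"
    by metis
  obtain b where b: "(\<lambda>v. h v - h (\<phi> z) - lin_part b (\<phi> z) v) \<in> o[near_in Y (\<phi> z)](l1_dist (\<phi> z))"
    using h maps[OF z] unfolding holo_on_iff by blast
  have diffO: "(\<lambda>w. \<phi> w ! j - \<phi> z ! j) \<in> O[?F](l1_dist z)" if "j < m" for j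
    using sum_in_bigo(1)[OF landau_o.small_imp_big[OF A[OF that]] lin_part_bigo[of "A j" z X]] by simp
  have "(\<lambda>w. \<Sum>j<m. complex_of_real (cmod (\<phi> w ! j - \<phi> z ! j))) \<in> O[?F](l1_dist z)"
    using diffO by (intro big_sum_in_bigo) (auto simp: bigo_def)
  \<comment> \<open>The displacement of \<open>\<phi>\<close> is at most of the order of that of its
    argument. Hence \<open>\<phi>\<close> tends to \<open>\<phi> z\<close> inside \<open>Y\<close>,
    and the error of \<open>h\<close> may be measured by the distance of the arguments.\<close>
  then have dO: "(\<lambda>w. complex_of_real (l1_dist (\<phi> z) (\<phi> w))) \<in> O[?F](l1_dist z)"
    unfolding l1_dist_def[of "\<phi> z"] len[OF z] by simp
  have l0: "(l1_dist z \<longlongrightarrow> 0) ?F"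
    unfolding tendsto_iff eventually_near_in using l1_dist_nonneg by (auto simp: dist_real_def)
  have lim0: "((\<lambda>w. l1_dist (\<phi> z) (\<phi> w)) \<longlongrightarrow> 0) ?F"
  proof -
    obtain K where "eventually (\<lambda>w. norm (complex_of_real (l1_dist (\<phi> z) (\<phi> w))) \<le> K * norm (complex_of_real (l1_dist z w))) ?F"
      using dO by (auto elim: landau_o.bigE)
    then have "eventually (\<lambda>w. norm (l1_dist (\<phi> z) (\<phi> w)) \<le> norm (l1_dist z w) * K) ?F"
      by (simp add: mult.commute)
    then show ?thesis using l0 by (rule tendsto_0_le[rotated])
  qed
  have fl: "filterlim \<phi> (near_in Y (\<phi> z)) ?F"
    unfolding near_in_def[of Y] filterlim_inf filterlim_principal filterlim_filtercomap_iff o_def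
    using lim0 eventually_mono[OF inX maps] by auto
  have "(\<lambda>w. h (\<phi> w) - h (\<phi> z) - lin_part b (\<phi> z) (\<phi> w)) \<in> o[?F](\<lambda>w. complex_of_real (l1_dist (\<phi> z) (\<phi> w)))"
    using landau_o.small.compose[OF b fl] .
  then have 1: "(\<lambda>w. h (\<phi> w) - h (\<phi> z) - lin_part b (\<phi> z) (\<phi> w)) \<in> o[?F](l1_dist z)"
    using dO by (rule landau_o.small_big_trans)
  have "(\<lambda>w. \<Sum>j<m. b j * (\<phi> w ! j - \<phi> z ! j - lin_part (A j) z w)) \<in> o[?F](l1_dist z)"
  proof (rule big_sum_in_smallo)
    fix j assume "j \<in> {..<m}"
    then show "(\<lambda>w. b j * (\<phi> w ! j - \<phi> z ! j - lin_part (A j) z w)) \<in> o[?F](l1_dist z)"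
      using A[of j] by (cases "b j = 0") auto
  qed
  from sum_in_smallo(1)[OF 1 this]
  have "(\<lambda>w. h (\<phi> w) - h (\<phi> z) - lin_part (\<lambda>i. \<Sum>j<m. b j * A j i) z w) \<in> o[?F](l1_dist z)"
    by (simp add: lin_part_sum lin_part_cmult lin_part_def[of b] len[OF z] sum_subtractf algebra_simps sum.distrib)
  then show "\<exists>a. (\<lambda>w. h (\<phi> w) - h (\<phi> z) - lin_part a z w) \<in> o[?F](l1_dist z)" by blast
qed

lemma holo_on_imp_holomorphic_on_fiber:
  assumes "holo_on X f" "\<And>y. y \<in> V \<Longrightarrow> x @ [y] \<in> X"
  shows "(\<lambda>y. f (x @ [y])) holomorphic_on V"
  unfolding holomorphic_on_def field_differentiable_def
proof
  fix y assume y: "y \<in> V"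
  obtain a where a: "\<And>e. e > 0 \<Longrightarrow> \<exists>d>0. \<forall>w\<in>X.
        (\<Sum>i<length (x @ [y]). cmod (w ! i - (x @ [y]) ! i)) < d \<longrightarrow>
        cmod (f w - f (x @ [y]) - (\<Sum>i<length (x @ [y]). a i * (w ! i - (x @ [y]) ! i)))
          \<le> e * (\<Sum>i<length (x @ [y]). cmod (w ! i - (x @ [y]) ! i))"
    using assms(1) assms(2)[OF y] unfolding holo_on_def by meson
  \<comment> \<open>Only the last coordinate moves, so at most one summand survives.\<close>
  have s: "(\<Sum>i<length (x @ [y]). F i ((x @ [y']) ! i - (x @ [y]) ! i)) = F (length x) (y' - y)"
    if "\<And>i. F i 0 = 0" for y' and F :: "nat \<Rightarrow> complex \<Rightarrow> 'z::comm_monoid_add"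
    using that by (simp add: nth_append)
  have "((\<lambda>y. f (x @ [y])) has_field_derivative a (length x)) (at y within V)"
    unfolding has_field_derivative_def has_derivative_within_alt
  proof (intro conjI allI impI bounded_linear_mult_right)
    fix e :: real assume "e > 0"
    from a[OF this] obtain d where d: "d > 0" "\<And>w. w \<in> X \<Longrightarrow>
        (\<Sum>i<length (x @ [y]). cmod (w ! i - (x @ [y]) ! i)) < d \<Longrightarrow>
        cmod (f w - f (x @ [y]) - (\<Sum>i<length (x @ [y]). a i * (w ! i - (x @ [y]) ! i)))
          \<le> e * (\<Sum>i<length (x @ [y]). cmod (w ! i - (x @ [y]) ! i))" by blast
    show "\<exists>d>0. \<forall>y'\<in>V. norm (y' - y) < d \<longrightarrow>
        norm (f (x @ [y']) - f (x @ [y]) - a (length x) * (y' - y)) \<le> e * norm (y' - y)"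
    proof (intro exI[of _ d] conjI ballI impI)
      fix y' assume "y' \<in> V" "norm (y' - y) < d"
      then show "norm (f (x @ [y']) - f (x @ [y]) - a (length x) * (y' - y)) \<le> e * norm (y' - y)"
        using d(2)[OF assms(2), of y'] s[of "\<lambda>i t. cmod t" y'] s[of "\<lambda>i t. a i * t" y'] by simp
    qed (use d in simp)
  qed
  then show "\<exists>f'. ((\<lambda>y. f (x @ [y])) has_field_derivative f') (at y within V)" by blast
qed

section \<open>Shrinking cells\<close>

text \<open>Undoes a \<delta>-extension when \<open>s\<close> and \<open>t\<close> are the
  respective values of \<delta>. Two factors are kept because discs and the other types extend by
  different amounts.\<close>

primrec shrink_fiber :: "real \<Rightarrow> real \<Rightarrow> fiber \<Rightarrow> fiber" where
  "shrink_fiber s t Star = Star"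
| "shrink_fiber s t (Disc r) = Disc (\<lambda>x. of_real s * r x)"
| "shrink_fiber s t (PDisc r) = PDisc (\<lambda>x. of_real t * r x)"
| "shrink_fiber s t (IDisc r) = IDisc (\<lambda>x. r x / of_real t)"
| "shrink_fiber s t (Annulus r1 r2) = Annulus (\<lambda>x. r1 x / of_real t) (\<lambda>x. of_real t * r2 x)"

primrec shrink :: "real \<Rightarrow> real \<Rightarrow> ccell \<Rightarrow> ccell" where
  "shrink s t Unit = Unit"
| "shrink s t (C \<odot> \<Phi>) = shrink s t C \<odot> shrink_fiber s t \<Phi>"

definition wide_fiber :: "real \<Rightarrow> complex list set \<Rightarrow> fiber \<Rightarrow> bool" where
  "wide_fiber t X \<Phi> \<longleftrightarrow>
     (\<forall>r1 r2. \<Phi> = Annulus r1 r2 \<longrightarrow> (\<forall>x\<in>X. cmod (r1 x) < t\<^sup>2 * cmod (r2 x)))"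

text \<open>Every annulus has width \<open>t\<^sup>-\<^sup>2\<close> over the whole of its base, so that shrinking by a factor
  \<open>\<ge> t\<close> yields a cell again. For the extension of a cell this is not automatic, since the
  original cell only controls its radii over the smaller base.\<close>

primrec wide :: "real \<Rightarrow> ccell \<Rightarrow> bool" where
  "wide t Unit \<longleftrightarrow> True"
| "wide t (C \<odot> \<Phi>) \<longleftrightarrow> wide t C \<and> wide_fiber t (cell_set C) \<Phi>"

lemma length_cell_set: "x \<in> cell_set C \<Longrightarrow> length x = cell_length C"
  by (induction C arbitrary: x) auto

lemma cell_length_shrink [simp]: "cell_length (shrink s t C) = cell_length C"
  by (induction C) auto

lemma shrink_fiber_subset:
  assumes "0 < s" "s \<le> 1" "0 < t" "t \<le> 1"
  shows "fiber_set (shrink_fiber s t \<Phi>) x \<subseteq> fiber_set \<Phi> x"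
proof -
  have 1: "s * cmod a \<le> cmod a" "t * cmod a \<le> cmod a" "cmod a \<le> cmod a / t" for a
    using assms by (auto simp: mult_left_le_one_le field_simps mult_left_le)
  show ?thesis
  proof (cases \<Phi>)
    case (Annulus r1 r2)
    then show ?thesis using assms 1(2)[of "r2 x"] 1(3)[of "r1 x"]
      by (auto simp: norm_mult norm_divide)
  next
    case (Disc r) then show ?thesis using assms 1(1)[of "r x"] by (auto simp: norm_mult)
  next
    case (PDisc r) then show ?thesis using assms 1(2)[of "r x"] by (auto simp: norm_mult)
  next
    case (IDisc r) then show ?thesis using assms 1(3)[of "r x"] by (auto simp: norm_divide)
  qed simp
qed

lemma shrink_subset:
  assumes "0 < s" "s \<le> 1" "0 < t" "t \<le> 1"
  shows "cell_set (shrink s t C) \<subseteq> cell_set C"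
proof (induction C)
  case (Odot C \<Phi>)
  have "x \<in> cell_set C \<and> y \<in> fiber_set \<Phi> x"
    if "x \<in> cell_set (shrink s t C)" "y \<in> fiber_set (shrink_fiber s t \<Phi>) x" for x y
    using that Odot.IH shrink_fiber_subset[OF assms] by blast
  then show ?case by auto
qed simp

lemma fiber_over_subset: "fiber_over X \<Phi> \<Longrightarrow> Y \<subseteq> X \<Longrightarrow> fiber_over Y \<Phi>"
  unfolding fiber_over_def using holo_on_subset by (metis subsetD)

text \<open>The shrunk annulus has its inner radius below its outer one exactly when
  \<open>cmod (r1 x) < t\<^sup>2 * cmod (r2 x)\<close>, which width \<open>t0\<close> grants for
  every \<open>t\<close> from \<open>t0\<close> on.\<close>

lemma fiber_over_shrink:
  assumes "fiber_over X \<Phi>" "wide_fiber t0 X \<Phi>" "0 < s" "0 < t0" "t0 \<le> t"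
  shows "fiber_over X (shrink_fiber s t \<Phi>)"
proof (cases \<Phi>)
  case (Annulus r1 r2)
  have "cmod (r1 x) / t < t * cmod (r2 x)" if "x \<in> X" for x
  proof -
    have "cmod (r1 x) < t0\<^sup>2 * cmod (r2 x)" using assms(2) that Annulus by (simp add: wide_fiber_def)
    also have "\<dots> \<le> t\<^sup>2 * cmod (r2 x)" using assms by (intro mult_right_mono power_mono) auto
    finally show ?thesis using assms by (simp add: field_simps power2_eq_square)
  qed
  then show ?thesis using assms Annulus
    by (auto simp: fiber_over_def norm_mult norm_divide intro!: holo_on_cmult holo_on_divide_const)
qed (use assms in \<open>auto simp: fiber_over_def intro!: holo_on_cmult holo_on_divide_const\<close>)

lemma is_ccell_shrink:
  assumes "is_ccell C" "wide t0 C" "0 < s" "s \<le> 1" "0 < t0" "t0 \<le> t" "t \<le> 1"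
  shows "is_ccell (shrink s t C)"
  using assms(1,2)
proof (induction C)
  case (Odot C \<Phi>)
  have "cell_set (shrink s t C) \<subseteq> cell_set C" using assms by (intro shrink_subset) auto
  then show ?case using Odot assms
    by (auto intro!: fiber_over_subset[OF fiber_over_shrink, of "cell_set C" \<Phi> t0 s t])
qed simp

lemma wide_fiber_shrink:
  assumes "wide_fiber (t0 * t) X \<Phi>" "0 < t"
  shows "wide_fiber t0 X (shrink_fiber s t \<Phi>)"
proof (cases \<Phi>)
  case (Annulus r1 r2)
  then show ?thesis using assms
    by (auto simp: wide_fiber_def norm_mult norm_divide field_simps power2_eq_square)
qed (auto simp: wide_fiber_def)

lemma wide_fiber_subset: "wide_fiber t X \<Phi> \<Longrightarrow> Y \<subseteq> X \<Longrightarrow> wide_fiber t Y \<Phi>"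
  unfolding wide_fiber_def by blast

lemma wide_shrink:
  assumes "wide (t0 * t) C" "0 < s" "s \<le> 1" "0 < t" "t \<le> 1"
  shows "wide t0 (shrink s t C)"
  using assms(1)
proof (induction C)
  case (Odot C \<Phi>)
  then show ?case
    using wide_fiber_subset[OF wide_fiber_shrink shrink_subset] assms(2-5) by auto
qed simp

text \<open>Because factors multiply, shrinking an extension by the ratios of the \<delta>-values of
  two parameters changes its parameter without changing the core.\<close>

lemma shrink_shrink: "shrink s t (shrink s' t' C) = shrink (s * s') (t * t') C"
proof -
  have "shrink_fiber s t (shrink_fiber s' t' \<Phi>) = shrink_fiber (s * s') (t * t') \<Phi>" for \<Phi>
    by (cases \<Phi>) (auto simp: mult.assoc divide_divide_eq_left mult.commute)
  then show ?thesis by (induction C) auto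
qed

section \<open>Sizes of the extensions and the core of an extended cell\<close>

definition disc_delta :: "real \<Rightarrow> real" where
  "disc_delta \<rho> = (sqrt (pi\<^sup>2 + \<rho>\<^sup>2) - pi) / \<rho>"

definition ann_delta :: "real \<Rightarrow> real" where
  "ann_delta \<rho> = exp (- (pi\<^sup>2 / (2 * \<rho>)))"

abbreviation core :: "real \<Rightarrow> ccell \<Rightarrow> ccell" where
  "core \<sigma> \<equiv> shrink (disc_delta \<sigma>) (ann_delta \<sigma>)"

abbreviation core_fiber :: "real \<Rightarrow> fiber \<Rightarrow> fiber" where
  "core_fiber \<sigma> \<equiv> shrink_fiber (disc_delta \<sigma>) (ann_delta \<sigma>)"

lemma disc_delta_alt: "0 < \<rho> \<Longrightarrow> disc_delta \<rho> = \<rho> / (sqrt (pi\<^sup>2 + \<rho>\<^sup>2) + pi)"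
proof -
  assume "0 < \<rho>"
  have "(sqrt (pi\<^sup>2 + \<rho>\<^sup>2) - pi) * (sqrt (pi\<^sup>2 + \<rho>\<^sup>2) + pi) = \<rho>\<^sup>2"
    by (simp add: algebra_simps flip: power2_eq_square)
  moreover have "0 < sqrt (pi\<^sup>2 + \<rho>\<^sup>2) + pi" by (simp add: add_nonneg_pos)
  ultimately show ?thesis using \<open>0 < \<rho>\<close> unfolding disc_delta_def
    by (simp add: field_simps power2_eq_square)
qed

text \<open>Rational substitutes for the square root: the first bounds
  \<open>1 / disc_delta \<rho>\<close> polynomially, the second makes it small for small \<rho>, the
  third keeps it away from 1 for large \<rho>.\<close>

lemma disc_delta_bounds:
  assumes "0 < \<rho>"
  shows "\<rho> / (2 * pi + \<rho>) \<le> disc_delta \<rho>" "disc_delta \<rho> \<le> \<rho> / (2 * pi)"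
    "disc_delta \<rho> \<le> (pi + \<rho>) / (2 * pi + \<rho>)"
proof -
  have u: "sqrt (pi\<^sup>2 + \<rho>\<^sup>2) \<le> pi + \<rho>"
    using assms by (intro real_le_lsqrt) (auto simp: power2_eq_square algebra_simps)
  have l: "pi \<le> sqrt (pi\<^sup>2 + \<rho>\<^sup>2)" "\<rho> \<le> sqrt (pi\<^sup>2 + \<rho>\<^sup>2)"
    using assms by (auto intro!: real_le_rsqrt)
  have pos: "0 < sqrt (pi\<^sup>2 + \<rho>\<^sup>2) + pi" using l(1) pi_gt_zero by linarith
  show "\<rho> / (2 * pi + \<rho>) \<le> disc_delta \<rho>"
    unfolding disc_delta_alt[OF assms] using u l pos assms pi_gt_zero by (intro divide_left_mono mult_pos_pos) auto
  show "disc_delta \<rho> \<le> \<rho> / (2 * pi)"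
    unfolding disc_delta_alt[OF assms] using u l pos assms pi_gt_zero by (intro divide_left_mono mult_pos_pos) auto
  have "disc_delta \<rho> \<le> \<rho> / (\<rho> + pi)"
    unfolding disc_delta_alt[OF assms] using u l pos assms pi_gt_zero by (intro divide_left_mono mult_pos_pos) auto
  also have "\<dots> \<le> (pi + \<rho>) / (2 * pi + \<rho>)"
  proof -
    have p: "0 < \<rho> + pi" "0 < 2 * pi + \<rho>" using assms pi_gt_zero by linarith+
    have "\<rho> * (2 * pi + \<rho>) \<le> (pi + \<rho>) * (\<rho> + pi)" by (simp add: algebra_simps)
    then show ?thesis using p by (simp add: divide_le_eq pos_le_divide_eq)
  qed
  finally show "disc_delta \<rho> \<le> (pi + \<rho>) / (2 * pi + \<rho>)" .
qed

lemma disc_delta_pos: "0 < \<rho> \<Longrightarrow> 0 < disc_delta \<rho>"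
  by (simp add: disc_delta_alt add_nonneg_pos)

lemma disc_delta_less_1:
  assumes "0 < \<rho>" shows "disc_delta \<rho> < 1"
proof -
  have "(pi + \<rho>) / (2 * pi + \<rho>) < 1" using assms pi_gt_zero by (subst divide_less_eq_1_pos) linarith+
  then show ?thesis using disc_delta_bounds(3)[OF assms] by linarith
qed

lemma ann_delta_pos: "0 < ann_delta \<rho>"
  by (simp add: ann_delta_def)

lemma ann_delta_less_1: "0 < \<rho> \<Longrightarrow> ann_delta \<rho> < 1"
  by (simp add: ann_delta_def)

lemma ann_delta_less: "0 < \<sigma> \<Longrightarrow> \<sigma> < \<rho> \<Longrightarrow> ann_delta \<sigma> < ann_delta \<rho>"
  by (simp add: ann_delta_def frac_less2)

lemma disc_delta_less:
  assumes "0 < \<sigma>" "\<sigma> < \<rho>"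
  shows "disc_delta \<sigma> < disc_delta \<rho>"
proof -
  \<comment> \<open>In this form both summands of the denominator visibly decrease as
    \<open>r\<close> grows.\<close>
  have eq: "disc_delta r = 1 / (sqrt (pi\<^sup>2 / r\<^sup>2 + 1) + pi / r)" if "0 < r" for r
  proof -
    have "sqrt (pi\<^sup>2 / r\<^sup>2 + 1) = sqrt ((pi\<^sup>2 + r\<^sup>2) / r\<^sup>2)" using that by (simp add: add_divide_distrib)
    also have "\<dots> = sqrt (pi\<^sup>2 + r\<^sup>2) / r" using that by (simp add: real_sqrt_divide)
    finally have "sqrt (pi\<^sup>2 / r\<^sup>2 + 1) + pi / r = (sqrt (pi\<^sup>2 + r\<^sup>2) + pi) / r"
      by (simp add: add_divide_distrib)
    then show ?thesis using that by (simp add: disc_delta_alt)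
  qed
  have r: "pi / \<rho> < pi / \<sigma>" using assms by (simp add: frac_less2)
  have "pi\<^sup>2 / \<rho>\<^sup>2 < pi\<^sup>2 / \<sigma>\<^sup>2" using assms by (intro divide_strict_left_mono power_strict_mono) auto
  then have "sqrt (pi\<^sup>2 / \<rho>\<^sup>2 + 1) + pi / \<rho> < sqrt (pi\<^sup>2 / \<sigma>\<^sup>2 + 1) + pi / \<sigma>"
    using r by (intro add_strict_mono) auto
  moreover have "0 < sqrt (pi\<^sup>2 / \<rho>\<^sup>2 + 1) + pi / \<rho>" using assms by (intro add_nonneg_pos) auto
  ultimately show ?thesis using assms by (simp add: eq divide_strict_left_mono)
qed

text \<open>The extended cell is the primary object and the cell is recovered by shrinking it; the
  width of its annuli over the whole extended base makes the core a cell.\<close>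

lemma is_extension_core:
  assumes "0 < \<sigma>" "is_ccell E" "wide (ann_delta \<sigma>) E"
  shows "is_extension \<sigma> (core \<sigma> E) E"
proof -
  have d: "ext_delta \<sigma> (Disc r) = disc_delta \<sigma>" "ext_delta \<sigma> (PDisc r) = ann_delta \<sigma>"
    "ext_delta \<sigma> (IDisc r) = ann_delta \<sigma>" "ext_delta \<sigma> (Annulus r r') = ann_delta \<sigma>" for r r'
    by (auto simp: disc_delta_def ann_delta_def)
  have "extends_cell \<sigma> (core \<sigma> E) E"
  proof (induction E)
    case (Odot E \<Phi>)
    then show ?case using disc_delta_pos[OF assms(1)] ann_delta_pos[of \<sigma>]
      by (cases \<Phi>) (auto simp: d simp del: ext_delta.simps)
  qed simp
  moreover have "is_ccell (core \<sigma> E)"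
    using assms disc_delta_pos disc_delta_less_1 ann_delta_pos ann_delta_less_1
    by (intro is_ccell_shrink[of E "ann_delta \<sigma>"]) (auto intro: less_imp_le)
  ultimately show ?thesis using assms by (auto simp: is_extension_def)
qed

section \<open>Harnack inequality on fibers and on cells\<close>

primrec closed_fiber :: "real \<Rightarrow> real \<Rightarrow> fiber \<Rightarrow> complex list \<Rightarrow> complex set" where
  "closed_fiber s t Star x = {0}"
| "closed_fiber s t (Disc r) x = {z. cmod z \<le> s * cmod (r x)}"
| "closed_fiber s t (PDisc r) x = {z. 0 < cmod z \<and> cmod z \<le> t * cmod (r x)}"
| "closed_fiber s t (IDisc r) x = {z. cmod (r x) / t \<le> cmod z}"
| "closed_fiber s t (Annulus r1 r2) x = {z. cmod (r1 x) / t \<le> cmod z \<and> cmod z \<le> t * cmod (r2 x)}"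

text \<open>A point of the fiber depending holomorphically on the base point. For
  \<open>PDisc\<close>, \<open>IDisc\<close> and \<open>Annulus\<close> it lies on a circle bounding
  the shrunk fiber, which is why \<open>closed_fiber\<close> includes these circles.\<close>

primrec fiber_section :: "real \<Rightarrow> fiber \<Rightarrow> complex list \<Rightarrow> complex" where
  "fiber_section t Star x = 0"
| "fiber_section t (Disc r) x = 0"
| "fiber_section t (PDisc r) x = of_real t * r x"
| "fiber_section t (IDisc r) x = r x / of_real t"
| "fiber_section t (Annulus r1 r2) x = r1 x / of_real t"

lemma fiber_set_shrink_subset_closed:
  "0 \<le> s \<Longrightarrow> 0 < t \<Longrightarrow> fiber_set (shrink_fiber s t \<Phi>) x \<subseteq> closed_fiber s t \<Phi> x"
  by (cases \<Phi>) (auto simp: norm_mult norm_divide)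

lemma closed_fiber_subset:
  assumes "fiber_over X \<Phi>" "x \<in> X" "0 < s" "s < 1" "0 < t" "t < 1"
  shows "closed_fiber s t \<Phi> x \<subseteq> fiber_set \<Phi> x"
proof -
  have 1: "s * cmod a < cmod a" "t * cmod a < cmod a" "cmod a < cmod a / t" if "a \<noteq> 0" for a
    using assms that by (auto simp: field_simps)
  show ?thesis using assms(1,2)
  proof (cases \<Phi>)
    case (Annulus r1 r2)
    then have "r1 x \<noteq> 0" "r2 x \<noteq> 0" using assms by (auto simp: fiber_over_def)
    then show ?thesis unfolding Annulus closed_fiber.simps fiber_set.simps
      using 1(2)[of "r2 x"] 1(3)[of "r1 x"] by (blast intro: le_less_trans less_le_trans)
  next
    case (Disc r)
    then have "r x \<noteq> 0" using assms by (auto simp: fiber_over_def)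
    then show ?thesis unfolding Disc closed_fiber.simps fiber_set.simps
      using 1(1)[of "r x"] by (blast intro: le_less_trans)
  next
    case (PDisc r)
    then have "r x \<noteq> 0" using assms by (auto simp: fiber_over_def)
    then show ?thesis unfolding PDisc closed_fiber.simps fiber_set.simps
      using 1(2)[of "r x"] by (blast intro: le_less_trans)
  next
    case (IDisc r)
    then have "r x \<noteq> 0" using assms by (auto simp: fiber_over_def)
    then show ?thesis unfolding IDisc closed_fiber.simps fiber_set.simps
      using 1(3)[of "r x"] by (blast intro: less_le_trans)
  qed simp
qed

lemma fiber_section_in_closed_fiber:
  assumes "fiber_over X \<Phi>" "wide_fiber t X \<Phi>" "x \<in> X" "0 < s" "0 < t"
  shows "fiber_section t \<Phi> x \<in> closed_fiber s t \<Phi> x"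
proof (cases \<Phi>)
  case (Annulus r1 r2)
  then have "cmod (r1 x) < t\<^sup>2 * cmod (r2 x)" using assms by (auto simp: wide_fiber_def)
  then show ?thesis using Annulus assms
    by (simp add: norm_divide field_simps power2_eq_square)
qed (use assms in \<open>auto simp: fiber_over_def norm_mult norm_divide\<close>)

lemma holo_on_fiber_section:
  assumes "fiber_over X \<Phi>"
  shows "holo_on X (fiber_section t \<Phi>)"
proof -
  have "holo_on X (\<lambda>x. fiber_section t \<Phi> x)"
    using assms by (cases \<Phi>)
      (simp_all add: fiber_over_def holo_on_const holo_on_cmult holo_on_divide_const)
  then show ?thesis .
qed

lemma harnack_fiber:
  assumes "fiber_over X \<Phi>" "x \<in> X"
    and hol: "P holomorphic_on fiber_set \<Phi> x" "Q holomorphic_on fiber_set \<Phi> x"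
    and PQ: "\<And>y. y \<in> fiber_set \<Phi> x \<Longrightarrow> 0 < cmod (P y) \<and> cmod (P y) < cmod (Q y)"
    and st: "0 < s" "s < 1" "0 < t" "t < 1"
    and T: "0 < T" "2 * pi + 2 * T \<le> - ln t" "2 * pi / T \<le> \<eta>" "2 * s / (1 - s) \<le> \<eta>" "\<eta> < 1"
    and y: "y1 \<in> closed_fiber s t \<Phi> x" "y2 \<in> closed_fiber s t \<Phi> x"
  shows "min (ln (cmod (Q y1) / cmod (P y1))) T \<le> harnack_factor \<eta> * ln (cmod (Q y2) / cmod (P y2))"
proof -
  define h where "h = (\<lambda>y. P y / Q y)"
  have yf: "y1 \<in> fiber_set \<Phi> x" "y2 \<in> fiber_set \<Phi> x"
    using y closed_fiber_subset[OF assms(1,2) st] by auto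
  have Qnz: "Q y \<noteq> 0" if "y \<in> fiber_set \<Phi> x" for y using PQ[OF that] by auto
  have hh: "h holomorphic_on fiber_set \<Phi> x"
    unfolding h_def using hol Qnz by (intro holomorphic_on_divide) auto
  have hb: "0 < cmod (h y) \<and> cmod (h y) < 1" if "y \<in> fiber_set \<Phi> x" for y
    using PQ[OF that] Qnz[OF that] by (auto simp: h_def norm_divide)
  have hl: "ln (cmod (Q y) / cmod (P y)) = - ln (cmod (h y))" if "y \<in> fiber_set \<Phi> x" for y
    using PQ[OF that] Qnz[OF that] by (simp add: h_def norm_divide ln_div)
  have \<eta>: "0 < \<eta>" using T pi_gt_zero by (smt (verit) divide_pos_pos)
  \<comment> \<open>In the coordinate \<open>Ln y\<close> the fiber becomes a half plane or a strip,
    and points of the closed shrunk fiber keep the distance \<open>- ln t\<close> from its boundary.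
    This is the radius handed to \<open>harnack_annulus\<close>.\<close>
  have annular: ?thesis
    if W: "convex W" "open W" "exp ` W \<subseteq> fiber_set \<Phi> x"
      "\<And>z. z \<in> W \<Longrightarrow> z + of_real (2 * pi) * \<i> \<in> W"
      and b: "ball (Ln y1) (- ln t) \<subseteq> W" "ball (Ln y2) (- ln t) \<subseteq> W" and nz: "y1 \<noteq> 0" "y2 \<noteq> 0" for W
  proof -
    have "min (- ln (cmod (h (exp (Ln y1))))) T \<le> harnack_factor \<eta> * - ln (cmod (h (exp (Ln y2))))"
      by (rule harnack_annulus[OF W(1,2,4) _ _ T(1-3) T(5) b])
         (use W(3) hh hb in \<open>auto intro: holomorphic_on_subset\<close>)
    then show ?thesis using nz hl yf by simp
  qed
  have exp_less_iff: "exp a < c \<longleftrightarrow> a < ln c" and less_exp_iff: "c < exp a \<longleftrightarrow> ln c < a"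
    if "0 < c" for a c :: real
    using that by (metis exp_less_cancel_iff exp_ln)+
  have ReLn: "\<bar>Re z - ln (cmod y)\<bar> < - ln t" if "z \<in> ball (Ln y) (- ln t)" "y \<noteq> 0" for z y
    using that abs_Re_le_cmod[of "z - Ln y"] by (simp add: dist_norm norm_minus_commute)
  have ball_lt: "ball (Ln y) (- ln t) \<subseteq> {z. Re z < a}" if "y \<noteq> 0" "ln (cmod y) \<le> ln t + a" for y a
  proof
    fix z assume "z \<in> ball (Ln y) (- ln t)"
    then show "z \<in> {z. Re z < a}" using ReLn[of z y] that by simp
  qed
  have ball_gt: "ball (Ln y) (- ln t) \<subseteq> {z. Re z > a}" if "y \<noteq> 0" "a - ln t \<le> ln (cmod y)" for y a
  proof
    fix z assume "z \<in> ball (Ln y) (- ln t)"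
    then show "z \<in> {z. Re z > a}" using ReLn[of z y] that by simp
  qed
  show ?thesis
  proof (cases \<Phi>)
    case Star
    then have "y1 = 0" "y2 = 0" using y by auto
    moreover have "1 \<le> harnack_factor \<eta>" using \<eta> T by (simp add: harnack_factor_ge_1)
    moreover have "0 < ln (cmod (Q y2) / cmod (P y2))"
      using PQ[OF yf(2)] by (intro ln_gt_zero) auto
    ultimately show ?thesis by (metis min.coboundedI1 mult_le_cancel_right1 less_imp_le not_le)
  next
    case (Disc r)
    have r: "0 < cmod (r x)" using assms(1,2) Disc by (auto simp: fiber_over_def)
    have fs: "fiber_set \<Phi> x = ball 0 (cmod (r x))" using Disc by auto
    have "- ln (cmod (h y1)) \<le> harnack_factor \<eta> * - ln (cmod (h y2))"
      by (rule harnack_disc[of h "cmod (r x)" s]) (use hh hb fs r st T y Disc in auto)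
    then show ?thesis using hl yf by simp
  next
    case (PDisc r)
    have r: "0 < cmod (r x)" using assms(1,2) PDisc by (auto simp: fiber_over_def)
    have up: "ln (cmod v) \<le> ln t + ln (cmod (r x))" if "v \<in> closed_fiber s t \<Phi> x" for v
    proof -
      have "ln (cmod v) \<le> ln (t * cmod (r x))" using that PDisc r st by simp
      then show ?thesis using r st by (simp add: ln_mult)
    qed
    show ?thesis
    proof (rule annular[of "{z. Re z < ln (cmod (r x))}"])
      show "exp ` {z. Re z < ln (cmod (r x))} \<subseteq> fiber_set \<Phi> x"
        using PDisc r by (auto simp: norm_exp_eq_Re exp_less_iff less_exp_iff)
      show nz: "y1 \<noteq> 0" "y2 \<noteq> 0" using y PDisc by auto
      show "ball (Ln y1) (- ln t) \<subseteq> {z. Re z < ln (cmod (r x))}" "ball (Ln y2) (- ln t) \<subseteq> {z. Re z < ln (cmod (r x))}"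
        using ball_lt nz up y by blast+
    qed (auto simp: convex_halfspace_Re_lt open_halfspace_Re_lt)
  next
    case (IDisc r)
    have r: "0 < cmod (r x)" using assms(1,2) IDisc by (auto simp: fiber_over_def)
    have lo: "v \<noteq> 0 \<and> ln (cmod (r x)) - ln t \<le> ln (cmod v)" if "v \<in> closed_fiber s t \<Phi> x" for v
    proof -
      have v: "cmod (r x) / t \<le> cmod v" using that IDisc by simp
      moreover have "0 < cmod (r x) / t" using r st by simp
      ultimately have "ln (cmod (r x) / t) \<le> ln (cmod v)" "0 < cmod v"
        by (metis ln_mono, linarith)
      then show ?thesis using r st by (auto simp: ln_div)
    qed
    show ?thesis
    proof (rule annular[of "{z. Re z > ln (cmod (r x))}"])
      show "exp ` {z. Re z > ln (cmod (r x))} \<subseteq> fiber_set \<Phi> x"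
        using IDisc r by (auto simp: norm_exp_eq_Re exp_less_iff less_exp_iff)
      show nz: "y1 \<noteq> 0" "y2 \<noteq> 0" using lo y by blast+
      show "ball (Ln y1) (- ln t) \<subseteq> {z. Re z > ln (cmod (r x))}" "ball (Ln y2) (- ln t) \<subseteq> {z. Re z > ln (cmod (r x))}"
        using ball_gt lo y by blast+
    qed (auto simp: convex_halfspace_Re_gt open_halfspace_Re_gt)
  next
    case (Annulus r1 r2)
    have r: "0 < cmod (r1 x)" "0 < cmod (r2 x)" using assms(1,2) Annulus by (auto simp: fiber_over_def)
    let ?W = "{z. Re z > ln (cmod (r1 x))} \<inter> {z. Re z < ln (cmod (r2 x))}"
    have lo: "v \<noteq> 0 \<and> ln (cmod (r1 x)) - ln t \<le> ln (cmod v) \<and> ln (cmod v) \<le> ln t + ln (cmod (r2 x))"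
      if "v \<in> closed_fiber s t \<Phi> x" for v
    proof -
      have v: "cmod (r1 x) / t \<le> cmod v" "cmod v \<le> t * cmod (r2 x)" using that Annulus by auto
      moreover have "0 < cmod (r1 x) / t" using r st by simp
      ultimately have "ln (cmod (r1 x) / t) \<le> ln (cmod v)" "0 < cmod v" "ln (cmod v) \<le> ln (t * cmod (r2 x))"
        by (metis ln_mono, linarith, metis ln_mono order_less_le_trans)
      then show ?thesis using r st by (auto simp: ln_div ln_mult)
    qed
    show ?thesis
    proof (rule annular[of ?W])
      show "exp ` ?W \<subseteq> fiber_set \<Phi> x"
        using Annulus r by (auto simp: norm_exp_eq_Re exp_less_iff less_exp_iff)
      show nz: "y1 \<noteq> 0" "y2 \<noteq> 0" using lo y by blast+
      show "ball (Ln y1) (- ln t) \<subseteq> ?W" "ball (Ln y2) (- ln t) \<subseteq> ?W"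
        using ball_lt ball_gt lo y by (meson Int_greatest)+
      show "convex ?W" by (intro convex_Int convex_halfspace_Re_gt convex_halfspace_Re_lt)
      show "open ?W" by (intro open_Int open_halfspace_Re_gt open_halfspace_Re_lt)
    qed auto
  qed
qed

text \<open>Truncated inequalities can be chained because a factor of at least 1 never lowers the
  truncation level below \<open>T\<close>.\<close>

lemma min_le_trans_mult:
  fixes u v T a b :: real
  assumes "min u T \<le> a * v" "min v T \<le> b * w" "1 \<le> a" "1 \<le> b" "0 < T"
  shows "min u T \<le> a * b * w"
proof -
  have "T \<le> a * T" using assms(3,5) by simp
  then have "min u T \<le> a * min v T" using assms(1) unfolding min_def by (auto split: if_splits)
  also have "\<dots> \<le> a * (b * w)" using assms by (intro mult_left_mono) auto
  finally show ?thesis by (simp add: mult.assoc)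
qed

text \<open>Move inside the fiber to a section, along the base, and back.\<close>

lemma harnack_cell:
  assumes "is_ccell E" "wide t E"
    and "holo_on (cell_set E) p" "holo_on (cell_set E) q"
    and "\<And>x. x \<in> cell_set E \<Longrightarrow> 0 < cmod (p x) \<and> cmod (p x) < cmod (q x)"
    and st: "0 < s" "s < 1" "0 < t" "t < 1"
    and T: "0 < T" "2 * pi + 2 * T \<le> - ln t" "2 * pi / T \<le> \<eta>" "2 * s / (1 - s) \<le> \<eta>" "\<eta> < 1"
    and "x1 \<in> cell_set (shrink s t E)" "x2 \<in> cell_set (shrink s t E)"
  shows "min (ln (cmod (q x1) / cmod (p x1))) T
    \<le> harnack_factor \<eta> ^ (2 * cell_length E) * ln (cmod (q x2) / cmod (p x2))"
  using assms(1-5,15,16)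
proof (induction E arbitrary: p q x1 x2)
  case Unit
  then show ?case by simp
next
  case (Odot E \<Phi>)
  have \<eta>: "0 < \<eta>" using T pi_gt_zero by (smt (verit) divide_pos_pos)
  let ?k = "harnack_factor \<eta>"
  have k: "1 \<le> ?k" "1 \<le> ?k ^ n" for n using \<eta> T by (simp_all add: harnack_factor_ge_1)
  have fo: "fiber_over (cell_set E) \<Phi>" and wf: "wide_fiber t (cell_set E) \<Phi>" using Odot.prems by auto
  obtain b1 y1 where x1: "x1 = b1 @ [y1]" "b1 \<in> cell_set (shrink s t E)" "y1 \<in> fiber_set (shrink_fiber s t \<Phi>) b1"
    using Odot.prems(6) by auto
  obtain b2 y2 where x2: "x2 = b2 @ [y2]" "b2 \<in> cell_set (shrink s t E)" "y2 \<in> fiber_set (shrink_fiber s t \<Phi>) b2"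
    using Odot.prems(7) by auto
  have sub: "cell_set (shrink s t E) \<subseteq> cell_set E" using st by (intro shrink_subset) auto
  have bE: "b1 \<in> cell_set E" "b2 \<in> cell_set E" using x1 x2 sub by auto
  \<comment> \<open>The section lifts the base into the cell, so \<open>p\<close> and
    \<open>q\<close> restrict to functions on the base to which the induction hypothesis
    applies.\<close>
  define g where "g = (\<lambda>x. x @ [fiber_section t \<Phi> x])"
  have sc: "fiber_section t \<Phi> x \<in> closed_fiber s t \<Phi> x" if "x \<in> cell_set E" for x
    using fiber_section_in_closed_fiber[OF fo wf that st(1) st(3)] .
  have gE: "g x \<in> cell_set (E \<odot> \<Phi>)" if "x \<in> cell_set E" for x
    using sc[OF that] closed_fiber_subset[OF fo that st] that by (auto simp: g_def)
  have gh: "holo_on (cell_set E) (\<lambda>z. g z ! j)" if "j < Suc (cell_length E)" for j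
  proof (cases "j = cell_length E")
    case True
    have "holo_on (cell_set E) (\<lambda>z. fiber_section t \<Phi> z)" by (rule holo_on_fiber_section[OF fo])
    then show ?thesis using True length_cell_set
      by (subst holo_on_cong[of _ _ "fiber_section t \<Phi>"]) (auto simp: g_def nth_append)
  next
    case False
    then have "holo_on (cell_set E) (\<lambda>z. z ! j)" using that length_cell_set by (intro holo_on_nth) fastforce
    then show ?thesis using False that length_cell_set
      by (subst holo_on_cong[of _ _ "\<lambda>z. z ! j"]) (auto simp: g_def nth_append)
  qed
  have comp: "holo_on (cell_set E) (\<lambda>z. h (g z))" if "holo_on (cell_set (E \<odot> \<Phi>)) h" for h
    by (rule holo_on_compose[OF that gE _ gh]) (auto simp: g_def length_cell_set)
  have fib: "min (ln (cmod (q (b @ [y])) / cmod (p (b @ [y])))) T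
      \<le> ?k * ln (cmod (q (b @ [y'])) / cmod (p (b @ [y'])))"
    if "b \<in> cell_set E" "y \<in> closed_fiber s t \<Phi> b" "y' \<in> closed_fiber s t \<Phi> b" for b y y'
  proof (rule harnack_fiber[OF fo that(1) _ _ _ st T that(2,3)])
    show "(\<lambda>y. p (b @ [y])) holomorphic_on fiber_set \<Phi> b" "(\<lambda>y. q (b @ [y])) holomorphic_on fiber_set \<Phi> b"
      using that(1) by (auto intro!: holo_on_imp_holomorphic_on_fiber[OF Odot.prems(3)]
          holo_on_imp_holomorphic_on_fiber[OF Odot.prems(4)])
    show "0 < cmod (p (b @ [y])) \<and> cmod (p (b @ [y])) < cmod (q (b @ [y]))" if "y \<in> fiber_set \<Phi> b" for y
      using Odot.prems(5) \<open>b \<in> cell_set E\<close> that by auto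
  qed
  have y: "y1 \<in> closed_fiber s t \<Phi> b1" "y2 \<in> closed_fiber s t \<Phi> b2"
    using x1(3) x2(3) fiber_set_shrink_subset_closed[of s t \<Phi>] st by (meson less_imp_le subsetD)+
  have 1: "min (ln (cmod (q x1) / cmod (p x1))) T \<le> ?k * ln (cmod (q (g b1)) / cmod (p (g b1)))"
    using fib[OF bE(1) y(1) sc[OF bE(1)]] by (simp add: x1 g_def)
  have 2: "min (ln (cmod (q (g b1)) / cmod (p (g b1)))) T
      \<le> ?k ^ (2 * cell_length E) * ln (cmod (q (g b2)) / cmod (p (g b2)))"
    using Odot.prems(1,2,5) x1 x2 gE
    by (intro Odot.IH comp Odot.prems(3,4)) auto
  have 3: "min (ln (cmod (q (g b2)) / cmod (p (g b2)))) T \<le> ?k * ln (cmod (q x2) / cmod (p x2))"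
    using fib[OF bE(2) sc[OF bE(2)] y(2)] by (simp add: x2 g_def)
  \<comment> \<open>The two moves inside a fiber contribute one factor each, whence the exponent
    \<open>2 * cell_length\<close>.\<close>
  have "1 \<le> ?k * ?k ^ (2 * cell_length E)" using k mult_mono[of 1 ?k 1 "?k ^ (2 * cell_length E)"] by simp
  then have "min (ln (cmod (q x1) / cmod (p x1))) T
      \<le> ?k * ?k ^ (2 * cell_length E) * ?k * ln (cmod (q x2) / cmod (p x2))"
    by (intro min_le_trans_mult[OF min_le_trans_mult[OF 1 2] 3] k T)
  then show ?case by (simp add: mult_ac)
qed

section \<open>Real polynomials as lists of monomials\<close>

definition monomials_eval :: "(real \<times> nat list) list \<Rightarrow> real list \<Rightarrow> real" where
  "monomials_eval ms x = (\<Sum>(k, \<alpha>)\<leftarrow>ms. k * (\<Prod>i<length x. (x ! i) ^ (\<alpha> ! i)))"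

lemma mpoly_eval_superset:
  assumes "finite B" "{\<alpha>. c \<alpha> \<noteq> 0} \<subseteq> B"
  shows "mpoly_eval c x = (\<Sum>\<alpha>\<in>B. c \<alpha> * (\<Prod>i<length x. (x ! i) ^ (\<alpha> ! i)))"
  unfolding mpoly_eval_def using assms by (intro sum.mono_neutral_left) auto

lemma mpoly_of_monomials:
  assumes "\<forall>(k, \<alpha>)\<in>set ms. length \<alpha> = n \<and> sum_list \<alpha> \<le> d"
  shows "\<exists>c. is_mpoly n c \<and> mpoly_degree c \<le> d \<and> (\<forall>x. mpoly_eval c x = monomials_eval ms x)"
  using assms
proof (induction ms)
  case Nil
  show ?case
    by (rule exI[of _ "\<lambda>_. 0"]) (auto simp: is_mpoly_def mpoly_degree_def mpoly_eval_def monomials_eval_def)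
next
  case (Cons m ms)
  obtain k \<alpha> where m: "m = (k, \<alpha>)" by force
  obtain c where c: "is_mpoly n c" "mpoly_degree c \<le> d" "\<And>x. mpoly_eval c x = monomials_eval ms x"
    using Cons by auto
  \<comment> \<open>Adding \<open>k\<close> to the old coefficient allows repeated exponents in the
    list. As it may cancel, the support is only contained in \<open>?B\<close> and the degree only
    bounded.\<close>
  let ?c = "c(\<alpha> := c \<alpha> + k)"
  let ?B = "insert \<alpha> {\<beta>. c \<beta> \<noteq> 0}"
  have fin: "finite ?B" using c(1) by (simp add: is_mpoly_def)
  have sub: "{\<beta>. ?c \<beta> \<noteq> 0} \<subseteq> ?B" by auto
  have "is_mpoly n ?c"
    using c(1) Cons.prems m finite_subset[OF sub fin] by (auto simp: is_mpoly_def split: if_splits)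
  moreover have "mpoly_degree ?c \<le> d"
  proof -
    have "sum_list \<beta> \<le> d" if "c \<beta> \<noteq> 0" for \<beta>
      using c(1,2) that unfolding mpoly_degree_def is_mpoly_def by (subst (asm) Max_le_iff) auto
    then show ?thesis
      unfolding mpoly_degree_def using finite_subset[OF sub fin] Cons.prems m
      by (subst Max_le_iff) (auto split: if_splits)
  qed
  moreover have "mpoly_eval ?c x = monomials_eval (m # ms) x" for x
  proof -
    let ?t = "\<lambda>\<beta>. \<Prod>i<length x. (x ! i) ^ (\<beta> ! i)"
    have "mpoly_eval ?c x = (\<Sum>\<beta>\<in>?B. ?c \<beta> * ?t \<beta>)" using mpoly_eval_superset[OF fin sub] .
    also have "\<dots> = (\<Sum>\<beta>\<in>?B. c \<beta> * ?t \<beta> + (if \<beta> = \<alpha> then k * ?t \<alpha> else 0))"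
      by (intro sum.cong) (auto simp: algebra_simps)
    also have "\<dots> = mpoly_eval c x + k * ?t \<alpha>"
      unfolding sum.distrib mpoly_eval_superset[OF fin subset_insertI] using fin by (simp add: sum.delta)
    finally show ?thesis using c(3) m by (simp add: monomials_eval_def)
  qed
  ultimately show ?case by blast
qed

section \<open>Identification of complex with real coordinates\<close>

lemma realify_Nil [simp]: "realify [] = []"
  and realify_Cons [simp]: "realify (z # zs) = Re z # Im z # realify zs"
  by (simp_all add: realify_def)

lemma realify_append: "realify (z @ w) = realify z @ realify w"
  by (simp add: realify_def)

lemma length_realify [simp]: "length (realify z) = 2 * length z"
  by (induction z) auto

lemma nth_realify:
  "i < length z \<Longrightarrow> realify z ! (2 * i) = Re (z ! i)"
  "i < length z \<Longrightarrow> realify z ! Suc (2 * i) = Im (z ! i)"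
proof (induction z arbitrary: i)
  case (Cons a z)
  { case 1 then show ?case using Cons.IH by (cases i) auto }
  { case 2 then show ?case using Cons.IH by (cases i) auto }
qed auto

lemma inj_realify: "inj realify"
proof
  fix x y assume "realify x = realify y"
  then show "x = y"
  proof (induction x arbitrary: y)
    case Nil then show ?case by (cases y) auto
  next
    case (Cons a x)
    then show ?case by (cases y) (auto simp: complex_eq_iff)
  qed
qed

lemma realify_image_iff: "realify z \<in> realify ` A \<longleftrightarrow> z \<in> A"
  using inj_realify by (auto dest: injD)

lemma realify_surj: "length x = 2 * n \<Longrightarrow> \<exists>z. length z = n \<and> realify z = x"
proof (induction n arbitrary: x)
  case (Suc n)
  then obtain a b y where x: "x = a # b # y" by (auto simp: length_Suc_conv numeral_2_eq_2)
  then have "length y = 2 * n" using Suc by simp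
  then obtain z where "length z = n" "realify z = y" using Suc.IH by blast
  then show ?case using x by (intro exI[of _ "Complex a b # z"]) simp
qed simp

lemma realify_Collect:
  "realify ` {z. length z = n \<and> P z} = {x \<in> Rn (2 * n). \<forall>z. x = realify z \<longrightarrow> P z}"
proof (intro set_eqI iffI)
  fix x assume "x \<in> realify ` {z. length z = n \<and> P z}"
  then show "x \<in> {x \<in> Rn (2 * n). \<forall>z. x = realify z \<longrightarrow> P z}"
    using injD[OF inj_realify] by (auto simp: Rn_def)
next
  fix x assume "x \<in> {x \<in> Rn (2 * n). \<forall>z. x = realify z \<longrightarrow> P z}"
  then show "x \<in> realify ` {z. length z = n \<and> P z}"
    using realify_surj[of x n] by (auto simp: Rn_def)
qed

lemma map_nth_realify:
  assumes "\<forall>i\<in>set is. i < length z"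
  shows "map ((!) (realify z)) (concat (map (\<lambda>i. [2 * i, Suc (2 * i)]) is)) = realify (map ((!) z) is)"
  using assms by (induction "is") (auto simp: nth_realify)

lemma map_nth_upt: "j \<le> length z \<Longrightarrow> map ((!) z) [i..<j] = take (j - i) (drop i z)"
  by (rule nth_equalityI) auto

section \<open>Sets of bounded complexity\<close>

locale sharp_filtration =
  fixes S :: "nat \<Rightarrow> nat \<Rightarrow> nat \<Rightarrow> real list set set"
  assumes mono: "F \<le> F' \<Longrightarrow> D \<le> D' \<Longrightarrow> S n F D \<subseteq> S n F' D'"
    and compat: "sharply_compatible S"
    and sub: "A \<in> S n F D \<Longrightarrow> A \<subseteq> Rn n"
begin

text \<open>The factor \<open>D + 1\<close> instead of \<open>D\<close> leaves room, even when
  \<open>D = 0\<close>, for auxiliary sets given by polynomials of fixed degree. With this form the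
  constants simply add up under intersection.\<close>

definition rtame :: "nat \<Rightarrow> nat \<Rightarrow> nat \<Rightarrow> nat \<Rightarrow> real list set \<Rightarrow> bool" where
  "rtame F D a n A \<longleftrightarrow> A \<in> S n (F + a) (a * (D + 1))"

lemma rtame_mono: "rtame F D a n A \<Longrightarrow> a \<le> b \<Longrightarrow> rtame F D b n A"
  unfolding rtame_def using mono[of "F + a" "F + b" "a * (D + 1)" "b * (D + 1)" n]
  by (meson add_le_mono le_refl mult_le_mono subsetD)

lemma rtame_Int:
  assumes "rtame F D a n A" "rtame F D b n B"
  shows "rtame F D (a + b) n (A \<inter> B)"
proof -
  have "A \<in> S n (F + (a + b)) (a * (D + 1))" "B \<in> S n (F + (a + b)) (b * (D + 1))"
    using assms mono[of "F + a" "F + (a + b)" "a * (D + 1)" "a * (D + 1)" n]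
      mono[of "F + b" "F + (a + b)" "b * (D + 1)" "b * (D + 1)" n] by (auto simp: rtame_def)
  then have "\<forall>i<2. (if i = (0::nat) then A else B) \<in> S n (F + (a + b)) (if i = 0 then a * (D + 1) else b * (D + 1))"
    by auto
  then have "(\<Inter>i<(2::nat). if i = 0 then A else B) \<in> S n (F + (a + b)) (\<Sum>i<(2::nat). if i = 0 then a * (D + 1) else b * (D + 1))"
    using compat[unfolded sharply_compatible_def, THEN conjunct2, THEN conjunct2, THEN conjunct1,
        THEN spec[of _ n], THEN spec[of _ "F + (a + b)"], THEN spec[of _ 2],
        THEN spec[of _ "\<lambda>i. if i = 0 then A else B"],
        THEN spec[of _ "\<lambda>i. if i = 0 then a * (D + 1) else b * (D + 1)"]]
    by simp
  moreover have "(\<Inter>i<(2::nat). if i = 0 then A else B) = A \<inter> B"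
    by (auto simp: lessThan_Suc numeral_2_eq_2)
  ultimately show ?thesis by (simp add: rtame_def numeral_2_eq_2 algebra_simps)
qed

lemma rtame_Compl: "rtame F D a n A \<Longrightarrow> rtame F D a n (Rn n - A)"
  using compat unfolding sharply_compatible_def rtame_def by blast

lemma rtame_butlast: "rtame F D a (Suc n) A \<Longrightarrow> rtame F D a n (butlast ` A)"
  using compat unfolding sharply_compatible_def rtame_def by blast

lemma rtame_take: "rtame F D a (n + k) A \<Longrightarrow> rtame F D a n (take n ` A)"
proof (induction k arbitrary: A)
  case 0
  then have "A \<subseteq> Rn n" using sub by (auto simp: rtame_def)
  then have "take n ` A = A" by (force simp: Rn_def)
  then show ?case using 0 by simp
next
  case (Suc k)
  have "A \<subseteq> Rn (Suc (n + k))" using sub Suc.prems by (auto simp: rtame_def)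
  then have "take n ` butlast ` A = take n ` A"
    by (force simp: Rn_def image_image butlast_conv_take intro!: image_cong)
  moreover have "rtame F D a n (take n ` butlast ` A)"
    using Suc.IH[OF rtame_butlast] Suc.prems by simp
  ultimately show ?case by simp
qed

lemma rtame_Cons:
  assumes "rtame F D a n A"
  shows "rtame F D (a + 1) (Suc n) {t # x |x t. x \<in> A}"
proof -
  have "{t # x |x t. x \<in> A} \<in> S (Suc n) (F + a + 1) (a * (D + 1))"
    using compat assms unfolding sharply_compatible_def rtame_def by blast
  then show ?thesis
    unfolding rtame_def using mono[of "F + a + 1" "F + (a + 1)" "a * (D + 1)" "(a + 1) * (D + 1)"] by auto
qed

lemma rtame_cylinder:
  assumes "rtame F D a k A"
  shows "rtame F D (a + n) (n + k) {x @ y |x y. length x = n \<and> y \<in> A}"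
proof (induction n)
  case 0
  then show ?case using assms by simp
next
  case (Suc n)
  have "{x @ y |x y. length x = Suc n \<and> y \<in> A} = {t # x |x t. x \<in> {x @ y |x y. length x = n \<and> y \<in> A}}"
    by (auto simp: length_Suc_conv) (metis append_Cons)+
  then show ?case using rtame_Cons[OF Suc] by simp
qed

lemma rtame_zero_set:
  assumes "\<forall>(k, \<alpha>)\<in>set ms. length \<alpha> = n \<and> sum_list \<alpha> \<le> d"
  shows "rtame F D (n + d) n {x \<in> Rn n. monomials_eval ms x = 0}"
proof -
  obtain c where c: "is_mpoly n c" "mpoly_degree c \<le> d" "\<And>x. mpoly_eval c x = monomials_eval ms x"
    using mpoly_of_monomials[OF assms] by blast
  have "{x \<in> Rn n. mpoly_eval c x = 0} \<in> S n n (mpoly_degree c)"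
    using compat c(1) unfolding sharply_compatible_def by blast
  moreover have "mpoly_degree c \<le> (n + d) * (D + 1)" using c(2) by simp
  ultimately show ?thesis
    unfolding rtame_def using mono[of n "F + (n + d)" "mpoly_degree c" "(n + d) * (D + 1)" n] c(3) by auto
qed

lemma rtame_coord_eq:
  assumes "p < n" "q < n" "p \<noteq> q"
  shows "rtame F D (n + 1) n {x \<in> Rn n. x ! p = x ! q}"
proof -
  let ?e = "\<lambda>p. (replicate n 0)[p := 1::nat]"
  have s: "sum_list (?e p) = 1" if "p < n" for p
    using that by (simp add: sum_list_update)
  have e: "(\<Prod>i<length x. (x ! i) ^ (?e p ! i)) = x ! p" if "x \<in> Rn n" "p < n" for x :: "real list" and p
  proof -
    have "(\<Prod>i<length x. (x ! i) ^ (?e p ! i)) = (\<Prod>i<n. if i = p then x ! p else 1)"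
      using that by (intro prod.cong) (auto simp: Rn_def nth_list_update)
    then show ?thesis using that by simp
  qed
  have "rtame F D (n + 1) n {x \<in> Rn n. monomials_eval [(1, ?e p), (-1, ?e q)] x = 0}"
    using assms s by (intro rtame_zero_set) auto
  moreover have "{x \<in> Rn n. monomials_eval [(1, ?e p), (-1, ?e q)] x = 0} = {x \<in> Rn n. x ! p = x ! q}"
    using e assms by (auto simp: monomials_eval_def)
  ultimately show ?thesis by simp
qed

text \<open>Adjoin the substituted values as further coordinates ranging over \<open>A\<close>,
  impose one coordinate equation for each, and project them away. Permutations, cylinders and
  diagonals are all instances.\<close>

lemma rtame_reindex:
  assumes A: "rtame F D a k A" and "is": "length is = k" "\<forall>i\<in>set is. i < n"
  shows "rtame F D (a + n + k * (n + k + 1)) n {x \<in> Rn n. map ((!) x) is \<in> A}"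
proof -
  let ?B = "\<lambda>j. {x @ y |x y. length x = n \<and> y \<in> A \<and> (\<forall>i<j. y ! i = x ! (is ! i))}"
  have Ak: "A \<subseteq> Rn k" using A sub by (auto simp: rtame_def)
  have B: "rtame F D (a + n + j * (n + k + 1)) (n + k) (?B j)" if "j \<le> k" for j
    using that
  proof (induction j)
    case 0
    then show ?case using rtame_cylinder[OF A, of n] by simp
  next
    case (Suc j)
    have isj: "is ! j < n" using "is" Suc.prems by (metis Suc_le_lessD nth_mem)
    have "rtame F D (n + k + 1) (n + k) {x \<in> Rn (n + k). x ! (n + j) = x ! (is ! j)}"
      using isj Suc.prems by (intro rtame_coord_eq) auto
    from rtame_Int[OF Suc.IH this]
    have "rtame F D (a + n + Suc j * (n + k + 1)) (n + k) (?B j \<inter> {x \<in> Rn (n + k). x ! (n + j) = x ! (is ! j)})"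
      using Suc.prems by (simp add: algebra_simps)
    moreover have "?B j \<inter> {x \<in> Rn (n + k). x ! (n + j) = x ! (is ! j)} = ?B (Suc j)"
      using isj Ak by (auto simp: Rn_def nth_append less_Suc_eq subset_iff) blast+
    ultimately show ?case by simp
  qed
  have "take n ` ?B k = {x \<in> Rn n. map ((!) x) is \<in> A}"
  proof (intro set_eqI iffI)
    fix v assume "v \<in> take n ` ?B k"
    then obtain y where y: "length v = n" "y \<in> A" "\<forall>i<k. y ! i = v ! (is ! i)" by auto
    then have "map ((!) v) is = y" using Ak "is" by (intro nth_equalityI) (auto simp: Rn_def)
    then show "v \<in> {x \<in> Rn n. map ((!) x) is \<in> A}" using y by (auto simp: Rn_def)
  next
    fix v assume v: "v \<in> {x \<in> Rn n. map ((!) x) is \<in> A}"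
    then have "v @ map ((!) v) is \<in> ?B k"
      using "is" by (intro CollectI exI[of _ v] exI[of _ "map ((!) v) is"]) (auto simp: Rn_def)
    moreover have "v = take n (v @ map ((!) v) is)" using v by (simp add: Rn_def)
    ultimately show "v \<in> take n ` ?B k" by (rule image_eqI[rotated])
  qed
  then show ?thesis using rtame_take[OF B[of k]] by simp
qed

text \<open>A single number \<open>a\<close> bounds the growth of format and degree; for a construction that is uniform
  in the data it depends only on the dimension.\<close>

definition tame :: "nat \<Rightarrow> nat \<Rightarrow> nat \<Rightarrow> nat \<Rightarrow> complex list set \<Rightarrow> bool" where
  "tame F D a n A \<longleftrightarrow> A \<subseteq> {z. length z = n} \<and> rtame F D a (2 * n) (realify ` A)"

lemma tame_mono: "tame F D a n A \<Longrightarrow> a \<le> b \<Longrightarrow> tame F D b n A"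
  unfolding tame_def using rtame_mono by blast

lemma tame_Int: "tame F D a n A \<Longrightarrow> tame F D b n B \<Longrightarrow> tame F D (a + b) n (A \<inter> B)"
  unfolding tame_def using rtame_Int[of F D a "2 * n" "realify ` A" b "realify ` B"]
  by (auto simp: image_Int[OF inj_realify])

lemma tame_Collect_conj:
  assumes "tame F D a n {z. length z = n \<and> P z}" "tame F D b n {z. length z = n \<and> Q z}"
  shows "tame F D (a + b) n {z. length z = n \<and> P z \<and> Q z}"
  using tame_Int[OF assms] by (rule back_subst[of "tame F D (a + b) n"]) auto

lemma tame_Collect_not:
  assumes "tame F D a n {z. length z = n \<and> P z}"
  shows "tame F D a n {z. length z = n \<and> \<not> P z}"
proof -
  have "realify ` {z. length z = n \<and> \<not> P z} = Rn (2 * n) - realify ` {z. length z = n \<and> P z}"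
    unfolding realify_Collect using realify_surj[of _ n] injD[OF inj_realify]
    by (auto simp: Rn_def)
  then show ?thesis using assms rtame_Compl by (auto simp: tame_def)
qed

lemma tame_Collect_ex:
  assumes "tame F D a (n + k) {z. length z = n + k \<and> P (take n z) (drop n z)}"
  shows "tame F D a n {z. length z = n \<and> (\<exists>w. length w = k \<and> P z w)}"
proof -
  let ?A = "{z. length z = n + k \<and> P (take n z) (drop n z)}"
  have eq: "{z. length z = n \<and> (\<exists>w. length w = k \<and> P z w)} = take n ` ?A"
  proof (intro set_eqI iffI)
    fix z assume "z \<in> {z. length z = n \<and> (\<exists>w. length w = k \<and> P z w)}"
    then obtain w where "length z = n" "length w = k" "P z w" by auto
    then show "z \<in> take n ` ?A" by (intro image_eqI[of _ _ "z @ w"]) auto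
  next
    fix z assume "z \<in> take n ` ?A"
    then obtain w where "z = take n w" "length w = n + k" "P (take n w) (drop n w)" by auto
    then show "z \<in> {z. length z = n \<and> (\<exists>w. length w = k \<and> P z w)}"
      by (auto intro!: exI[of _ "drop n w"])
  qed
  have "take (2 * n) (realify z) = realify (take n z)" for z
  proof (cases "n \<le> length z")
    case True
    have "realify z = realify (take n z) @ realify (drop n z)" by (metis append_take_drop_id realify_append)
    then show ?thesis using True by simp
  qed simp
  then have "realify ` take n ` ?A = take (2 * n) ` realify ` ?A" by (simp add: image_image)
  then show ?thesis
    unfolding eq using assms rtame_take[of F D a "2 * n" "2 * k" "realify ` ?A"] by (auto simp: tame_def algebra_simps)
qed

text \<open>The increment in \<open>rtame_reindex\<close> for \<open>2 * n\<close> and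
  \<open>2 * k\<close> real coordinates.\<close>

definition reindex_cost :: "nat \<Rightarrow> nat \<Rightarrow> nat" where
  "reindex_cost n k = 2 * n + 2 * k * (2 * n + 2 * k + 1)"

lemma tame_reindex:
  assumes A: "tame F D a k A" and "is": "length is = k" "\<forall>i\<in>set is. i < n"
  shows "tame F D (a + reindex_cost n k) n {z. length z = n \<and> map ((!) z) is \<in> A}"
proof -
  let ?js = "concat (map (\<lambda>i. [2 * i, Suc (2 * i)]) is)"
  have js: "length ?js = 2 * k" "\<forall>i\<in>set ?js. i < 2 * n"
    using "is"(1) "is"(2) by (auto simp: length_concat comp_def sum_list_triv)
  have m: "map ((!) (realify z)) ?js \<in> realify ` A \<longleftrightarrow> map ((!) z) is \<in> A" if "length z = n" for z
    using map_nth_realify[of "is" z] "is"(2) that by (simp add: realify_image_iff)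
  have "realify ` {z. length z = n \<and> map ((!) z) is \<in> A} = {x \<in> Rn (2 * n). map ((!) x) ?js \<in> realify ` A}"
  proof (intro set_eqI iffI)
    fix x assume "x \<in> realify ` {z. length z = n \<and> map ((!) z) is \<in> A}"
    then show "x \<in> {x \<in> Rn (2 * n). map ((!) x) ?js \<in> realify ` A}" using m by (auto simp: Rn_def)
  next
    fix x assume x: "x \<in> {x \<in> Rn (2 * n). map ((!) x) ?js \<in> realify ` A}"
    then obtain z where "length z = n" "realify z = x" using realify_surj[of x n] by (auto simp: Rn_def)
    then show "x \<in> realify ` {z. length z = n \<and> map ((!) z) is \<in> A}" using m x by auto
  qed
  then show ?thesis
    using rtame_reindex[of F D a "2 * k" "realify ` A" ?js "2 * n"] A js
    by (auto simp: tame_def reindex_cost_def add.assoc)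
qed

lemma tame_Collect_real:
  assumes "rtame F D a (2 * n) {x \<in> Rn (2 * n). Q x}" "\<And>z. length z = n \<Longrightarrow> P z \<longleftrightarrow> Q (realify z)"
  shows "tame F D a n {z. length z = n \<and> P z}"
proof -
  have "realify ` {z. length z = n \<and> P z} = {x \<in> Rn (2 * n). Q x}"
    unfolding realify_Collect using assms(2) realify_surj[of _ n] by (auto simp: Rn_def)
  then show ?thesis using assms(1) by (auto simp: tame_def)
qed

lemma rtame_Collect_conj:
  assumes "rtame F D a n {x \<in> Rn n. P x}" "rtame F D b n {x \<in> Rn n. Q x}"
  shows "rtame F D (a + b) n {x \<in> Rn n. P x \<and> Q x}"
  using rtame_Int[OF assms] by (rule back_subst[of "rtame F D (a + b) n"]) auto

section \<open>Basic algebraic relations between complex coordinates\<close>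

lemma tame_zero: "tame F D 6 1 {z. length z = 1 \<and> z ! 0 = 0}"
proof (rule tame_Collect_real)
  have "rtame F D 3 2 {x \<in> Rn 2. monomials_eval [(1, [1, 0])] x = 0}"
    "rtame F D 3 2 {x \<in> Rn 2. monomials_eval [(1, [0, 1])] x = 0}"
    using rtame_zero_set[of "[(1, [1, 0])]" 2 1] rtame_zero_set[of "[(1, [0, 1])]" 2 1] by auto
  from rtame_Collect_conj[OF this]
  show "rtame F D 6 (2 * 1) {x \<in> Rn (2 * 1). monomials_eval [(1, [1, 0])] x = 0 \<and> monomials_eval [(1, [0, 1])] x = 0}"
    by simp
  show "z ! 0 = 0 \<longleftrightarrow> monomials_eval [(1, [1, 0])] (realify z) = 0 \<and> monomials_eval [(1, [0, 1])] (realify z) = 0"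
    if len: "length z = 1" for z
  proof -
    obtain a where "z = [a]" using len by (auto simp: length_Suc_conv)
    then show ?thesis by (simp add: monomials_eval_def complex_eq_iff eval_nat_numeral lessThan_Suc del: prod_zero_iff)
  qed
qed

text \<open>\<open>c\<close> enters only through the coefficients of two real linear equations in
  four variables, each of cost \<open>4 + 1\<close>; hence one bound for every
  \<open>c\<close>.\<close>

lemma tame_cmult: "tame F D 10 2 {z. length z = 2 \<and> z ! 0 = c * z ! 1}"
proof (rule tame_Collect_real)
  let ?p = "[(1, [1, 0, 0, 0]), (- Re c, [0, 0, 1, 0]), (Im c, [0, 0, 0, 1])]"
  let ?q = "[(1, [0, 1, 0, 0]), (- Re c, [0, 0, 0, 1]), (- Im c, [0, 0, 1, 0])]"
  have "rtame F D 5 4 {x \<in> Rn 4. monomials_eval ?p x = 0}" "rtame F D 5 4 {x \<in> Rn 4. monomials_eval ?q x = 0}"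
    using rtame_zero_set[of ?p 4 1] rtame_zero_set[of ?q 4 1] by auto
  from rtame_Collect_conj[OF this]
  show "rtame F D 10 (2 * 2) {x \<in> Rn (2 * 2). monomials_eval ?p x = 0 \<and> monomials_eval ?q x = 0}"
    by simp
  show "z ! 0 = c * z ! 1 \<longleftrightarrow> monomials_eval ?p (realify z) = 0 \<and> monomials_eval ?q (realify z) = 0"
    if "length z = 2" for z
    using that by (auto simp: length_Suc_conv monomials_eval_def complex_eq_iff eval_nat_numeral)
qed

lemma tame_add: "tame F D 14 3 {z. length z = 3 \<and> z ! 0 = z ! 1 + z ! 2}"
proof (rule tame_Collect_real)
  let ?p = "[(1, [1, 0, 0, 0, 0, 0]), (- 1, [0, 0, 1, 0, 0, 0]), (- 1, [0, 0, 0, 0, 1, 0])] :: (real \<times> nat list) list"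
  let ?q = "[(1, [0, 1, 0, 0, 0, 0]), (- 1, [0, 0, 0, 1, 0, 0]), (- 1, [0, 0, 0, 0, 0, 1])] :: (real \<times> nat list) list"
  have "rtame F D 7 6 {x \<in> Rn 6. monomials_eval ?p x = 0}" "rtame F D 7 6 {x \<in> Rn 6. monomials_eval ?q x = 0}"
    using rtame_zero_set[of ?p 6 1] rtame_zero_set[of ?q 6 1] by auto
  from rtame_Collect_conj[OF this]
  show "rtame F D 14 (2 * 3) {x \<in> Rn (2 * 3). monomials_eval ?p x = 0 \<and> monomials_eval ?q x = 0}"
    by simp
  show "z ! 0 = z ! 1 + z ! 2 \<longleftrightarrow> monomials_eval ?p (realify z) = 0 \<and> monomials_eval ?q (realify z) = 0"
    if "length z = 3" for z
    using that by (auto simp: length_Suc_conv monomials_eval_def complex_eq_iff eval_nat_numeral)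
qed

lemma tame_cmod_less: "tame F D 9 2 {z. length z = 2 \<and> cmod (z ! 0) < cmod (z ! 1)}"
proof (rule tame_Collect_real)
  \<comment> \<open>The equation \<open>(c^2 + d^2 - a^2 - b^2) * t^2 = 1\<close> is solvable in
    \<open>t\<close> exactly if the strict inequality holds. Compatibility supplies zero sets, so
    the order relation is obtained by projecting this one.\<close>
  let ?p = "[(- 1, [2, 0, 0, 0, 2]), (- 1, [0, 2, 0, 0, 2]), (1, [0, 0, 2, 0, 2]), (1, [0, 0, 0, 2, 2]),
     (- 1, [0, 0, 0, 0, 0])] :: (real \<times> nat list) list"
  have "rtame F D 9 (4 + 1) {x \<in> Rn 5. monomials_eval ?p x = 0}"
    using rtame_zero_set[of ?p 5 4] by auto
  from rtame_take[OF this]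
  have "rtame F D 9 4 (take 4 ` {x \<in> Rn 5. monomials_eval ?p x = 0})" .
  moreover have "take 4 ` {x \<in> Rn 5. monomials_eval ?p x = 0}
      = {x \<in> Rn (2 * 2). (x ! 0)\<^sup>2 + (x ! 1)\<^sup>2 < (x ! 2)\<^sup>2 + (x ! 3)\<^sup>2}" (is "?L = ?R")
  proof (intro set_eqI iffI)
    have ev: "monomials_eval ?p [a, b, c, d, t] = (c\<^sup>2 + d\<^sup>2 - (a\<^sup>2 + b\<^sup>2)) * t\<^sup>2 - 1" for a b c d t
      by (simp add: monomials_eval_def eval_nat_numeral algebra_simps)
    { fix v assume "v \<in> ?L"
      then obtain a b c d t where v: "v = [a, b, c, d]" "monomials_eval ?p [a, b, c, d, t] = 0"
        by (auto simp: Rn_def length_Suc_conv eval_nat_numeral)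
      then have "(c\<^sup>2 + d\<^sup>2 - (a\<^sup>2 + b\<^sup>2)) * t\<^sup>2 = 1" using ev by simp
      then have "0 < c\<^sup>2 + d\<^sup>2 - (a\<^sup>2 + b\<^sup>2)" by (metis zero_less_mult_pos2 zero_less_one zero_less_power2 mult_zero_right power_zero_numeral zero_neq_one)
      then show "v \<in> ?R" using v by (simp add: Rn_def eval_nat_numeral) }
    { fix v assume "v \<in> ?R"
      then obtain a b c d where v: "v = [a, b, c, d]" "0 < c\<^sup>2 + d\<^sup>2 - (a\<^sup>2 + b\<^sup>2)"
        by (auto simp: Rn_def length_Suc_conv eval_nat_numeral)
      define t where "t = 1 / sqrt (c\<^sup>2 + d\<^sup>2 - (a\<^sup>2 + b\<^sup>2))"
      have "t\<^sup>2 = 1 / (c\<^sup>2 + d\<^sup>2 - (a\<^sup>2 + b\<^sup>2))"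
        unfolding t_def power_divide using v(2) by (simp add: real_sqrt_pow2)
      then have "monomials_eval ?p [a, b, c, d, t] = 0" unfolding ev using v(2) by simp
      then show "v \<in> ?L" using v by (intro image_eqI[of _ _ "[a, b, c, d, t]"]) (auto simp: Rn_def) }
  qed
  ultimately show "rtame F D 9 (2 * 2) ?R" by simp
  show "cmod (z ! 0) < cmod (z ! 1)
      \<longleftrightarrow> (realify z ! 0)\<^sup>2 + (realify z ! 1)\<^sup>2 < (realify z ! 2)\<^sup>2 + (realify z ! 3)\<^sup>2"
    if len: "length z = 2" for z
  proof -
    obtain a b where "z = [a, b]" using len
      by (cases z; cases "tl z"; cases "tl (tl z)") auto
    then show ?thesis by (simp add: cmod_def eval_nat_numeral)
  qed
qed

end

lemma fiber_set_nonempty: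
  assumes "fiber_over X \<Phi>" "x \<in> X"
  shows "fiber_set \<Phi> x \<noteq> {}"
proof (cases \<Phi>)
  case (Disc r)
  then have "0 \<in> fiber_set \<Phi> x" using assms by (simp add: fiber_over_def)
  then show ?thesis by blast
next
  case (PDisc r)
  then have "r x / 2 \<in> fiber_set \<Phi> x" using assms by (simp add: fiber_over_def norm_divide)
  then show ?thesis by blast
next
  case (IDisc r)
  then have "2 * r x \<in> fiber_set \<Phi> x" using assms by (simp add: fiber_over_def norm_mult)
  then show ?thesis by blast
next
  case (Annulus r1 r2)
  then have "cmod (r1 x) < cmod (r2 x)" using assms by (simp add: fiber_over_def)
  then have "of_real ((cmod (r1 x) + cmod (r2 x)) / 2) \<in> fiber_set \<Phi> x"
    unfolding Annulus fiber_set.simps mem_Collect_eq norm_of_real by (simp add: abs_of_nonneg)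
  then show ?thesis by blast
qed simp

text \<open>Radii do not vanish and annuli have positive width, so no fiber is empty and the
  projection is onto the base.\<close>

lemma take_image_cell_set:
  assumes "is_ccell (C \<odot> \<Phi>)"
  shows "take (cell_length C) ` cell_set (C \<odot> \<Phi>) = cell_set C"
proof (intro set_eqI iffI)
  fix x assume "x \<in> cell_set C"
  moreover then obtain y where "y \<in> fiber_set \<Phi> x" using assms fiber_set_nonempty by fastforce
  ultimately show "x \<in> take (cell_length C) ` cell_set (C \<odot> \<Phi>)"
    by (intro image_eqI[of _ _ "x @ [y]"]) (auto simp: length_cell_set)
qed (auto simp: length_cell_set)

lemma list_graph_altdef: "list_graph X r = {x @ [y] |x y. x \<in> X \<and> y = r x}"
  by (auto simp: list_graph_def)

lemma length_SucE:
  assumes "length z = Suc n"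
  obtains x y where "z = x @ [y]" "length x = n"
  using assms by (metis append_butlast_last_id length_0_conv length_butlast diff_Suc_1 Zero_not_Suc)

context sharp_filtration
begin

lemma tame_reindexI:
  assumes "tame F D a k A" "length is = k" "\<forall>i\<in>set is. i < n"
    and "\<And>z. length z = n \<Longrightarrow> P z \<longleftrightarrow> map ((!) z) is \<in> A"
  shows "tame F D (a + reindex_cost n k) n {z. length z = n \<and> P z}"
  using tame_reindex[OF assms(1-3)] by (rule back_subst[of "tame F D (a + reindex_cost n k) n"]) (use assms(4) in auto)

lemma tame_take_in:
  assumes "tame F D a n X"
  shows "tame F D (a + reindex_cost (n + m) n) (n + m) {z. length z = n + m \<and> take n z \<in> X}"
  by (rule tame_reindexI[OF assms, of "[0..<n]"]) (auto simp: map_nth_upt)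

lemma tame_projection:
  assumes "tame F D a (n + k) A"
  shows "tame F D a n (take n ` A)"
proof -
  have A: "A \<subseteq> {z. length z = n + k}" using assms by (simp add: tame_def)
  have "tame F D a n {z. length z = n \<and> (\<exists>w. length w = k \<and> z @ w \<in> A)}"
    by (rule tame_Collect_ex) (rule back_subst[of "tame F D a (n + k)", OF assms], use A in auto)
  moreover have "{z. length z = n \<and> (\<exists>w. length w = k \<and> z @ w \<in> A)} = take n ` A"
  proof (intro set_eqI iffI)
    fix z assume "z \<in> take n ` A"
    then obtain u where u: "u \<in> A" "z = take n u" by auto
    have lu: "length u = n + k" using A u(1) by blast
    then show "z \<in> {z. length z = n \<and> (\<exists>w. length w = k \<and> z @ w \<in> A)}"
      using u by (intro CollectI conjI exI[of _ "drop n u"]) simp_all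
  next
    fix z assume "z \<in> {z. length z = n \<and> (\<exists>w. length w = k \<and> z @ w \<in> A)}"
    then obtain w where "length z = n" "z @ w \<in> A" by blast
    then show "z \<in> take n ` A" by (intro image_eqI[of _ _ "z @ w"]) auto
  qed
  ultimately show ?thesis by simp
qed

section \<open>First-order operations on graphs\<close>

lemma tame_graph_restrict:
  assumes "tame F D a (n + m) {x @ f x |x. x \<in> X'}" "tame F D b n X" "X \<subseteq> X'"
    and "\<And>x. x \<in> X' \<Longrightarrow> length x = n"
  shows "tame F D (a + (b + reindex_cost (n + m) n)) (n + m) {x @ f x |x. x \<in> X}"
proof -
  have "{x @ f x |x. x \<in> X'} \<subseteq> {z. length z = n + m}" using assms(1) by (simp add: tame_def)
  then have "{x @ f x |x. x \<in> X'} \<inter> {z. length z = n + m \<and> take n z \<in> X} = {x @ f x |x. x \<in> X}"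
    using assms(3,4) by fastforce
  then show ?thesis using tame_Int[OF assms(1) tame_take_in[OF assms(2)]] by metis
qed

text \<open>An extra last coordinate carries \<open>r x\<close>, tied to \<open>x\<close> by the
  graph and to \<open>y\<close> by \<open>Q\<close>, and is projected away. Relations between a
  variable and a radius thus reduce to relations between two numbers.\<close>

lemma tame_graph_rel:
  assumes G: "tame F D a (n + 1) (list_graph X r)" and len: "\<And>x. x \<in> X \<Longrightarrow> length x = n"
    and Q: "tame F D b 2 {v. length v = 2 \<and> Q (v ! 0) (v ! 1)}"
  shows "tame F D (a + reindex_cost (n + 2) (n + 1) + (b + reindex_cost (n + 2) 2)) (n + 1)
    {x @ [y] |x y. x \<in> X \<and> Q y (r x)}"
proof -
  have "tame F D (a + reindex_cost (n + 2) (n + 1)) (n + 2)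
      {z. length z = n + 2 \<and> take n z @ [z ! (n + 1)] \<in> list_graph X r}"
    by (rule tame_reindexI[OF G, of "[0..<n] @ [n + 1]"]) (auto simp: map_nth_upt)
  moreover have "tame F D (b + reindex_cost (n + 2) 2) (n + 2)
      {z. length z = n + 2 \<and> Q (z ! n) (z ! (n + 1))}"
    by (rule tame_reindexI[OF Q, of "[n, n + 1]"]) auto
  ultimately have "tame F D (a + reindex_cost (n + 2) (n + 1) + (b + reindex_cost (n + 2) 2)) (n + 2)
    {z. length z = n + 2 \<and> take n z @ [z ! (n + 1)] \<in> list_graph X r \<and> Q (z ! n) (z ! (n + 1))}"
    by (rule tame_Collect_conj)
  then have "tame F D (a + reindex_cost (n + 2) (n + 1) + (b + reindex_cost (n + 2) 2)) (n + 1)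
    (take (n + 1) ` {z. length z = n + 2 \<and> take n z @ [z ! (n + 1)] \<in> list_graph X r \<and> Q (z ! n) (z ! (n + 1))})"
    by (intro tame_projection[where k = 1]) simp
  moreover have "take (n + 1) ` {z. length z = n + 2 \<and> take n z @ [z ! (n + 1)] \<in> list_graph X r \<and> Q (z ! n) (z ! (n + 1))}
    = {x @ [y] |x y. x \<in> X \<and> Q y (r x)}" (is "_ ` ?A = ?B")
  proof (intro set_eqI iffI)
    fix v assume "v \<in> take (n + 1) ` ?A"
    then obtain z where z: "v = take (n + 1) z" "length z = n + 2"
      "take n z \<in> X" "z ! (n + 1) = r (take n z)" "Q (z ! n) (z ! (n + 1))"
      by (auto simp: list_graph_def)
    then show "v \<in> ?B" by (auto simp: take_Suc_conv_app_nth intro!: exI[of _ "take n z"])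
  next
    fix v assume "v \<in> ?B"
    then obtain x y where "v = x @ [y]" "x \<in> X" "Q y (r x)" by blast
    then show "v \<in> take (n + 1) ` ?A" using len[of x]
      by (intro image_eqI[of _ _ "x @ [y, r x]"]) (auto simp: nth_append list_graph_def)
  qed
  ultimately show ?thesis by simp
qed

lemma tame_graph_cmult:
  assumes "tame F D a (n + 1) (list_graph X r)" "\<And>x. x \<in> X \<Longrightarrow> length x = n"
  shows "tame F D (a + reindex_cost (n + 2) (n + 1) + (10 + reindex_cost (n + 2) 2)) (n + 1)
    (list_graph X (\<lambda>x. c * r x))"
  using tame_graph_rel[OF assms tame_cmult[of F D c]] by (simp add: list_graph_altdef)

lemma tame_cmod_less_graph:
  assumes "tame F D a (n + 1) (list_graph X r)" "\<And>x. x \<in> X \<Longrightarrow> length x = n"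
  shows "tame F D (a + reindex_cost (n + 2) (n + 1) + (9 + reindex_cost (n + 2) 2)) (n + 1)
    {x @ [y] |x y. x \<in> X \<and> cmod y < cmod (r x)}"
  by (rule tame_graph_rel[OF assms tame_cmod_less])

lemma tame_cmod_greater_graph:
  assumes "tame F D a (n + 1) (list_graph X r)" "\<And>x. x \<in> X \<Longrightarrow> length x = n"
  shows "tame F D (a + reindex_cost (n + 2) (n + 1) + (9 + reindex_cost 2 2 + reindex_cost (n + 2) 2)) (n + 1)
    {x @ [y] |x y. x \<in> X \<and> cmod (r x) < cmod y}"
proof -
  have "tame F D (9 + reindex_cost 2 2) 2 {v. length v = 2 \<and> cmod (v ! 1) < cmod (v ! 0)}"
    by (rule tame_reindexI[OF tame_cmod_less, of "[1, 0]"]) auto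
  from tame_graph_rel[OF assms this] show ?thesis .
qed

lemma tame_graph_zero:
  assumes "tame F D a n X"
  shows "tame F D (a + reindex_cost (n + 1) n + (6 + reindex_cost (n + 1) 1)) (n + 1) (list_graph X (\<lambda>_. 0))"
proof -
  have len: "X \<subseteq> {z. length z = n}" using assms by (simp add: tame_def)
  have "tame F D (6 + reindex_cost (n + 1) 1) (n + 1) {z. length z = n + 1 \<and> z ! n = 0}"
    by (rule tame_reindexI[OF tame_zero, of "[n]"]) auto
  from tame_Collect_conj[OF tame_take_in[OF assms, of 1] this]
  have "tame F D (a + reindex_cost (n + 1) n + (6 + reindex_cost (n + 1) 1)) (n + 1)
    {z. length z = n + 1 \<and> take n z \<in> X \<and> z ! n = 0}" .
  moreover have "{z. length z = n + 1 \<and> take n z \<in> X \<and> z ! n = 0} = list_graph X (\<lambda>_. 0)"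
    using len by (auto simp: list_graph_def nth_append elim!: length_SucE)
  ultimately show ?thesis by simp
qed

lemma tame_nonzero:
  "tame F D (6 + reindex_cost (n + 1) 1) (n + 1) {z. length z = n + 1 \<and> z ! n \<noteq> 0}"
  by (rule tame_Collect_not, rule tame_reindexI[OF tame_zero, of "[n]"]) auto

text \<open>The coordinates are ordered as \<open>x\<close>, the value, \<open>f x\<close>, so that
  projection to an initial segment removes the intermediate point \<open>f x\<close>.\<close>

lemma tame_graph_compose:
  assumes G: "tame F D a (n + m) {x @ f x |x. x \<in> X}" and H: "tame F D b (m + 1) (list_graph Y R)"
    and len: "\<And>x. x \<in> X \<Longrightarrow> length x = n" "\<And>x. x \<in> X \<Longrightarrow> f x \<in> Y" "\<And>y. y \<in> Y \<Longrightarrow> length y = m"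
  shows "tame F D (a + reindex_cost (n + 1 + m) (n + m) + (b + reindex_cost (n + 1 + m) (m + 1))) (n + 1)
    (list_graph X (\<lambda>x. R (f x)))"
proof -
  let ?c = "a + reindex_cost (n + 1 + m) (n + m) + (b + reindex_cost (n + 1 + m) (m + 1))"
  let ?A = "{z. length z = n + 1 + m \<and> take n z @ drop (n + 1) z \<in> {x @ f x |x. x \<in> X} \<and>
    drop (n + 1) z @ [z ! n] \<in> list_graph Y R}"
  have "tame F D (a + reindex_cost (n + 1 + m) (n + m)) (n + 1 + m)
      {z. length z = n + 1 + m \<and> take n z @ drop (n + 1) z \<in> {x @ f x |x. x \<in> X}}"
    by (rule tame_reindexI[OF G, of "[0..<n] @ [n + 1..<n + 1 + m]"]) (auto simp: map_nth_upt simp del: upt_Suc)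
  moreover have "tame F D (b + reindex_cost (n + 1 + m) (m + 1)) (n + 1 + m)
      {z. length z = n + 1 + m \<and> drop (n + 1) z @ [z ! n] \<in> list_graph Y R}"
    by (rule tame_reindexI[OF H, of "[n + 1..<n + 1 + m] @ [n]"]) (auto simp: map_nth_upt simp del: upt_Suc)
  ultimately have "tame F D ?c (n + 1 + m) ?A" by (rule tame_Collect_conj)
  then have "tame F D ?c (n + 1) (take (n + 1) ` ?A)" by (rule tame_projection)
  moreover have "take (n + 1) ` ?A = list_graph X (\<lambda>x. R (f x))"
  proof (intro set_eqI iffI)
    fix v assume "v \<in> take (n + 1) ` ?A"
    then obtain z x y where z: "v = take (n + 1) z" "length z = n + 1 + m"
      "take n z @ drop (n + 1) z = x @ f x" "x \<in> X" "drop (n + 1) z @ [z ! n] = y @ [R y]"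
      by (auto simp: list_graph_def)
    have tx: "take n z = x" "drop (n + 1) z = f x" using z len(1)[of x]
      by (metis append_eq_append_conv length_take min.absorb2 le_add1 add.assoc)+
    moreover have "z ! n = R (f x)" using z(5) tx(2) by simp
    ultimately have "v = x @ [R (f x)]" using z(1,2) by (simp add: take_Suc_conv_app_nth)
    then show "v \<in> list_graph X (\<lambda>x. R (f x))" using z(4) by (auto simp: list_graph_def)
  next
    fix v assume "v \<in> list_graph X (\<lambda>x. R (f x))"
    then obtain x where x: "v = x @ [R (f x)]" "x \<in> X" by (auto simp: list_graph_def)
    have l: "length x = n" "length (f x) = m" "f x \<in> Y" using len x(2) by auto
    then show "v \<in> take (n + 1) ` ?A" using x
      by (intro image_eqI[of _ _ "x @ [R (f x)] @ f x"]) (auto simp: list_graph_def nth_append)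
  qed
  ultimately show ?thesis by simp
qed

text \<open>Complexity of a translation prolonged by one coordinate. The \<open>n + m + 3\<close>
  coordinates hold \<open>x\<close>, \<open>y\<close>, \<open>f x\<close>, \<open>y + g x\<close>
  and, to be projected away, \<open>g x\<close>.\<close>

lemma tame_graph_snoc_add:
  assumes Z: "tame F D a (n + 1) Z" and G: "tame F D b (n + m) {x @ f x |x. x \<in> X}"
    and H: "tame F D c (n + 1) (list_graph X g)"
    and ZX: "\<And>x y. x @ [y] \<in> Z \<Longrightarrow> x \<in> X"
    and len: "\<And>x. x \<in> X \<Longrightarrow> length x = n" "\<And>x. x \<in> X \<Longrightarrow> length (f x) = m"
  defines "N \<equiv> n + m + 3"
  shows "tame F D (a + reindex_cost N (n + 1) + (b + reindex_cost N (n + m) +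
      (c + reindex_cost N (n + 1) + (14 + reindex_cost N 3)))) (n + 1 + (m + 1))
    {z @ (f (butlast z) @ [last z + g (butlast z)]) |z. z \<in> Z}"
proof -
  let ?c = "a + reindex_cost N (n + 1) + (b + reindex_cost N (n + m) +
      (c + reindex_cost N (n + 1) + (14 + reindex_cost N 3)))"
  let ?m = "\<lambda>z. take m (drop (n + 1) z)"
  let ?A = "{z. length z = N \<and> take (n + 1) z \<in> Z \<and> take n z @ ?m z \<in> {x @ f x |x. x \<in> X} \<and>
      take n z @ [z ! (n + m + 2)] \<in> list_graph X g \<and> z ! (n + m + 1) = z ! n + z ! (n + m + 2)}"
  have ZL: "Z \<subseteq> {z. length z = n + 1}" using Z by (simp add: tame_def)
  have "tame F D (a + reindex_cost N (n + 1)) N {z. length z = N \<and> take (n + 1) z \<in> Z}"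
    by (rule tame_reindexI[OF Z, of "[0..<n + 1]"]) (auto simp: map_nth_upt N_def simp del: upt_Suc)
  moreover have "tame F D (b + reindex_cost N (n + m)) N
      {z. length z = N \<and> take n z @ ?m z \<in> {x @ f x |x. x \<in> X}}"
    by (rule tame_reindexI[OF G, of "[0..<n] @ [n + 1..<n + 1 + m]"]) (auto simp: map_nth_upt N_def simp del: upt_Suc)
  moreover have "tame F D (c + reindex_cost N (n + 1)) N
      {z. length z = N \<and> take n z @ [z ! (n + m + 2)] \<in> list_graph X g}"
    by (rule tame_reindexI[OF H, of "[0..<n] @ [n + m + 2]"]) (auto simp: map_nth_upt N_def simp del: upt_Suc)
  moreover have "tame F D (14 + reindex_cost N 3) N
      {z. length z = N \<and> z ! (n + m + 1) = z ! n + z ! (n + m + 2)}"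
    by (rule tame_reindexI[OF tame_add, of "[n + m + 1, n, n + m + 2]"]) (auto simp: N_def)
  ultimately have "tame F D ?c N ?A" by (intro tame_Collect_conj)
  then have "tame F D ?c (n + 1 + (m + 1) + 1) ?A" by (simp add: N_def eval_nat_numeral)
  then have "tame F D ?c (n + 1 + (m + 1)) (take (n + 1 + (m + 1)) ` ?A)" by (rule tame_projection)
  moreover have "take (n + 1 + (m + 1)) ` ?A = {z @ (f (butlast z) @ [last z + g (butlast z)]) |z. z \<in> Z}"
    (is "_ = ?B")
  proof (intro set_eqI iffI)
    fix v assume "v \<in> take (n + 1 + (m + 1)) ` ?A"
    then obtain z where z: "v = take (n + 1 + (m + 1)) z" "z \<in> ?A" by blast
    define x where "x = take n z"
    define y where "y = z ! n"
    have l: "length z = n + m + 3" using z(2) by (simp add: N_def)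
    have xy: "take (n + 1) z = x @ [y]" using l by (simp add: x_def y_def take_Suc_conv_app_nth)
    then have xyZ: "x @ [y] \<in> Z" using z(2) by simp
    have xX: "x \<in> X" using ZX[OF xyZ] .
    have "x @ ?m z \<in> {x @ f x |x. x \<in> X}" using z(2) by (simp add: x_def)
    then obtain x' where "x @ ?m z = x' @ f x'" "x' \<in> X" by blast
    then have mz: "?m z = f x" using len(1) xX by (metis append_eq_append_conv)
    have w: "z ! (n + m + 2) = g x" using z(2) by (auto simp: list_graph_def x_def)
    have "v = take (n + 1) z @ take (m + 1) (drop (n + 1) z)" unfolding z(1) by (rule take_add)
    also have "take (m + 1) (drop (n + 1) z) = ?m z @ [z ! (n + m + 1)]"
      using l by (simp add: take_Suc_conv_app_nth)
    also have "z ! (n + m + 1) = y + g x" using z(2) w by (simp add: y_def)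
    finally have "v = (x @ [y]) @ (f x @ [y + g x])" using xy mz by simp
    then show "v \<in> ?B" using xyZ by (intro CollectI exI[of _ "x @ [y]"]) simp
  next
    fix v assume "v \<in> ?B"
    then obtain z where z: "v = z @ (f (butlast z) @ [last z + g (butlast z)])" "z \<in> Z" by blast
    then have "length z = Suc n" using ZL by auto
    then obtain x y where xy: "z = x @ [y]" "length x = n" by (rule length_SucE)
    have xX: "x \<in> X" using ZX z(2) xy by simp
    let ?u = "x @ [y] @ f x @ [y + g x] @ [g x]"
    have "?u \<in> ?A" using xX xy len(2)[OF xX] z(2) by (auto simp: N_def nth_append list_graph_def)
    moreover have "v = take (n + 1 + (m + 1)) ?u" using xX xy len(2)[OF xX] z(1) by simp
    ultimately show "v \<in> take (n + 1 + (m + 1)) ` ?A" by (rule image_eqI[rotated])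
  qed
  ultimately show ?thesis by simp
qed

section \<open>Complexity of complex cells\<close>

definition tame_cell :: "nat \<Rightarrow> nat \<Rightarrow> nat \<Rightarrow> ccell \<Rightarrow> bool" where
  "tame_cell F D a C \<longleftrightarrow> cell_in S (F + a) (a * (D + 1)) C"

lemma tame_cell_set: "tame_cell F D a C \<Longrightarrow> tame F D a (cell_length C) (cell_set C)"
  unfolding tame_cell_def cell_in_def tame_def rtame_def by (auto simp: length_cell_set)

lemma tame_cell_Odot_iff:
  "tame_cell F D a (C \<odot> \<Phi>) \<longleftrightarrow> tame F D a (cell_length C + 1) (cell_set (C \<odot> \<Phi>)) \<and>
     radii_in S (F + a) (a * (D + 1)) C \<and>
     (\<forall>r\<in>radii \<Phi>. tame F D a (cell_length C + 1) (list_graph (cell_set C) r))"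
  unfolding tame_cell_def cell_in_def tame_def rtame_def by (auto simp: length_cell_set list_graph_def)

text \<open>The base is a projection of the cell, and projections raise neither format nor degree,
  so \<open>a\<close> stays the same.\<close>

lemma tame_cell_base:
  assumes "is_ccell (C \<odot> \<Phi>)" "tame_cell F D a (C \<odot> \<Phi>)"
  shows "tame_cell F D a C"
proof -
  have "tame F D a (cell_length C) (cell_set C)"
    using tame_projection[of F D a "cell_length C" 1 "cell_set (C \<odot> \<Phi>)"] assms
    unfolding tame_cell_Odot_iff take_image_cell_set[OF assms(1)] by blast
  then show ?thesis using assms(2) unfolding tame_cell_Odot_iff
    by (auto simp: tame_cell_def cell_in_def tame_def rtame_def)
qed

lemma radii_in_mono:
  "radii_in S F D C \<Longrightarrow> F \<le> F' \<Longrightarrow> D \<le> D' \<Longrightarrow> radii_in S F' D' C"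
proof (induction C)
  case (Odot C \<Phi>)
  have "S n F D \<subseteq> S n F' D'" for n using mono Odot.prems(2,3) .
  then show ?case using Odot by auto
qed simp

lemma cell_in_mono: "cell_in S F D C \<Longrightarrow> F \<le> F' \<Longrightarrow> D \<le> D' \<Longrightarrow> cell_in S F' D' C"
  using mono radii_in_mono unfolding cell_in_def by blast

lemma tame_cell_mono: "tame_cell F D a C \<Longrightarrow> a \<le> b \<Longrightarrow> tame_cell F D b C"
  unfolding tame_cell_def by (erule cell_in_mono) (simp, rule mult_le_mono1)

text \<open>A generous sum that serves all five types of fibers at once.\<close>

definition odot_cost :: "nat \<Rightarrow> nat \<Rightarrow> nat \<Rightarrow> nat" where
  "odot_cost n a b = a + 2 * b + 30 + reindex_cost (n + 1) n + reindex_cost (n + 1) 1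
     + 2 * reindex_cost (n + 2) (n + 1) + reindex_cost 2 2 + 2 * reindex_cost (n + 2) 2"

lemma tame_cell_Odot:
  assumes C: "tame_cell F D a C" and n: "cell_length C = n"
    and r: "\<And>r. r \<in> radii \<Phi> \<Longrightarrow> tame F D b (n + 1) (list_graph (cell_set C) r)"
  shows "tame_cell F D (odot_cost n a b) (C \<odot> \<Phi>)"
proof -
  have len: "length x = n" if "x \<in> cell_set C" for x using that n length_cell_set by auto
  let ?X = "cell_set C"
  have "tame F D (odot_cost n a b) (n + 1) (cell_set (C \<odot> \<Phi>))"
  proof (cases \<Phi>)
    case Star
    have eq: "cell_set (C \<odot> \<Phi>) = list_graph ?X (\<lambda>_. 0)" using Star by (auto simp: list_graph_def)
    show ?thesis unfolding eq using n
      by (intro tame_mono[OF tame_graph_zero[OF tame_cell_set[OF C], unfolded n]]) (auto simp: odot_cost_def)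
  next
    case (Disc r)
    have eq: "cell_set (C \<odot> \<Phi>) = {x @ [y] |x y. x \<in> ?X \<and> cmod y < cmod (r x)}" using Disc by auto
    show ?thesis unfolding eq
      by (rule tame_mono[OF tame_cmod_less_graph[OF r len]]) (auto simp: Disc odot_cost_def)
  next
    case (PDisc r)
    have eq: "cell_set (C \<odot> \<Phi>) = {x @ [y] |x y. x \<in> ?X \<and> cmod y < cmod (r x)} \<inter> {z. length z = n + 1 \<and> z ! n \<noteq> 0}"
      using PDisc len by (auto simp: nth_append)
    show ?thesis unfolding eq
      by (rule tame_mono[OF tame_Int[OF tame_cmod_less_graph[OF r len] tame_nonzero]]) (auto simp: PDisc odot_cost_def)
  next
    case (IDisc r)
    have eq: "cell_set (C \<odot> \<Phi>) = {x @ [y] |x y. x \<in> ?X \<and> cmod (r x) < cmod y}" using IDisc by auto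
    show ?thesis unfolding eq
      by (rule tame_mono[OF tame_cmod_greater_graph[OF r len]]) (auto simp: IDisc odot_cost_def)
  next
    case (Annulus r1 r2)
    have eq: "cell_set (C \<odot> \<Phi>) = {x @ [y] |x y. x \<in> ?X \<and> cmod (r1 x) < cmod y} \<inter> {x @ [y] |x y. x \<in> ?X \<and> cmod y < cmod (r2 x)}"
      using Annulus by auto
    show ?thesis unfolding eq
      by (rule tame_mono[OF tame_Int[OF tame_cmod_greater_graph[OF r len] tame_cmod_less_graph[OF r len]]])
        (auto simp: Annulus odot_cost_def)
  qed
  moreover have "tame_cell F D (odot_cost n a b) C"
    by (rule tame_cell_mono[OF C]) (simp add: odot_cost_def)
  moreover have "tame F D (odot_cost n a b) (n + 1) (list_graph ?X r)" if "r \<in> radii \<Phi>" for r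
    by (rule tame_mono[OF assms(3)[OF that]]) (simp add: odot_cost_def)
  ultimately show ?thesis unfolding tame_cell_Odot_iff n by (auto simp: tame_cell_def cell_in_def)
qed

text \<open>\<open>b\<close> is fixed before \<open>s\<close> and \<open>t\<close>: a radius is
  restricted to the shrunk base and multiplied by a constant, and the cost of the latter ignores the
  constant.\<close>

lemma tame_cell_shrink:
  "\<exists>b. \<forall>F D s t E. 0 < s \<longrightarrow> s \<le> 1 \<longrightarrow> 0 < t \<longrightarrow> t \<le> 1 \<longrightarrow>
    is_ccell E \<longrightarrow> cell_length E = n \<longrightarrow> tame_cell F D a E \<longrightarrow> tame_cell F D b (shrink s t E)"
proof (induction n)
  case 0
  have "E = Unit" if "cell_length E = 0" for E using that by (cases E) auto
  then show ?case by (intro exI[of _ a]) (metis shrink.simps(1))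
next
  case (Suc n)
  then obtain b where b: "\<And>F D s t E. \<lbrakk>0 < s; s \<le> 1; 0 < t; t \<le> 1; is_ccell E; cell_length E = n;
    tame_cell F D a E\<rbrakk> \<Longrightarrow> tame_cell F D b (shrink s t E)" by blast
  let ?d = "a + (b + reindex_cost (n + 1) n) + reindex_cost (n + 2) (n + 1) + (10 + reindex_cost (n + 2) 2)"
  show ?case
  proof (intro exI[of _ "odot_cost n b ?d"] allI impI)
    fix F D and s t :: real and E'
    assume st: "0 < s" "s \<le> 1" "0 < t" "t \<le> 1" and E': "is_ccell E'" "cell_length E' = Suc n" "tame_cell F D a E'"
    then obtain E \<Phi> where E: "E' = E \<odot> \<Phi>" "cell_length E = n" by (cases E') auto
    let ?X = "cell_set (shrink s t E)"
    have tE: "tame_cell F D b (shrink s t E)"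
      using b[OF st, of E F D] E E' tame_cell_base by auto
    have restr: "tame F D (a + (b + reindex_cost (n + 1) n)) (n + 1) (list_graph ?X r)" if "r \<in> radii \<Phi>" for r
      unfolding list_graph_def
      using E' E that tame_cell_set[OF tE] shrink_subset[OF st, of E]
      by (intro tame_graph_restrict[of F D a n 1 _ "cell_set E"])
         (auto simp: tame_cell_Odot_iff list_graph_def length_cell_set)
    have scale: "tame F D ?d (n + 1) (list_graph ?X (\<lambda>x. c * r x))" if "r \<in> radii \<Phi>" for r c
      by (rule tame_graph_cmult[OF restr[OF that]]) (simp add: length_cell_set E)
    have div: "(\<lambda>x. r x / c) = (\<lambda>x. inverse c * r x)" for r :: "complex list \<Rightarrow> complex" and c
      by (auto simp: field_simps)
    have "tame F D ?d (n + 1) (list_graph ?X r')" if "r' \<in> radii (shrink_fiber s t \<Phi>)" for r'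
      using that scale by (cases \<Phi>) (auto simp: div)
    then show "tame_cell F D (odot_cost n b ?d) (shrink s t E')"
      unfolding E(1) shrink.simps by (intro tame_cell_Odot[OF tE]) (auto simp: E)
  qed
qed

end

section \<open>Covering a fiber by translated fibers\<close>

lemma norm_exp_minus_1_le:
  assumes "cmod w \<le> 1 / 2"
  shows "cmod (exp w - 1) \<le> 2 * cmod w"
proof -
  have "cmod (exp w - exp 0) \<le> 2 * cmod (w - 0)"
  proof (rule field_differentiable_bound[of "cball 0 (1/2)"])
    show "(exp has_field_derivative exp z) (at z within cball 0 (1/2))" for z :: complex
      by (rule has_field_derivative_at_within) (rule DERIV_exp)
    show "cmod (exp z) \<le> 2" if "z \<in> cball 0 (1/2)" for z
      using that by (intro exp_bound_half) simp
  qed (use assms in auto)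
  then show ?thesis by simp
qed

text \<open>Number of grid points of mesh \<open>e / 8\<close> in a rectangle with sides
  \<open>V\<close> and \<open>2 * pi\<close>, rounding included.\<close>

definition net_size :: "real \<Rightarrow> real \<Rightarrow> real" where
  "net_size V e = (8 * V / e + 1) * (16 * pi / e + 1)"

text \<open>The net is a square grid in the logarithmic coordinate.\<close>

lemma annulus_net:
  assumes "0 < a" "0 < e" "e \<le> 1" "ln (b / a) \<le> V" "0 \<le> V"
  shows "\<exists>Z. finite Z \<and> real (card Z) \<le> net_size V e \<and> (\<forall>c\<in>Z. a \<le> cmod c \<and> cmod c \<le> b) \<and>
    (\<forall>z. a \<le> cmod z \<and> cmod z \<le> b \<longrightarrow> (\<exists>c\<in>Z. cmod (z - c) < e * cmod c))"
proof (cases "a \<le> b")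
  \<comment> \<open>The ring is empty. This does occur: a narrow annulus may have no room left
    between its two shrunk circles.\<close>
  case False
  then show ?thesis using assms by (intro exI[of _ "{}"]) (auto simp: net_size_def)
next
  case True
  \<comment> \<open>A point is within \<open>2 * h\<close> of the grid in the logarithmic
    coordinate, which the exponential turns into a relative distance of at most
    \<open>4 * h = e / 2\<close>.\<close>
  define h where "h = e / 8"
  have h: "0 < h" "4 * h < e" "2 * h \<le> 1 / 2" using assms by (auto simp: h_def)
  define c where "c = (\<lambda>(k::nat, j::nat). complex_of_real (a * exp (k * h)) * cis (j * h))"
  define A where "A = {..nat \<lfloor>ln (b / a) / h\<rfloor>} \<times> {..nat \<lfloor>2 * pi / h\<rfloor>}"
  have lb: "0 \<le> ln (b / a)" using True assms by simp
  have card: "real (card (c ` A)) \<le> net_size V e"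
  proof -
    have "finite A" by (simp add: A_def)
    then have "real (card (c ` A)) \<le> real (card A)" by (simp only: card_image_le of_nat_le_iff)
    also have "\<dots> = (real (nat \<lfloor>ln (b / a) / h\<rfloor>) + 1) * (real (nat \<lfloor>2 * pi / h\<rfloor>) + 1)"
      by (simp add: A_def card_cartesian_product algebra_simps)
    also have "\<dots> \<le> (ln (b / a) / h + 1) * (2 * pi / h + 1)"
      using lb h by (intro mult_mono add_mono) auto
    also have "\<dots> \<le> (V / h + 1) * (2 * pi / h + 1)"
      using assms h by (intro mult_right_mono add_mono divide_right_mono) auto
    also have "\<dots> = net_size V e" by (simp add: net_size_def h_def field_simps)
    finally show ?thesis .
  qed
  have cm: "cmod (c (k, j)) = a * exp (k * h)" for k j
    using assms by (simp add: c_def norm_mult)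
  show ?thesis
  proof (intro exI[of _ "c ` A"] conjI ballI allI impI card)
    show "finite (c ` A)" by (simp add: A_def)
  next
    fix w assume "w \<in> c ` A"
    then obtain k j where w: "w = c (k, j)" "k \<le> nat \<lfloor>ln (b / a) / h\<rfloor>" by (auto simp: A_def)
    have "real k \<le> real (nat \<lfloor>ln (b / a) / h\<rfloor>)" using w(2) by simp
    also have "\<dots> \<le> ln (b / a) / h" using lb h by auto
    finally have "real k * h \<le> ln (b / a)" using h by (simp add: field_simps)
    then have "exp (k * h) \<le> b / a" using assms True by (metis exp_le_cancel_iff exp_ln divide_pos_pos less_le_trans)
    then show "cmod w \<le> b" using assms by (simp add: w(1) cm field_simps)
    have "1 \<le> exp (k * h)" using h by simp
    then show "a \<le> cmod w" using assms by (simp add: w(1) cm)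
  next
    fix z assume z: "a \<le> cmod z \<and> cmod z \<le> b"
    then have z0: "0 < cmod z" using assms by linarith
    define s where "s = ln (cmod z / a)"
    define \<theta> where "\<theta> = Arg2pi z"
    have s: "0 \<le> s" "s \<le> ln (b / a)"
      using z z0 assms by (auto simp: s_def divide_right_mono)
    have \<theta>: "0 \<le> \<theta>" "\<theta> < 2 * pi" by (auto simp: \<theta>_def Arg2pi_ge_0 Arg2pi_lt_2pi)
    \<comment> \<open>Rounding down keeps the modulus of the net point between \<open>a\<close> and
      \<open>cmod z\<close>, so that the centers stay in the ring.\<close>
    define k where "k = nat \<lfloor>s / h\<rfloor>"
    define j where "j = nat \<lfloor>\<theta> / h\<rfloor>"
    have kA: "(k, j) \<in> A"
      unfolding A_def k_def j_def using s \<theta> h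
      by (auto intro!: nat_mono floor_mono divide_right_mono)
    have kh: "real k * h \<le> s" "s \<le> real k * h + h"
    proof -
      have "real k = real_of_int \<lfloor>s / h\<rfloor>" using s h by (simp add: k_def)
      then have "real k \<le> s / h" "s / h \<le> real k + 1" by linarith+
      then show "real k * h \<le> s" "s \<le> real k * h + h" using h by (simp_all add: field_simps)
    qed
    have jh: "real j * h \<le> \<theta>" "\<theta> \<le> real j * h + h"
    proof -
      have "real j = real_of_int \<lfloor>\<theta> / h\<rfloor>" using \<theta> h by (simp add: j_def)
      then have "real j \<le> \<theta> / h" "\<theta> / h \<le> real j + 1" by linarith+
      then show "real j * h \<le> \<theta>" "\<theta> \<le> real j * h + h" using h by (simp_all add: field_simps)
    qed
    define w where "w = Complex (s - k * h) (\<theta> - j * h)"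
    have "cmod w \<le> \<bar>Re w\<bar> + \<bar>Im w\<bar>" by (rule cmod_le)
    also have "\<dots> \<le> 2 * h" using kh jh by (simp add: w_def)
    finally have w: "cmod w \<le> 2 * h" .
    have "z = complex_of_real (cmod z) * cis \<theta>"
      using Arg2pi_eq[of z] by (simp add: \<theta>_def cis_conv_exp)
    also have "cmod z = a * exp s" using assms z0 by (simp add: s_def)
    also have "complex_of_real (a * exp s) * cis \<theta> = c (k, j) * exp w"
    proof -
      have "exp w = of_real (exp (s - k * h)) * cis (\<theta> - j * h)"
        by (simp add: w_def exp_eq_polar)
      moreover have "of_real (exp (k * h)) * complex_of_real (exp (s - k * h)) = of_real (exp s)"
        by (simp flip: exp_add of_real_mult)
      moreover have "cis (j * h) * cis (\<theta> - j * h) = cis \<theta>" by (simp add: cis_mult)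
      ultimately show ?thesis by (simp add: c_def mult_ac)
    qed
    finally have "z - c (k, j) = c (k, j) * (exp w - 1)" by (simp add: algebra_simps)
    then have "cmod (z - c (k, j)) = cmod (c (k, j)) * cmod (exp w - 1)" by (simp add: norm_mult)
    also have "\<dots> \<le> cmod (c (k, j)) * (2 * cmod w)"
      using w h by (intro mult_left_mono norm_exp_minus_1_le) auto
    also have "\<dots> < cmod (c (k, j)) * e"
      using w h assms by (intro mult_strict_left_mono) (auto simp: cm)
    finally show "\<exists>c\<in>c ` A. cmod (z - c) < e * cmod c" using kA by (auto simp: mult.commute)
  qed
qed

text \<open>\<open>(\<Psi>, g)\<close> stands for the fiber \<open>\<Psi>\<close> translated by \<open>g\<close>, over the set \<open>G\<close> of base points.\<close>

definition translated_subfiber ::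
    "real \<Rightarrow> complex list set \<Rightarrow> fiber \<Rightarrow> fiber \<times> (complex list \<Rightarrow> complex) \<Rightarrow> bool" where
  "translated_subfiber \<sigma> G \<Phi> = (\<lambda>(\<Psi>, g).
     (\<forall>r\<in>radii \<Psi>. \<exists>c. c \<noteq> 0 \<and> (\<exists>R\<in>radii \<Phi>. r = (\<lambda>p. c * R p))) \<and>
     (g = (\<lambda>p. 0) \<or> (\<exists>c. \<exists>R\<in>radii \<Phi>. g = (\<lambda>p. c * R p))) \<and>
     wide_fiber (ann_delta \<sigma>) G \<Psi> \<and>
     (\<forall>p\<in>G. \<forall>y\<in>fiber_set \<Psi> p. y + g p \<in> fiber_set \<Phi> p))"

lemma translated_subfiber_self: "wide_fiber (ann_delta \<sigma>) G \<Phi> \<Longrightarrow> translated_subfiber \<sigma> G \<Phi> (\<Phi>, \<lambda>p. 0)"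
  unfolding translated_subfiber_def by (auto intro!: exI[of _ 1])

section \<open>Families of discs with centers proportional to a radius\<close>

definition disc_ratio :: "real \<Rightarrow> real" where
  "disc_ratio \<rho> = 1 / (2 + \<rho>)"

text \<open>\<open>disc_ratio\<close> is the radius of a disc in units of the modulus of its center.
  Discs around points of the \<rho>-core stay in the fiber if it is at most
  \<open>1 - disc_delta \<rho>\<close> for type \<open>Disc\<close>, and at most 1 minus the square
  root of \<open>ann_delta \<rho>\<close> for the others. Both bounds decay like
  \<open>1 / \<rho>\<close>, hence the simple choice \<open>1 / (2 + \<rho>)\<close>.\<close>

lemma disc_ratio_bounds:
  assumes "0 < \<rho>"
  shows "0 < disc_ratio \<rho>" "disc_ratio \<rho> < 1" "disc_ratio \<rho> \<le> 1 - disc_delta \<rho>"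
    "disc_ratio \<rho> \<le> 1 - exp (- (pi\<^sup>2 / (4 * \<rho>)))"
proof -
  show "0 < disc_ratio \<rho>" "disc_ratio \<rho> < 1" using assms by (auto simp: disc_ratio_def)
  have p: "3 < pi" using pi_gt3 .
  have "2 * pi + \<rho> \<le> pi * (2 + \<rho>)" using assms p by (simp add: algebra_simps)
  then have "disc_ratio \<rho> \<le> pi / (2 * pi + \<rho>)"
    using assms p add_pos_pos[of "2 * pi" \<rho>] by (simp add: disc_ratio_def divide_le_eq pos_le_divide_eq mult.commute)
  also have "\<dots> = 1 - (pi + \<rho>) / (2 * pi + \<rho>)"
    using assms add_pos_pos[of "2 * pi" \<rho>] by (simp add: eq_divide_eq diff_divide_eq_iff)
  also have "\<dots> \<le> 1 - disc_delta \<rho>" using disc_delta_bounds(3)[OF assms] by simp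
  finally show "disc_ratio \<rho> \<le> 1 - disc_delta \<rho>" .
  define x where "x = pi\<^sup>2 / (4 * \<rho>)"
  have x: "0 < x" using assms by (simp add: x_def)
  have "1 + x \<le> exp x" using exp_ge_add_one_self by simp
  then have "exp (- x) \<le> 1 / (1 + x)" using x by (simp add: exp_minus field_simps)
  moreover have "1 - 1 / (1 + x) = x / (1 + x)" using x by (simp add: field_simps)
  moreover have "disc_ratio \<rho> \<le> x / (1 + x)"
  proof -
    have p2: "9 \<le> pi\<^sup>2" using power_mono[of 3 pi 2] p by simp
    have "1 + x = (4 * \<rho> + pi\<^sup>2) / (4 * \<rho>)" using assms by (simp add: x_def add_divide_distrib)
    then have "x / (1 + x) = pi\<^sup>2 / (4 * \<rho> + pi\<^sup>2)" using assms by (simp add: x_def)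
    moreover have "4 * \<rho> \<le> pi\<^sup>2 * \<rho>" using p2 assms by simp
    then have "4 * \<rho> + pi\<^sup>2 \<le> pi\<^sup>2 * (2 + \<rho>)" using p2 by (simp add: algebra_simps)
    moreover have "0 < 4 * \<rho> + pi\<^sup>2" using assms p2 by linarith
    moreover have "1 / (2 + \<rho>) \<le> pi\<^sup>2 / (4 * \<rho> + pi\<^sup>2)"
      using assms calculation(2,3) by (subst frac_le_eq) (auto simp: divide_le_0_iff algebra_simps)
    ultimately show ?thesis by (simp add: disc_ratio_def)
  qed
  ultimately show "disc_ratio \<rho> \<le> 1 - exp (- (pi\<^sup>2 / (4 * \<rho>)))" by (simp add: x_def)
qed

text \<open>The cores of the discs have to cover, so the net must be finer than the discs by the
  factor \<open>disc_delta \<sigma>\<close>.\<close>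

definition disc_mesh :: "real \<Rightarrow> real \<Rightarrow> real" where
  "disc_mesh \<rho> \<sigma> = disc_ratio \<rho> * disc_delta \<sigma>"

text \<open>The translated fibers have to lie in \<open>\<Phi>\<close> as a whole, whereas covering
  \<open>Y\<close> is demanded of their cores.\<close>

definition fiber_cover ::
    "real \<Rightarrow> complex list set \<Rightarrow> fiber \<Rightarrow> real \<Rightarrow> (complex list \<Rightarrow> complex set) \<Rightarrow>
      (fiber \<times> (complex list \<Rightarrow> complex)) set \<Rightarrow> bool" where
  "fiber_cover \<sigma> G \<Phi> N Y I \<longleftrightarrow> finite I \<and> real (card I) \<le> N \<and>
     (\<forall>i\<in>I. translated_subfiber \<sigma> G \<Phi> i) \<and>
     (\<forall>p\<in>G. \<forall>y\<in>Y p. \<exists>(\<Psi>, g)\<in>I. y - g p \<in> fiber_set (core_fiber \<sigma> \<Psi>) p)"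

lemma fiber_cover_mono:
  assumes "fiber_cover \<sigma> G \<Phi> N Y I" "N \<le> N'" "\<And>p. p \<in> G \<Longrightarrow> Y' p \<subseteq> Y p"
  shows "fiber_cover \<sigma> G \<Phi> N' Y' I"
  using assms unfolding fiber_cover_def by (meson order_trans subsetD)

lemma fiber_cover_Un:
  assumes "fiber_cover \<sigma> G \<Phi> N Y I" "fiber_cover \<sigma> G \<Phi> N' Y' I'"
  shows "fiber_cover \<sigma> G \<Phi> (N + N') (\<lambda>p. Y p \<union> Y' p) (I \<union> I')"
proof -
  have "real (card (I \<union> I')) \<le> N + N'"
    using assms card_Un_le[of I I'] unfolding fiber_cover_def by linarith
  then show ?thesis using assms unfolding fiber_cover_def by blast
qed

lemma fiber_cover_self:
  assumes "wide_fiber (ann_delta \<sigma>) G \<Phi>"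
  shows "fiber_cover \<sigma> G \<Phi> 1 (\<lambda>p. fiber_set (core_fiber \<sigma> \<Phi>) p) {(\<Phi>, \<lambda>p. 0)}"
  using translated_subfiber_self[OF assms] by (simp add: fiber_cover_def)

definition closed_ring :: "(complex list \<Rightarrow> complex) \<Rightarrow> real \<Rightarrow> real \<Rightarrow> complex list \<Rightarrow> complex set" where
  "closed_ring R a b p = {y. a * cmod (R p) \<le> cmod y \<and> cmod y \<le> b * cmod (R p)}"

text \<open>After division by \<open>R p\<close> the ring no longer depends on \<open>p\<close>, so
  one net of constants serves all base points. The type of the fiber enters only through
  \<open>inc\<close>, which places the zones swept by the discs inside the fiber.\<close>

lemma disc_family:
  assumes \<sigma>: "0 < \<sigma>" "0 < \<rho>" and a: "0 < a" "ln (b / a) \<le> V" "0 \<le> V"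
    and R: "R \<in> radii \<Phi>" "\<And>p. p \<in> G \<Longrightarrow> R p \<noteq> 0"
    and inc: "\<And>p y c. p \<in> G \<Longrightarrow> a \<le> c \<Longrightarrow> c \<le> b \<Longrightarrow> c * (1 - disc_ratio \<rho>) * cmod (R p) < cmod y \<Longrightarrow>
      cmod y < c * (1 + disc_ratio \<rho>) * cmod (R p) \<Longrightarrow> y \<in> fiber_set \<Phi> p"
  shows "\<exists>I. fiber_cover \<sigma> G \<Phi> (net_size V (disc_mesh \<rho> \<sigma>)) (closed_ring R a b) I"
proof -
  let ?e = "disc_ratio \<rho>"
  have e: "0 < ?e" "?e < 1" using disc_ratio_bounds \<sigma> by auto
  have d: "0 < disc_delta \<sigma>" "disc_delta \<sigma> < 1" using \<sigma> disc_delta_pos disc_delta_less_1 by auto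
  have m: "0 < disc_mesh \<rho> \<sigma>" "disc_mesh \<rho> \<sigma> \<le> 1"
    using e d mult_mono[of ?e 1 "disc_delta \<sigma>" 1] by (auto simp: disc_mesh_def)
  obtain Z where Z: "finite Z" "real (card Z) \<le> net_size V (disc_mesh \<rho> \<sigma>)"
    "\<And>c. c \<in> Z \<Longrightarrow> a \<le> cmod c \<and> cmod c \<le> b"
    "\<And>z. a \<le> cmod z \<Longrightarrow> cmod z \<le> b \<Longrightarrow> \<exists>c\<in>Z. cmod (z - c) < disc_mesh \<rho> \<sigma> * cmod c"
    using annulus_net[OF a(1) m a(2,3)] by metis
  define item where "item = (\<lambda>c. (Disc (\<lambda>p. of_real ?e * c * R p), \<lambda>p. c * R p))"
  have sub: "translated_subfiber \<sigma> G \<Phi> (item c)" if c: "c \<in> Z" for c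
    unfolding translated_subfiber_def item_def prod.case
  proof (intro conjI ballI)
    have "c \<noteq> 0" using Z(3)[OF c] a(1) by auto
    then show "\<exists>c. c \<noteq> 0 \<and> (\<exists>R\<in>radii \<Phi>. r = (\<lambda>p. c * R p))"
      if "r \<in> radii (Disc (\<lambda>p. of_real ?e * c * R p))" for r
      using that e R(1) by (intro exI[of _ "of_real ?e * c"]) auto
    show "(\<lambda>p. c * R p) = (\<lambda>p. 0) \<or> (\<exists>ca. \<exists>Ra\<in>radii \<Phi>. (\<lambda>p. c * R p) = (\<lambda>p. ca * Ra p))"
      using R(1) by blast
    show "wide_fiber (ann_delta \<sigma>) G (Disc (\<lambda>p. of_real ?e * c * R p))" by (simp add: wide_fiber_def)
  next
    fix p y assume p: "p \<in> G" and "y \<in> fiber_set (Disc (\<lambda>p. of_real ?e * c * R p)) p"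
    then have y: "cmod y < ?e * (cmod c * cmod (R p))" using e by (simp add: norm_mult)
    have "cmod (y + c * R p) \<le> cmod y + cmod c * cmod (R p)" by (metis norm_mult norm_triangle_ineq)
    moreover have "cmod c * cmod (R p) - cmod y \<le> cmod (y + c * R p)"
      by (metis add.commute norm_diff_ineq norm_mult)
    ultimately show "y + c * R p \<in> fiber_set \<Phi> p"
      using Z(3)[OF c] y by (intro inc[OF p, of "cmod c"]) (auto simp: algebra_simps)
  qed
  show ?thesis
    unfolding fiber_cover_def
  proof (intro exI[of _ "item ` Z"] conjI ballI)
    show "finite (item ` Z)" using Z by simp
    show "real (card (item ` Z)) \<le> net_size V (disc_mesh \<rho> \<sigma>)"
      using card_image_le[OF Z(1), of item] Z(2) by linarith
    show "translated_subfiber \<sigma> G \<Phi> i" if "i \<in> item ` Z" for i using that sub by auto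
  next
    fix p y assume p: "p \<in> G" and "y \<in> closed_ring R a b p"
    then have y: "a * cmod (R p) \<le> cmod y \<and> cmod y \<le> b * cmod (R p)" by (simp add: closed_ring_def)
    have Rp: "0 < cmod (R p)" using R(2)[OF p] by simp
    have "a \<le> cmod (y / R p)" "cmod (y / R p) \<le> b" using y Rp by (auto simp: norm_divide field_simps)
    then obtain c where c: "c \<in> Z" "cmod (y / R p - c) < disc_mesh \<rho> \<sigma> * cmod c" using Z(4) by blast
    have "cmod (y - c * R p) = cmod (y / R p - c) * cmod (R p)"
    proof -
      have "y - c * R p = (y / R p - c) * R p" using Rp by (simp add: left_diff_distrib)
      then show ?thesis by (metis norm_mult)
    qed
    also have "\<dots> < disc_mesh \<rho> \<sigma> * cmod c * cmod (R p)" using c(2) Rp by simp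
    finally have "y - c * R p \<in> fiber_set (core_fiber \<sigma> (Disc (\<lambda>p. of_real ?e * c * R p))) p"
      using e d by (simp add: norm_mult disc_mesh_def mult_ac)
    then show "\<exists>(\<Psi>, g)\<in>item ` Z. y - g p \<in> fiber_set (core_fiber \<sigma> \<Psi>) p"
      using c(1) by (auto simp: item_def)
  qed
qed

text \<open>Bounds the logarithmic width of every ring to be covered. The term
  \<open>1 / disc_delta \<sigma>\<close> is for discs, via \<open>ln x \<le> x - 1\<close>. The
  factor 3 is for annuli of almost constant width: two units at a point where width is lacking and
  at most one more for the variation.\<close>

definition log_range :: "real \<Rightarrow> real" where
  "log_range \<sigma> = 3 * (pi\<^sup>2 / (2 * \<sigma>)) + 1 / disc_delta \<sigma>"

text \<open>The fiber itself and at most two families of discs; two occur along the two boundary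
  circles of a wide annulus.\<close>

definition refinement_size :: "real \<Rightarrow> real \<Rightarrow> real" where
  "refinement_size \<rho> \<sigma> = 1 + 2 * net_size (log_range \<sigma>) (disc_mesh \<rho> \<sigma>)"

lemma log_range_pos: "0 < \<sigma> \<Longrightarrow> 0 < log_range \<sigma>"
  using disc_delta_pos by (simp add: log_range_def add_pos_pos)

lemma net_size_nonneg: "0 < \<sigma> \<Longrightarrow> 0 < \<rho> \<Longrightarrow> 0 \<le> net_size (log_range \<sigma>) (disc_mesh \<rho> \<sigma>)"
  using log_range_pos[of \<sigma>] disc_delta_pos[of \<sigma>] disc_ratio_bounds(1)[of \<rho>]
  by (simp add: net_size_def disc_mesh_def)

text \<open>An annulus must either be wide enough to contain a smaller annulus with the required
  extension, or have width almost constant over \<open>G\<close>, in which case discs with centers proportional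
  to the inner radius suffice.\<close>

lemma fiber_refinement:
  assumes \<sigma>: "0 < \<sigma>" "\<sigma> < \<rho>"
    and nz: "\<And>R p. R \<in> radii \<Phi> \<Longrightarrow> p \<in> G \<Longrightarrow> R p \<noteq> 0"
    and ann: "\<And>R1 R2. \<Phi> = Annulus R1 R2 \<Longrightarrow> wide_fiber (ann_delta \<sigma>) G \<Phi> \<or>
      (\<exists>v. v + pi\<^sup>2 / (4 * \<rho>) \<le> 3 * (pi\<^sup>2 / (2 * \<sigma>)) \<and>
        (\<forall>p\<in>G. v \<le> ln (cmod (R2 p) / cmod (R1 p)) \<and>
           ln (cmod (R2 p) / cmod (R1 p)) \<le> v + pi\<^sup>2 / (4 * \<rho>)))"
  shows "\<exists>I. fiber_cover \<sigma> G \<Phi> (refinement_size \<rho> \<sigma>) (fiber_set (core_fiber \<rho> \<Phi>)) I"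
proof -
  let ?e = "disc_ratio \<rho>" and ?V = "log_range \<sigma>"
  let ?M = "net_size ?V (disc_mesh \<rho> \<sigma>)"
  \<comment> \<open>Square root of \<open>ann_delta \<rho>\<close>: one factor \<open>q\<close>
    makes room for the discs, the other one absorbs the variation of the width of an
    annulus.\<close>
  define q where "q = exp (- (pi\<^sup>2 / (4 * \<rho>)))"
  have \<rho>: "0 < \<rho>" using \<sigma> by simp
  have q: "0 < q" "q < 1" "ann_delta \<rho> = q\<^sup>2"
    using \<rho> by (auto simp: q_def ann_delta_def power2_eq_square field_simps simp flip: exp_add)
  note e = disc_ratio_bounds(1,2)[OF \<rho>]
  have eq: "?e \<le> 1 - q" using disc_ratio_bounds(4)[OF \<rho>] by (simp add: q_def)
  \<comment> \<open>A disc whose center has at most \<open>q\<close> times the modulus of a radius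
    stays below that radius.\<close>
  have e1: "q * (1 + ?e) \<le> 1"
  proof -
    have "q * (1 + ?e) \<le> q * (2 - q)" using eq q by (intro mult_left_mono) auto
    also have "\<dots> = 1 - (1 - q)\<^sup>2" by (simp add: power2_eq_square algebra_simps)
    finally show ?thesis by (smt (verit) zero_le_power2)
  qed
  have e2: "q \<le> 1 - ?e" using eq by simp
  let ?d = "ann_delta \<rho>" and ?s = "ann_delta \<sigma>"
  have ds: "0 < ?s" "?s < ?d" "?d < 1" using \<sigma> \<rho> ann_delta_pos ann_delta_less ann_delta_less_1 by auto
  have de1: "?d * (1 + ?e) < 1"
  proof -
    have "?d * (1 + ?e) = q * (q * (1 + ?e))" using q by (simp add: power2_eq_square)
    also have "\<dots> \<le> q * 1" using q e1 by (intro mult_left_mono) auto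
    finally show ?thesis using q by simp
  qed
  have de2: "?d \<le> 1 - ?e" using e2 q by (simp add: power2_eq_square) (smt (verit) mult_left_le)
  have V: "0 \<le> ?V" using log_range_pos \<sigma>(1) less_imp_le by blast
  have lnV: "ln (?d / ?s) \<le> ?V" "ln ((1 / ?s) / (1 / ?d)) \<le> ?V"
  proof -
    have "ln (?d / ?s) = pi\<^sup>2 / (2 * \<sigma>) - pi\<^sup>2 / (2 * \<rho>)"
      by (simp add: ln_div ann_delta_pos) (simp add: ann_delta_def)
    also have "\<dots> \<le> pi\<^sup>2 / (2 * \<sigma>)" using \<rho> by simp
    also have "\<dots> \<le> ?V"
    proof -
      have "0 < pi\<^sup>2 / (2 * \<sigma>)" "0 < 1 / disc_delta \<sigma>" using \<sigma>(1) disc_delta_pos[OF \<sigma>(1)] by auto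
      then show ?thesis unfolding log_range_def by linarith
    qed
    finally show "ln (?d / ?s) \<le> ?V" .
    then show "ln ((1 / ?s) / (1 / ?d)) \<le> ?V" by simp
  qed
  have M: "0 \<le> ?M" using net_size_nonneg[OF \<sigma>(1) \<rho>] .
  have insert_core: ?thesis
    if I: "fiber_cover \<sigma> G \<Phi> (2 * ?M) Y I" and w: "wide_fiber ?s G \<Phi>"
      and Y: "\<And>p. p \<in> G \<Longrightarrow> fiber_set (core_fiber \<rho> \<Phi>) p \<subseteq> fiber_set (core_fiber \<sigma> \<Phi>) p \<union> Y p" for Y I
    using fiber_cover_mono[OF fiber_cover_Un[OF fiber_cover_self[OF w] I] _ Y]
    unfolding refinement_size_def by auto
  have insert_core1: ?thesis
    if "\<exists>I. fiber_cover \<sigma> G \<Phi> ?M Y I" "wide_fiber ?s G \<Phi>"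
      "\<And>p. p \<in> G \<Longrightarrow> fiber_set (core_fiber \<rho> \<Phi>) p \<subseteq> fiber_set (core_fiber \<sigma> \<Phi>) p \<union> Y p" for Y
    using that insert_core fiber_cover_mono[of \<sigma> G \<Phi> ?M Y _ "2 * ?M" Y] M by fastforce
  show ?thesis
  proof (cases \<Phi>)
    case Star
    show ?thesis
      by (rule insert_core[of "\<lambda>_. {}" "{}"]) (use Star M in \<open>auto simp: wide_fiber_def fiber_cover_def\<close>)
  next
    case (Disc R)
    let ?D = "disc_delta \<rho>" and ?S = "disc_delta \<sigma>"
    have DS: "0 < ?S" "?S < ?D" "?D < 1" using \<sigma> \<rho> disc_delta_pos disc_delta_less disc_delta_less_1 by auto
    have De: "?D * (1 + ?e) \<le> 1"
    proof -
      have "?D * (1 + ?e) \<le> ?D * (2 - ?D)" using disc_ratio_bounds(3)[OF \<rho>] DS by (intro mult_left_mono) auto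
      also have "\<dots> = 1 - (1 - ?D)\<^sup>2" by (simp add: power2_eq_square algebra_simps)
      finally show ?thesis by (smt (verit) zero_le_power2)
    qed
    have lnD: "ln (?D / ?S) \<le> ?V"
    proof -
      have "ln (?D / ?S) \<le> ?D / ?S - 1" using DS by (intro ln_le_minus_one) auto
      also have "\<dots> \<le> 1 / ?S" using DS divide_right_mono[of ?D 1 ?S] by simp
      also have "\<dots> \<le> ?V" using \<sigma>(1) by (simp add: log_range_def)
      finally show ?thesis .
    qed
    have fam: "\<exists>I. fiber_cover \<sigma> G \<Phi> ?M (closed_ring R (?S) (?D)) I"
    proof (rule disc_family[OF \<sigma>(1) \<rho> DS(1) lnD V])
      fix p y c assume c: "c \<le> ?D" and y: "cmod y < c * (1 + ?e) * cmod (R p)"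
      have "c * (1 + ?e) \<le> 1" using c e De mult_right_mono[of c ?D "1 + ?e"] by linarith
      then have "c * (1 + ?e) * cmod (R p) \<le> 1 * cmod (R p)" by (intro mult_right_mono) auto
      then show "y \<in> fiber_set \<Phi> p" using y by (simp add: Disc)
    qed (use nz Disc in auto)
    show ?thesis
      by (rule insert_core1[OF fam]) (use DS in \<open>auto simp: Disc wide_fiber_def closed_ring_def norm_mult\<close>)
  next
    case (PDisc R)
    have fam: "\<exists>I. fiber_cover \<sigma> G \<Phi> ?M (closed_ring R (?s) (?d)) I"
    proof (rule disc_family[OF \<sigma>(1) \<rho> ds(1) lnV(1) V])
      fix p y c assume c: "?s \<le> c" "c \<le> ?d" and y: "c * (1 - ?e) * cmod (R p) < cmod y" "cmod y < c * (1 + ?e) * cmod (R p)"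
      have "c * (1 + ?e) \<le> 1" using c e de1 mult_right_mono[of c ?d "1 + ?e"] by linarith
      then have "c * (1 + ?e) * cmod (R p) \<le> 1 * cmod (R p)" by (intro mult_right_mono) auto
      moreover have "0 \<le> c * (1 - ?e) * cmod (R p)" using c ds e by simp
      ultimately show "y \<in> fiber_set \<Phi> p" using y unfolding PDisc fiber_set.simps mem_Collect_eq by linarith
    qed (use nz PDisc in auto)
    show ?thesis
      by (rule insert_core1[OF fam]) (use ds in \<open>auto simp: PDisc wide_fiber_def closed_ring_def norm_mult\<close>)
  next
    case (IDisc R)
    have fam: "\<exists>I. fiber_cover \<sigma> G \<Phi> ?M (closed_ring R (1 / ?d) (1 / ?s)) I"
    proof (rule disc_family[OF \<sigma>(1) \<rho> _ lnV(2) V])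
      fix p y c assume c: "1 / ?d \<le> c" and y: "c * (1 - ?e) * cmod (R p) < cmod y"
      have "0 < 1 / ?d" using ds by simp
      then have "0 < c" using c by linarith
      then have "1 / ?d * ?d \<le> c * (1 - ?e)" using c ds de2 e by (intro mult_mono) auto
      then have "1 \<le> c * (1 - ?e)" using ds by simp
      then have "1 * cmod (R p) \<le> c * (1 - ?e) * cmod (R p)" by (intro mult_right_mono) auto
      then show "y \<in> fiber_set \<Phi> p" using y by (simp add: IDisc)
    qed (use nz IDisc ds in auto)
    show ?thesis
      by (rule insert_core1[OF fam]) (use ds in \<open>auto simp: IDisc wide_fiber_def closed_ring_def norm_divide\<close>)
  next
    case (Annulus R1 R2)
    have nz12: "R1 p \<noteq> 0" "R2 p \<noteq> 0" if "p \<in> G" for p using nz that Annulus by auto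
    have low: "cmod (R1 p) < cmod y" if "1 / ?d \<le> c" "c * (1 - ?e) * cmod (R1 p) < cmod y" for p y c
    proof -
      have "0 < 1 / ?d" using ds by simp
      then have "0 < c" using that(1) by linarith
      then have "1 / ?d * ?d \<le> c * (1 - ?e)" using that(1) ds de2 e by (intro mult_mono) auto
      then have "1 \<le> c * (1 - ?e)" using ds by simp
      then have "1 * cmod (R1 p) \<le> c * (1 - ?e) * cmod (R1 p)" by (intro mult_right_mono) auto
      then show ?thesis using that(2) by simp
    qed
    consider "wide_fiber ?s G \<Phi>" | v where "v + pi\<^sup>2 / (4 * \<rho>) \<le> 3 * (pi\<^sup>2 / (2 * \<sigma>))"
      "\<And>p. p \<in> G \<Longrightarrow> v \<le> ln (cmod (R2 p) / cmod (R1 p)) \<and>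
           ln (cmod (R2 p) / cmod (R1 p)) \<le> v + pi\<^sup>2 / (4 * \<rho>)"
      using ann[OF Annulus] by blast
    then show ?thesis
    proof cases
      case 1
      then have w: "cmod (R1 p) < ?s\<^sup>2 * cmod (R2 p)" if "p \<in> G" for p
        using that by (auto simp: wide_fiber_def Annulus)
      \<comment> \<open>The \<sigma>-core leaves two rings of the \<rho>-core uncovered, one along
        each boundary circle. The width \<open>w\<close> prevents the discs along one circle from
        crossing the other.\<close>
      have famR1: "\<exists>I. fiber_cover \<sigma> G \<Phi> ?M (closed_ring R1 (1 / ?d) (1 / ?s)) I"
      proof (rule disc_family[OF \<sigma>(1) \<rho> _ lnV(2) V])
        fix p y c assume p: "p \<in> G" and c: "1 / ?d \<le> c" "c \<le> 1 / ?s"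
          and y: "c * (1 - ?e) * cmod (R1 p) < cmod y" "cmod y < c * (1 + ?e) * cmod (R1 p)"
        have "?d * (1 + ?e) \<le> 1" using de1 by simp
        then have "?s * (1 + ?e) \<le> 1" using ds e mult_right_mono[of ?s ?d "1 + ?e"] by linarith
        then have "1 + ?e \<le> 1 / ?s" using ds by (simp add: field_simps)
        then have "c * (1 + ?e) \<le> 1 / ?s * (1 / ?s)" using c(2) ds e by (intro mult_mono) auto
        then have "c * (1 + ?e) * cmod (R1 p) \<le> 1 / ?s * (1 / ?s) * cmod (R1 p)" by (intro mult_right_mono) auto
        also have "\<dots> < cmod (R2 p)" using w[OF p] ds by (simp add: field_simps power2_eq_square)
        finally show "y \<in> fiber_set \<Phi> p" using y low[OF c(1) y(1)] by (simp add: Annulus)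
      qed (use nz Annulus ds in auto)
      have famR2: "\<exists>I. fiber_cover \<sigma> G \<Phi> ?M (closed_ring R2 (?s) (?d)) I"
      proof (rule disc_family[OF \<sigma>(1) \<rho> ds(1) lnV(1) V])
        fix p y c assume p: "p \<in> G" and c: "?s \<le> c" "c \<le> ?d"
          and y: "c * (1 - ?e) * cmod (R2 p) < cmod y" "cmod y < c * (1 + ?e) * cmod (R2 p)"
        have "c * (1 + ?e) \<le> 1" using c e de1 mult_right_mono[of c ?d "1 + ?e"] by linarith
        then have up: "c * (1 + ?e) * cmod (R2 p) \<le> 1 * cmod (R2 p)" by (intro mult_right_mono) auto
        have "?s * ?s \<le> c * (1 - ?e)" using c ds de2 by (intro mult_mono) auto
        then have "?s * ?s * cmod (R2 p) \<le> c * (1 - ?e) * cmod (R2 p)" by (intro mult_right_mono) auto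
        then show "y \<in> fiber_set \<Phi> p" using y up w[OF p] by (simp add: Annulus power2_eq_square)
      qed (use nz Annulus in auto)
      from famR1 famR2 obtain I J where "fiber_cover \<sigma> G \<Phi> ?M (closed_ring R1 (1 / ?d) (1 / ?s)) I"
        "fiber_cover \<sigma> G \<Phi> ?M (closed_ring R2 ?s ?d) J" by blast
      from fiber_cover_Un[OF this] show ?thesis
        by (intro insert_core[OF _ 1]) (use ds in \<open>auto simp: Annulus closed_ring_def norm_mult norm_divide\<close>)
    next
      case (2 v)
      \<comment> \<open>Upper end of the ring in units of \<open>R1\<close>: it reaches
        \<open>ann_delta \<rho> * cmod (R2 p)\<close> even where the fiber is widest. As it equals
        \<open>exp v * q\<close>, the discs still stay inside where the fiber is narrowest.\<close>
      let ?b = "exp (v + pi\<^sup>2 / (4 * \<rho>)) * ?d"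
      have dq: "?d = q * q" using q by (simp add: power2_eq_square)
      have bv: "?b = exp v * q" using q(1)
        by (simp add: dq q_def exp_add exp_minus)
      have famR1: "\<exists>I. fiber_cover \<sigma> G \<Phi> ?M (closed_ring R1 (1 / ?d) (?b)) I"
      proof (rule disc_family[OF \<sigma>(1) \<rho> _ _ V])
        have "ln (?b / (1 / ?d)) = v + pi\<^sup>2 / (4 * \<rho>) + 2 * ln ?d"
          using ds by (simp add: ln_mult)
        also have "\<dots> \<le> 3 * (pi\<^sup>2 / (2 * \<sigma>))" using 2(1) ds by (smt (verit) ln_less_zero)
        also have "\<dots> \<le> ?V" using disc_delta_pos[OF \<sigma>(1)] by (simp add: log_range_def)
        finally show "ln (?b / (1 / ?d)) \<le> ?V" .
        fix p y c assume p: "p \<in> G" and c: "1 / ?d \<le> c" "c \<le> ?b"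
          and y: "c * (1 - ?e) * cmod (R1 p) < cmod y" "cmod y < c * (1 + ?e) * cmod (R1 p)"
        have "c * (1 + ?e) \<le> exp v * q * (1 + ?e)" using c(2) e unfolding bv by (intro mult_right_mono) auto
        also have "\<dots> \<le> exp v" using mult_left_mono[OF e1, of "exp v"] by (simp add: mult.assoc)
        also have "\<dots> \<le> cmod (R2 p) / cmod (R1 p)"
          using 2(2)[OF p] nz12[OF p] by (metis exp_le_cancel_iff exp_ln divide_pos_pos zero_less_norm_iff)
        finally have "c * (1 + ?e) * cmod (R1 p) \<le> cmod (R2 p)" using nz12[OF p] by (simp add: field_simps)
        then show "y \<in> fiber_set \<Phi> p" using y low[OF c(1) y(1)] by (simp add: Annulus)
      qed (use nz Annulus ds in auto)
      have "fiber_set (core_fiber \<rho> \<Phi>) p \<subseteq> closed_ring R1 (1 / ?d) ?b p" if p: "p \<in> G" for p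
      proof
        fix y assume y: "y \<in> fiber_set (core_fiber \<rho> \<Phi>) p"
        have y1: "1 / ?d * cmod (R1 p) \<le> cmod y" "cmod y \<le> ?d * cmod (R2 p)"
          using y ds by (auto simp: Annulus norm_mult norm_divide)
        have "cmod (R2 p) / cmod (R1 p) \<le> exp (v + pi\<^sup>2 / (4 * \<rho>))"
          using 2(2)[OF p] nz12[OF p] by (metis exp_le_cancel_iff exp_ln divide_pos_pos zero_less_norm_iff)
        then have "cmod (R2 p) \<le> exp (v + pi\<^sup>2 / (4 * \<rho>)) * cmod (R1 p)" using nz12[OF p] by (simp add: field_simps)
        then have "?d * cmod (R2 p) \<le> ?b * cmod (R1 p)" using ds by (simp add: mult.left_commute mult_left_mono)
        then show "y \<in> closed_ring R1 (1 / ?d) ?b p" using y1 unfolding closed_ring_def by simp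
      qed
      moreover have "?M \<le> refinement_size \<rho> \<sigma>" using M by (simp add: refinement_size_def)
      ultimately show ?thesis using famR1 fiber_cover_mono by metis
    qed
  qed
qed

section \<open>Translations and pieces of a cover\<close>

text \<open>The formula is imposed on every list of the right length, so it survives replacing one
  coordinate, as in the partial derivative, and passing to a smaller cell.\<close>

definition unit_translation :: "ccell \<Rightarrow> (complex list \<Rightarrow> complex list) \<Rightarrow> bool" where
  "unit_translation E f \<longleftrightarrow> (\<exists>g.
     (\<forall>z. length z = cell_length E \<longrightarrow> length (f z) = cell_length E \<and>
        (\<forall>j<cell_length E. f z ! j = z ! j + g j (take j z))) \<and>
     (\<forall>j<cell_length E. holo_on (take j ` cell_set E) (g j)))"

lemma holo_on_take:
  assumes "holo_on (take j ` X) g" "\<And>z. z \<in> X \<Longrightarrow> j \<le> length z"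
  shows "holo_on X (\<lambda>z. g (take j z))"
proof (rule holo_on_compose[OF assms(1), where m = j])
  show "holo_on X (\<lambda>z. take j z ! i)" if "i < j" for i
  proof (subst holo_on_cong[of _ _ "\<lambda>z. z ! i"])
    show "holo_on X (\<lambda>z. z ! i)"
      by (rule holo_on_nth) (use that assms(2) in \<open>blast intro: less_le_trans\<close>)
  qed (use that in auto)
qed (use assms(2) in auto)

lemma unit_translation_length:
  "unit_translation E f \<Longrightarrow> length z = cell_length E \<Longrightarrow> length (f z) = cell_length E"
  unfolding unit_translation_def by blast

lemma unit_translation_holo:
  assumes "unit_translation E f" "j < cell_length E"
  shows "holo_on (cell_set E) (\<lambda>z. f z ! j)"
proof -
  obtain g where g: "\<And>z. length z = cell_length E \<Longrightarrow> f z ! j = z ! j + g (take j z)"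
    "holo_on (take j ` cell_set E) g"
    using assms unfolding unit_translation_def by metis
  have "holo_on (cell_set E) (\<lambda>z. z ! j + g (take j z))"
    using assms(2) by (intro holo_on_add holo_on_nth holo_on_take g(2)) (auto simp: length_cell_set)
  then show ?thesis using g(1) by (subst holo_on_cong[of _ _ "\<lambda>z. z ! j + g (take j z)"]) (auto simp: length_cell_set)
qed

lemma unit_translation_cellular:
  assumes "unit_translation E f"
  shows "cellular_map E f" "translate_map E f"
proof -
  obtain g where g: "\<And>z. length z = cell_length E \<Longrightarrow> length (f z) = cell_length E"
    "\<And>z j. length z = cell_length E \<Longrightarrow> j < cell_length E \<Longrightarrow> f z ! j = z ! j + g j (take j z)"
    "\<And>j. j < cell_length E \<Longrightarrow> holo_on (take j ` cell_set E) (g j)"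
    using assms unfolding unit_translation_def by metis
  show "translate_map E f"
    unfolding translate_map_def
  proof (intro allI impI)
    fix j assume "j < cell_length E"
    then show "\<exists>s g. (s = 1 \<or> s = -1) \<and> holo_on (take j ` cell_set E) g \<and>
        (\<forall>z\<in>cell_set E. f z ! j = s * z ! j + g (take j z))"
      using g(2,3) length_cell_set by (intro exI[of _ 1] exI[of _ "g j"]) auto
  qed
  show "cellular_map E f"
    unfolding cellular_map_def
  proof (intro conjI ballI allI impI)
    show "length (f z) = cell_length E" if "z \<in> cell_set E" for z using g(1) that length_cell_set by blast
    fix j assume j: "j < cell_length E"
    show "holo_on (cell_set E) (\<lambda>z. f z ! j)" using unit_translation_holo[OF assms j] .
    show "f z ! j = f w ! j" if "z \<in> cell_set E" "w \<in> cell_set E" "take (Suc j) z = take (Suc j) w" for z w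
    proof -
      have "take j z = take j w" using that(3) by (metis min.absorb1 le_SucI order_refl take_take)
      moreover have "z ! j = w ! j" using that(3) by (metis lessI nth_take)
      ultimately show ?thesis using g(2) j that length_cell_set by simp
    qed
    show "deriv (\<lambda>t. f (z[j := t]) ! j) (z ! j) \<noteq> 0" if "z \<in> cell_set E" for z
    proof -
      have "length z = cell_length E" using that length_cell_set by blast
      then have "(\<lambda>t. f (z[j := t]) ! j) = (\<lambda>t. t + g j (take j z))" using g(2) j by auto
      moreover have "((\<lambda>t. t + g j (take j z)) has_field_derivative 1) (at (z ! j))"
        by (auto intro!: derivative_eq_intros)
      ultimately show ?thesis using DERIV_imp_deriv by force
    qed
  qed
qed

lemma unit_translation_subset:
  assumes "unit_translation E f" "cell_set E' \<subseteq> cell_set E" "cell_length E' = cell_length E"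
  shows "unit_translation E' f"
proof -
  have "holo_on (take j ` cell_set E') g" if "holo_on (take j ` cell_set E) g" for j g
    using holo_on_subset[OF that image_mono[OF assms(2)]] .
  then show ?thesis using assms(1) unfolding unit_translation_def assms(3) by blast
qed

definition snoc_map :: "(complex list \<Rightarrow> complex list) \<Rightarrow> (complex list \<Rightarrow> complex) \<Rightarrow> complex list \<Rightarrow> complex list" where
  "snoc_map f g z = f (butlast z) @ [last z + g (butlast z)]"

lemma unit_translation_snoc:
  assumes f: "unit_translation E f" and h: "holo_on (cell_set E) h"
  shows "unit_translation (E \<odot> \<Psi>) (snoc_map f h)"
proof -
  let ?n = "cell_length E"
  obtain g where g: "\<And>z. length z = ?n \<Longrightarrow> length (f z) = ?n"
    "\<And>z j. length z = ?n \<Longrightarrow> j < ?n \<Longrightarrow> f z ! j = z ! j + g j (take j z)"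
    "\<And>j. j < ?n \<Longrightarrow> holo_on (take j ` cell_set E) (g j)"
    using f unfolding unit_translation_def by metis
  define g' where "g' = (\<lambda>j. if j = ?n then h else g j)"
  show ?thesis
    unfolding unit_translation_def
  proof (intro exI[of _ g'] conjI allI impI)
    fix z :: "complex list" assume "length z = cell_length (E \<odot> \<Psi>)"
    then have "length z = Suc ?n" by simp
    then obtain x y where z: "z = x @ [y]" "length x = ?n" by (rule length_SucE)
    show "length (snoc_map f h z) = cell_length (E \<odot> \<Psi>)" using z g(1) by (simp add: snoc_map_def)
    fix j assume "j < cell_length (E \<odot> \<Psi>)"
    then show "snoc_map f h z ! j = z ! j + g' j (take j z)"
      using z g(1,2) by (auto simp: snoc_map_def g'_def nth_append)
  next
    fix j assume j: "j < cell_length (E \<odot> \<Psi>)"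
    have tk: "take j ` cell_set (E \<odot> \<Psi>) \<subseteq> take j ` cell_set E"
      using j by (auto simp: length_cell_set)
    show "holo_on (take j ` cell_set (E \<odot> \<Psi>)) (g' j)"
    proof (cases "j = ?n")
      case True
      have "take j ` cell_set E \<subseteq> cell_set E" using True by (auto simp: length_cell_set)
      then show ?thesis using True holo_on_subset[OF h] tk by (auto simp: g'_def)
    next
      case False
      then show ?thesis using j holo_on_subset[OF g(3) tk] by (auto simp: g'_def)
    qed
  qed
qed

section \<open>Pullback of fibers, and fibers as cores of their extensions\<close>

primrec pull_fiber :: "(complex list \<Rightarrow> complex list) \<Rightarrow> fiber \<Rightarrow> fiber" where
  "pull_fiber f Star = Star"
| "pull_fiber f (Disc r) = Disc (\<lambda>x. r (f x))"
| "pull_fiber f (PDisc r) = PDisc (\<lambda>x. r (f x))"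
| "pull_fiber f (IDisc r) = IDisc (\<lambda>x. r (f x))"
| "pull_fiber f (Annulus r1 r2) = Annulus (\<lambda>x. r1 (f x)) (\<lambda>x. r2 (f x))"

lemma fiber_set_pull: "fiber_set (pull_fiber f \<Psi>) x = fiber_set \<Psi> (f x)"
  by (cases \<Psi>) auto

lemma shrink_pull: "shrink_fiber s t (pull_fiber f \<Psi>) = pull_fiber f (shrink_fiber s t \<Psi>)"
  by (cases \<Psi>) auto

lemma radii_pull: "radii (pull_fiber f \<Psi>) = (\<lambda>r x. r (f x)) ` radii \<Psi>"
  by (cases \<Psi>) auto

lemma wide_fiber_pull: "wide_fiber t (f ` X) \<Psi> \<Longrightarrow> wide_fiber t X (pull_fiber f \<Psi>)"
  by (cases \<Psi>) (auto simp: wide_fiber_def)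

lemma wide_mono:
  assumes "wide t C" "0 \<le> t" "t \<le> t'"
  shows "wide t' C"
  using assms(1)
proof (induction C)
  case (Odot C \<Phi>)
  have "wide_fiber t' (cell_set C) \<Phi>"
    unfolding wide_fiber_def
  proof (intro allI impI ballI)
    fix r1 r2 x assume "\<Phi> = Annulus r1 r2" "x \<in> cell_set C"
    then have "cmod (r1 x) < t\<^sup>2 * cmod (r2 x)" using Odot.prems by (auto simp: wide_fiber_def)
    also have "\<dots> \<le> t'\<^sup>2 * cmod (r2 x)" using assms by (intro mult_right_mono power_mono) auto
    finally show "cmod (r1 x) < t'\<^sup>2 * cmod (r2 x)" .
  qed
  then show ?case using Odot by simp
qed simp

text \<open>The radii of an extension are prescribed over the original base, and over it the
  original fiber is the core of the extended one. This suffices, as only the original cell has to be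
  covered.\<close>

lemma fiber_set_extension:
  assumes "fiber_extension (ext_delta \<rho> \<Phi>) X \<Phi> \<Phi>'" "x \<in> X" "0 < \<rho>"
  shows "fiber_set \<Phi> x = fiber_set (core_fiber \<rho> \<Phi>') x"
proof -
  have d: "ext_delta \<rho> (Disc r) = disc_delta \<rho>" "ext_delta \<rho> (PDisc r) = ann_delta \<rho>"
    "ext_delta \<rho> (IDisc r) = ann_delta \<rho>" "ext_delta \<rho> (Annulus r r') = ann_delta \<rho>" for r r'
    by (auto simp: disc_delta_def ann_delta_def)
  have "disc_delta \<rho> \<noteq> 0" "ann_delta \<rho> \<noteq> 0"
    using disc_delta_pos[OF assms(3)] ann_delta_pos[of \<rho>] by auto
  then show ?thesis using assms(1,2)
    by (cases \<Phi>; cases \<Phi>') (auto simp: d simp del: ext_delta.simps)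
qed

text \<open>Holomorphy is inherited from the radii of \<open>\<Phi>\<close>. The two radii of an
  annulus \<open>\<Psi>\<close> are arbitrary multiples of them, so their order comes from the width
  condition.\<close>

lemma radii_multiple_over:
  assumes Y: "fiber_over Y \<Phi>" and f: "f ` X \<subseteq> Y"
    and comp: "\<And>h. holo_on Y h \<Longrightarrow> holo_on X (\<lambda>x. h (f x))"
    and \<Psi>: "translated_subfiber \<sigma> (f ` X) \<Phi> (\<Psi>, g)" and \<sigma>: "0 < \<sigma>"
  shows "fiber_over X (pull_fiber f \<Psi>)" "holo_on X (\<lambda>x. g (f x))"
proof -
  have rad: "holo_on X r \<and> (\<forall>x\<in>X. r x \<noteq> 0)" if r: "r \<in> radii (pull_fiber f \<Psi>)" for r
  proof -
    obtain c R where cR: "c \<noteq> 0" "R \<in> radii \<Phi>" "r = (\<lambda>x. c * R (f x))"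
      using r \<Psi> unfolding translated_subfiber_def radii_pull by fastforce
    have "holo_on Y R" "\<forall>p\<in>Y. R p \<noteq> 0" using Y cR(2) by (auto simp: fiber_over_def)
    then show ?thesis using cR f comp by (auto intro!: holo_on_cmult)
  qed
  have w: "wide_fiber (ann_delta \<sigma>) X (pull_fiber f \<Psi>)"
    using \<Psi> by (intro wide_fiber_pull) (simp add: translated_subfiber_def)
  have "cmod (r1 x) < cmod (r2 x)" if "pull_fiber f \<Psi> = Annulus r1 r2" "x \<in> X" for r1 r2 x
  proof -
    have "cmod (r1 x) < (ann_delta \<sigma>)\<^sup>2 * cmod (r2 x)" using w that by (auto simp: wide_fiber_def)
    also have "\<dots> \<le> 1 * cmod (r2 x)"
      using ann_delta_pos[of \<sigma>] ann_delta_less_1[OF \<sigma>] by (intro mult_right_mono power_le_one) auto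
    finally show ?thesis by simp
  qed
  then show "fiber_over X (pull_fiber f \<Psi>)" using rad by (auto simp: fiber_over_def)
  have "(\<forall>p. g p = 0) \<or> (\<exists>c. \<exists>R\<in>radii \<Phi>. \<forall>p. g p = c * R p)"
    using \<Psi> by (auto simp: translated_subfiber_def)
  then show "holo_on X (\<lambda>x. g (f x))"
    using Y comp by (auto simp: fiber_over_def holo_on_const intro!: holo_on_cmult)
qed

context sharp_filtration
begin

text \<open>\<open>E\<close> is the extended cell, mapped into the extended target \<open>C\<close>;
  its \<sigma>-core does the covering. The number \<open>b\<close> bounds the complexity of cell and
  map together.\<close>

definition piece :: "nat \<Rightarrow> nat \<Rightarrow> nat \<Rightarrow> real \<Rightarrow> ccell \<Rightarrow> ccell \<times> (complex list \<Rightarrow> complex list) \<Rightarrow> bool" where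
  "piece F D b \<sigma> C = (\<lambda>(E, f). is_ccell E \<and> cell_length E = cell_length C \<and> wide (ann_delta \<sigma>) E \<and>
     unit_translation E f \<and> f ` cell_set E \<subseteq> cell_set C \<and> tame_cell F D b E \<and>
     tame F D b (cell_length E + cell_length E) {z @ f z |z. z \<in> cell_set E})"

text \<open>Trades extension for room: the factor \<open>t\<close> accounts for the change of
  parameter, since the width condition concerns annuli, while \<open>s\<close> may be any factor up
  to 1.\<close>

lemma piece_shrink:
  "\<exists>b'. \<forall>F D \<sigma> \<sigma>' s t C E f. 0 < \<sigma> \<longrightarrow> 0 < s \<longrightarrow> s \<le> 1 \<longrightarrow> 0 < t \<longrightarrow> t \<le> 1 \<longrightarrow> cell_length C = n \<longrightarrow>
     piece F D b \<sigma>' C (E, f) \<longrightarrow> ann_delta \<sigma>' = ann_delta \<sigma> * t \<longrightarrow> piece F D b' \<sigma> C (shrink s t E, f)"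
proof -
  obtain b1 where b1: "\<And>F D s t E. \<lbrakk>0 < s; s \<le> 1; 0 < t; t \<le> 1; is_ccell E; cell_length E = n;
    tame_cell F D b E\<rbrakk> \<Longrightarrow> tame_cell F D b1 (shrink s t E)" using tame_cell_shrink[of n b] by blast
  let ?b2 = "b + (b1 + reindex_cost (n + n) n)"
  show ?thesis
  proof (intro exI[of _ ?b2] allI impI)
    fix F D and \<sigma> \<sigma>' s t :: real and C E f
    assume \<sigma>: "0 < \<sigma>" and st: "0 < s" "s \<le> 1" "0 < t" "t \<le> 1" and n: "cell_length C = n"
      and p: "piece F D b \<sigma>' C (E, f)" and t: "ann_delta \<sigma>' = ann_delta \<sigma> * t"
    have E: "is_ccell E" "cell_length E = n" "wide (ann_delta \<sigma> * t) E" "unit_translation E f"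
      "f ` cell_set E \<subseteq> cell_set C" "tame_cell F D b E" "tame F D b (n + n) {z @ f z |z. z \<in> cell_set E}"
      using p n t by (auto simp: piece_def)
    let ?E = "shrink s t E"
    have sub: "cell_set ?E \<subseteq> cell_set E" using shrink_subset[OF st] .
    have tE: "tame_cell F D b1 ?E" using b1[OF st E(1,2,6)] .
    have "ann_delta \<sigma> * t \<le> t" "0 < ann_delta \<sigma> * t"
      using ann_delta_pos[of \<sigma>] ann_delta_less_1[OF \<sigma>] st by auto
    then have "is_ccell ?E" using E(1,3) st by (intro is_ccell_shrink[of E "ann_delta \<sigma> * t"]) auto
    moreover have "wide (ann_delta \<sigma>) ?E" using E(3) st by (intro wide_shrink)
    moreover have "unit_translation ?E f" using unit_translation_subset[OF E(4) sub] by simp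
    moreover have "f ` cell_set ?E \<subseteq> cell_set C" using sub E(5) by blast
    moreover have "tame_cell F D ?b2 ?E" by (rule tame_cell_mono[OF tE]) simp
    moreover have "tame F D ?b2 (n + n) {z @ f z |z. z \<in> cell_set ?E}"
      using tame_cell_set[OF tE] E(2) sub
      by (intro tame_graph_restrict[OF E(7)]) (auto simp: length_cell_set)
    ultimately show "piece F D ?b2 \<sigma> C (?E, f)" using E(2) n by (simp add: piece_def)
  qed
qed

text \<open>Fiber and shift are given over the target and pulled back along \<open>f\<close>. Each
  is built from multiples of radii of \<open>\<Phi>\<close> composed with \<open>f\<close>, so the
  new bound depends on \<open>n\<close> and \<open>b\<close> alone.\<close>

lemma piece_snoc:
  "\<exists>b'. \<forall>F D \<sigma> C \<Phi> E f \<Psi> g. 0 < \<sigma> \<longrightarrow> cell_length C = n \<longrightarrow> is_ccell (C \<odot> \<Phi>) \<longrightarrow>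
     tame_cell F D 1 (C \<odot> \<Phi>) \<longrightarrow> piece F D b \<sigma> C (E, f) \<longrightarrow>
     translated_subfiber \<sigma> (f ` cell_set E) \<Phi> (\<Psi>, g) \<longrightarrow>
     piece F D b' \<sigma> (C \<odot> \<Phi>) (E \<odot> pull_fiber f \<Psi>, snoc_map f (\<lambda>x. g (f x)))"
proof -
  define b1 where "b1 = b + reindex_cost (n + 1 + n) (n + n) + (1 + reindex_cost (n + 1 + n) (n + 1))
    + reindex_cost (n + 2) (n + 1) + (10 + reindex_cost (n + 2) 2)"
  define b2 where "b2 = b1 + (b + reindex_cost (n + 1) n + (6 + reindex_cost (n + 1) 1))"
  define b3 where "b3 = odot_cost n b b1"
  define N where "N = n + n + 3"
  define b4 where "b4 = b3 + reindex_cost N (n + 1) + (b + reindex_cost N (n + n) +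
      (b2 + reindex_cost N (n + 1) + (14 + reindex_cost N 3)))"
  show ?thesis
  proof (intro exI[of _ b4] allI impI)
    fix F D \<sigma> C \<Phi> E f \<Psi> g
    assume \<sigma>: "0 < \<sigma>" and n: "cell_length C = n" and C: "is_ccell (C \<odot> \<Phi>)" and tC: "tame_cell F D 1 (C \<odot> \<Phi>)"
      and p: "piece F D b \<sigma> C (E, f)" and \<Psi>: "translated_subfiber \<sigma> (f ` cell_set E) \<Phi> (\<Psi>, g)"
    have E: "is_ccell E" "cell_length E = n" "wide (ann_delta \<sigma>) E" "unit_translation E f"
      "f ` cell_set E \<subseteq> cell_set C" "tame_cell F D b E" "tame F D b (n + n) {z @ f z |z. z \<in> cell_set E}"
      using p n by (auto simp: piece_def)
    let ?E = "E \<odot> pull_fiber f \<Psi>" and ?f = "snoc_map f (\<lambda>x. g (f x))"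
    have fo: "fiber_over (cell_set C) \<Phi>" using C by simp
    have lenE: "length x = n" "length (f x) = n" "f x \<in> cell_set C" if "x \<in> cell_set E" for x
      using that E(2,5) n length_cell_set by auto
    have comp: "holo_on (cell_set E) (\<lambda>x. h (f x))" if "holo_on (cell_set C) h" for h
      by (rule holo_on_compose[OF that, of _ _ n])
         (use lenE unit_translation_holo[OF E(4)] E(2) in auto)
    note over = radii_multiple_over[OF fo E(5) comp \<Psi> \<sigma>]
    have wf: "wide_fiber (ann_delta \<sigma>) (cell_set E) (pull_fiber f \<Psi>)"
      using \<Psi> by (intro wide_fiber_pull) (simp add: translated_subfiber_def)
    have mult: "tame F D b1 (n + 1) (list_graph (cell_set E) (\<lambda>x. c * R (f x)))" if R: "R \<in> radii \<Phi>" for c R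
    proof -
      have "tame F D 1 (n + 1) (list_graph (cell_set C) R)"
        using tC R n unfolding tame_cell_Odot_iff by auto
      from tame_graph_compose[OF E(7) this] lenE
      have "tame F D (b + reindex_cost (n + 1 + n) (n + n) + (1 + reindex_cost (n + 1 + n) (n + 1))) (n + 1)
        (list_graph (cell_set E) (\<lambda>x. R (f x)))" by (simp add: length_cell_set n)
      from tame_graph_cmult[OF this] show ?thesis using lenE by (simp add: b1_def)
    qed
    have rad: "tame F D b1 (n + 1) (list_graph (cell_set E) r)" if r: "r \<in> radii (pull_fiber f \<Psi>)" for r
    proof -
      obtain c R where "R \<in> radii \<Phi>" "r = (\<lambda>x. c * R (f x))"
        using r \<Psi> unfolding translated_subfiber_def radii_pull by fastforce
      then show ?thesis using mult by simp
    qed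
    have gt: "tame F D b2 (n + 1) (list_graph (cell_set E) (\<lambda>x. g (f x)))"
    proof -
      have "g = (\<lambda>p. 0) \<or> (\<exists>c. \<exists>R\<in>radii \<Phi>. g = (\<lambda>p. c * R p))"
        using \<Psi> by (auto simp: translated_subfiber_def)
      then show ?thesis
      proof
        assume "g = (\<lambda>p. 0)"
        then show ?thesis using tame_graph_zero[OF tame_cell_set[OF E(6)]] E(2)
          by (auto simp: b2_def elim!: tame_mono)
      next
        assume "\<exists>c. \<exists>R\<in>radii \<Phi>. g = (\<lambda>p. c * R p)"
        then obtain c R where R: "R \<in> radii \<Phi>" "g = (\<lambda>p. c * R p)" by blast
        show ?thesis unfolding R(2) by (rule tame_mono[OF mult[OF R(1)]]) (simp add: b2_def)
      qed
    qed
    have tE: "tame_cell F D b3 ?E" unfolding b3_def using tame_cell_Odot[OF E(6,2) rad] by simp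
    have "tame F D b3 (n + 1) (cell_set ?E)" using tame_cell_set[OF tE] E(2) by simp
    from tame_graph_snoc_add[OF this E(7) gt] lenE
    have "tame F D b4 (n + 1 + (n + 1)) {z @ ?f z |z. z \<in> cell_set ?E}"
      unfolding snoc_map_def b4_def N_def by auto
    moreover have "is_ccell ?E" using E(1) over(1) by simp
    moreover have "cell_length ?E = cell_length (C \<odot> \<Phi>)" using E(2) n by simp
    moreover have "wide (ann_delta \<sigma>) ?E" using E(3) wf by simp
    moreover have "unit_translation ?E ?f" by (rule unit_translation_snoc[OF E(4) over(2)])
    moreover have "?f ` cell_set ?E \<subseteq> cell_set (C \<odot> \<Phi>)"
      using \<Psi> E(5) by (auto simp: snoc_map_def fiber_set_pull translated_subfiber_def)
    moreover have "tame_cell F D b4 ?E" by (rule tame_cell_mono[OF tE]) (simp add: b4_def)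
    ultimately show "piece F D b4 \<sigma> (C \<odot> \<Phi>) (?E, ?f)" using E(2) by (simp add: piece_def)
  qed
qed

end

section \<open>Choice of the parameters\<close>

text \<open>Tuned to the \<open>2 * n\<close> comparisons in the base: each factor is at most
  \<open>exp (3 * \<eta>)\<close>, and \<open>6 * n * \<eta> \<le> \<sigma> / (16 * \<rho>)\<close>,
  so the product exceeds 1 by at most \<open>\<sigma> / (8 * \<rho>)\<close>.\<close>

definition harnack_eta :: "nat \<Rightarrow> real \<Rightarrow> real \<Rightarrow> real" where
  "harnack_eta n \<rho> \<sigma> = \<sigma> / (96 * (real n + 1) * \<rho>)"

text \<open>The first summand makes the relative change over one turn at most \<eta>; the second
  puts the truncation level at twice the logarithmic width below which an annulus has to be covered
  by discs.\<close>

definition harnack_trunc :: "nat \<Rightarrow> real \<Rightarrow> real \<Rightarrow> real" where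
  "harnack_trunc n \<rho> \<sigma> = 2 * pi / harnack_eta n \<rho> \<sigma> + 4 * (pi\<^sup>2 / (2 * \<sigma>))"

text \<open>The extension of the base that makes the width of an annulus over it almost constant.\<close>

definition base_sigma :: "nat \<Rightarrow> real \<Rightarrow> real \<Rightarrow> real" where
  "base_sigma n \<rho> \<sigma> = 1 / (1 / \<sigma> + 2 / pi\<^sup>2 * (2 * pi + 2 * harnack_trunc n \<rho> \<sigma>)
     + 3 * (1 / \<sigma> + 1) / harnack_eta n \<rho> \<sigma>)"

context
  fixes n :: nat and \<rho> \<sigma> :: real
  assumes \<sigma>: "0 < \<sigma>" "\<sigma> < \<rho>"
begin

lemma harnack_eta_bounds: "0 < harnack_eta n \<rho> \<sigma>" "harnack_eta n \<rho> \<sigma> \<le> 1 / 96"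
proof -
  show "0 < harnack_eta n \<rho> \<sigma>" using \<sigma> by (simp add: harnack_eta_def)
  have "96 * \<sigma> \<le> (real n + 1) * (96 * \<rho>)"
    using \<sigma> mult_right_mono[of 1 "real n + 1" "96 * \<rho>"] by linarith
  then show "harnack_eta n \<rho> \<sigma> \<le> 1 / 96" using \<sigma> by (simp add: harnack_eta_def divide_le_eq mult_ac)
qed

lemma harnack_trunc_bounds:
  "0 < harnack_trunc n \<rho> \<sigma>" "2 * pi / harnack_trunc n \<rho> \<sigma> \<le> harnack_eta n \<rho> \<sigma>"
  "4 * (pi\<^sup>2 / (2 * \<sigma>)) \<le> harnack_trunc n \<rho> \<sigma>"
proof -
  let ?h = "harnack_eta n \<rho> \<sigma>" and ?T = "harnack_trunc n \<rho> \<sigma>"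
  have a: "0 < 2 * pi / ?h" "0 < 4 * (pi\<^sup>2 / (2 * \<sigma>))" using harnack_eta_bounds \<sigma> by auto
  then show T: "0 < ?T" "4 * (pi\<^sup>2 / (2 * \<sigma>)) \<le> ?T" unfolding harnack_trunc_def by linarith+
  have "2 * pi / ?h \<le> ?T" using a unfolding harnack_trunc_def by linarith
  then show "2 * pi / ?T \<le> ?h" using T harnack_eta_bounds(1) by (simp add: divide_le_eq mult.commute)
qed

lemma harnack_factor_power_le:
  "1 \<le> harnack_factor (harnack_eta n \<rho> \<sigma>) ^ (2 * n)"
  "harnack_factor (harnack_eta n \<rho> \<sigma>) ^ (2 * n) \<le> 1 + \<sigma> / (8 * \<rho>)"
proof -
  let ?h = "harnack_eta n \<rho> \<sigma>"
  note h = harnack_eta_bounds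
  show "1 \<le> harnack_factor ?h ^ (2 * n)"
    using h by (intro one_le_power harnack_factor_ge_1) auto
  have "harnack_factor ?h \<le> 1 + 3 * ?h"
  proof -
    have "?h * ?h \<le> ?h * (1 / 96)" using h by (intro mult_left_mono) auto
    then have "1 + ?h \<le> (1 + 3 * ?h) * (1 - ?h)" using h by (simp add: algebra_simps)
    then show ?thesis using h by (simp add: harnack_factor_def divide_le_eq)
  qed
  also have "\<dots> \<le> exp (3 * ?h)" using exp_ge_add_one_self by simp
  finally have k: "harnack_factor ?h \<le> exp (3 * ?h)" .
  define x where "x = real (2 * n) * (3 * ?h)"
  have x0: "0 \<le> x" using h by (simp add: x_def)
  have "6 * real n * \<sigma> \<le> 6 * (real n + 1) * \<sigma>" using \<sigma> by simp
  then have x16: "x \<le> \<sigma> / (16 * \<rho>)"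
    using \<sigma> by (simp add: x_def harnack_eta_def divide_simps)
  have "\<sigma> / (16 * \<rho>) \<le> 1" using \<sigma> by simp
  then have x1: "x \<le> 1" using x16 by simp
  have "harnack_factor ?h ^ (2 * n) \<le> exp (3 * ?h) ^ (2 * n)"
    using k h by (intro power_mono) (auto simp: harnack_factor_def)
  also have "\<dots> = exp x" unfolding x_def by (rule exp_of_nat_mult[symmetric])
  also have "\<dots> \<le> 1 + x + x\<^sup>2" using exp_bound x0 x1 by blast
  also have "\<dots> \<le> 1 + 2 * x" using x0 x1 by (simp add: power2_eq_square mult_left_le)
  also have "\<dots> \<le> 1 + \<sigma> / (8 * \<rho>)" using x16 by simp
  finally show "harnack_factor ?h ^ (2 * n) \<le> 1 + \<sigma> / (8 * \<rho>)" .
qed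

text \<open>The summands serve one purpose each: the first makes the parameter smaller than
  \<sigma>, the second provides the logarithmic room \<open>2 * pi + 2 * T\<close> in annular
  fibers, the third makes the relative error in discs at most \<eta>.\<close>

lemma base_sigma_inverse:
  "1 / base_sigma n \<rho> \<sigma> = 1 / \<sigma> + 2 / pi\<^sup>2 * (2 * pi + 2 * harnack_trunc n \<rho> \<sigma>)
     + 3 * (1 / \<sigma> + 1) / harnack_eta n \<rho> \<sigma>"
  by (simp add: base_sigma_def)

lemma base_sigma_bounds: "0 < base_sigma n \<rho> \<sigma>" "base_sigma n \<rho> \<sigma> < \<sigma>"
proof -
  have a: "0 < 2 / pi\<^sup>2 * (2 * pi + 2 * harnack_trunc n \<rho> \<sigma>)"
    using harnack_trunc_bounds(1) by (simp add: add_pos_pos)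
  have b: "0 < 3 * (1 / \<sigma> + 1) / harnack_eta n \<rho> \<sigma>"
    using harnack_eta_bounds(1) \<sigma> by (simp add: add_pos_pos)
  have c: "0 < 1 / \<sigma>" using \<sigma> by simp
  have "0 < 1 / base_sigma n \<rho> \<sigma>" unfolding base_sigma_inverse using a b c by linarith
  then show p: "0 < base_sigma n \<rho> \<sigma>" by simp
  have "1 / \<sigma> < 1 / base_sigma n \<rho> \<sigma>" unfolding base_sigma_inverse using a b by linarith
  then show "base_sigma n \<rho> \<sigma> < \<sigma>" using p \<sigma>
    by (metis inverse_eq_divide inverse_less_iff_less)
qed

lemma base_sigma_disc_ratio:
  "2 * (disc_delta (base_sigma n \<rho> \<sigma>) / disc_delta \<sigma>) / (1 - disc_delta (base_sigma n \<rho> \<sigma>) / disc_delta \<sigma>)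
    \<le> harnack_eta n \<rho> \<sigma>"
proof -
  let ?s = "base_sigma n \<rho> \<sigma>" and ?h = "harnack_eta n \<rho> \<sigma>"
  define s where "s = disc_delta ?s / disc_delta \<sigma>"
  note h = harnack_eta_bounds
  have d: "0 < disc_delta \<sigma>" "0 < disc_delta ?s" using disc_delta_pos \<sigma> base_sigma_bounds by auto
  have "0 < 2 / pi\<^sup>2 * (2 * pi + 2 * harnack_trunc n \<rho> \<sigma>)"
    using harnack_trunc_bounds(1) by (simp add: add_pos_pos)
  moreover have "0 < 1 / \<sigma>" using \<sigma> by simp
  ultimately have "3 * (1 / \<sigma> + 1) / ?h \<le> 1 / ?s" unfolding base_sigma_inverse by linarith
  then have "3 * (1 / \<sigma> + 1) * ?s \<le> ?h" using h base_sigma_bounds(1) by (simp add: field_simps)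
  then have s3: "3 * ((1 + \<sigma>) * ?s / \<sigma>) \<le> ?h" using \<sigma> by (simp add: field_simps)
  have "disc_delta ?s / disc_delta \<sigma> \<le> (?s / (2 * pi)) / (\<sigma> / (2 * pi + \<sigma>))"
    using disc_delta_bounds(1)[OF \<sigma>(1)] disc_delta_bounds(2)[OF base_sigma_bounds(1)] base_sigma_bounds(1) \<sigma>
    by (intro frac_le) (auto simp: add_pos_pos)
  also have "\<dots> = ?s / \<sigma> * ((2 * pi + \<sigma>) / (2 * pi))" by simp
  also have "\<dots> \<le> ?s / \<sigma> * (1 + \<sigma>)"
  proof (rule mult_left_mono)
    have "\<sigma> * 1 \<le> \<sigma> * (2 * pi)" using \<sigma> pi_gt3 by (intro mult_left_mono) auto
    then show "(2 * pi + \<sigma>) / (2 * pi) \<le> 1 + \<sigma>" by (simp add: divide_le_eq algebra_simps)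
    show "0 \<le> ?s / \<sigma>" using base_sigma_bounds(1) \<sigma> by simp
  qed
  finally have "s \<le> (1 + \<sigma>) * ?s / \<sigma>" by (simp add: s_def mult.commute)
  \<comment> \<open>The factor 3 leaves room for the denominator: \<open>2 * s\<close> and
    \<open>?h * s\<close> together stay below \<open>?h\<close>.\<close>
  then have s: "3 * s \<le> ?h" using s3 by linarith
  have s0: "0 < s" using d by (simp add: s_def)
  have "?h * s \<le> ?h * (1 / 3)" using s h by (intro mult_left_mono) auto
  then have "2 * s \<le> ?h * (1 - s)" using s by (simp add: algebra_simps)
  moreover have "0 < 1 - s" using s h by simp
  ultimately show ?thesis unfolding s_def[symmetric] by (simp add: divide_le_eq)
qed

lemma base_sigma_ann_ratio:
  "2 * pi + 2 * harnack_trunc n \<rho> \<sigma> \<le> - ln (ann_delta (base_sigma n \<rho> \<sigma>) / ann_delta \<sigma>)"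
proof -
  have "- ln (ann_delta (base_sigma n \<rho> \<sigma>) / ann_delta \<sigma>) = pi\<^sup>2 / 2 * (1 / base_sigma n \<rho> \<sigma> - 1 / \<sigma>)"
    by (simp add: ln_div ann_delta_pos) (simp add: ann_delta_def algebra_simps)
  moreover have "0 < 3 * (1 / \<sigma> + 1) / harnack_eta n \<rho> \<sigma>"
    using harnack_eta_bounds(1) \<sigma> by (simp add: add_pos_pos)
  then have "2 / pi\<^sup>2 * (2 * pi + 2 * harnack_trunc n \<rho> \<sigma>) \<le> 1 / base_sigma n \<rho> \<sigma> - 1 / \<sigma>"
    unfolding base_sigma_inverse by linarith
  then have "pi\<^sup>2 / 2 * (2 / pi\<^sup>2 * (2 * pi + 2 * harnack_trunc n \<rho> \<sigma>)) \<le> pi\<^sup>2 / 2 * (1 / base_sigma n \<rho> \<sigma> - 1 / \<sigma>)"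
    by (intro mult_left_mono) auto
  moreover have "pi\<^sup>2 / 2 * (2 / pi\<^sup>2 * (2 * pi + 2 * harnack_trunc n \<rho> \<sigma>)) = 2 * pi + 2 * harnack_trunc n \<rho> \<sigma>"
    by simp
  ultimately show ?thesis by linarith
qed

text \<open>\<open>1 / harnack_eta\<close> is quadratic in \<rho> and \<open>1 / \<sigma>\<close>
  and is multiplied by \<open>1 / \<sigma> + 1\<close>, whence the cube.\<close>

lemma base_sigma_growth:
  "1 + \<rho> + 1 / base_sigma n \<rho> \<sigma> \<le> 1000 * (real n + 1) * (1 + \<rho> + 1 / \<sigma>) ^ 3"
proof -
  define B where "B = 1 + \<rho> + 1 / \<sigma>"
  define m where "m = real n + 1"
  have s: "0 < 1 / \<sigma>" using \<sigma> by simp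
  have B: "1 \<le> B" "\<rho> \<le> B" "1 / \<sigma> \<le> B" "1 / \<sigma> + 1 \<le> B" "1 + \<rho> + 1 / \<sigma> = B" using less_trans[OF \<sigma>] s unfolding B_def by linarith+
  have m: "1 \<le> m" by (simp add: m_def)
  have pi: "pi < 4" "3 < pi" using pi_less_4 pi_gt3 by auto
  have pi2: "9 \<le> pi\<^sup>2" "pi\<^sup>2 \<le> 16" using power_mono[of 3 pi 2] power_mono[of pi 4 2] pi by auto
  have B2: "\<rho> * (1 / \<sigma>) \<le> B\<^sup>2" unfolding power2_eq_square using B less_trans[OF \<sigma>] s by (intro mult_mono) auto
  have eta: "1 / harnack_eta n \<rho> \<sigma> = 96 * m * (\<rho> * (1 / \<sigma>))" by (simp add: harnack_eta_def m_def)
  have eta_le: "1 / harnack_eta n \<rho> \<sigma> \<le> 96 * m * B\<^sup>2"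
    unfolding eta using B2 m by (intro mult_left_mono) auto
  have mB: "1 \<le> m * B\<^sup>2" "B \<le> m * B\<^sup>2" "m * B\<^sup>2 \<le> m * B ^ 3"
  proof -
    have "1 * B \<le> B * B" using B by (intro mult_right_mono) auto
    then have BB: "B \<le> B\<^sup>2" by (simp add: power2_eq_square)
    also have "1 * B\<^sup>2 \<le> m * B\<^sup>2" using m by (intro mult_right_mono) auto
    finally show "B \<le> m * B\<^sup>2" by simp
    then show "1 \<le> m * B\<^sup>2" using B by linarith
    show "m * B\<^sup>2 \<le> m * B ^ 3" using m B by (intro mult_left_mono power_increasing) auto
  qed
  have "2 * pi / harnack_eta n \<rho> \<sigma> = 2 * pi * (1 / harnack_eta n \<rho> \<sigma>)" by simp
  also have "\<dots> \<le> 8 * (96 * m * B\<^sup>2)" using eta_le pi harnack_eta_bounds(1) by (intro mult_mono) auto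
  finally have t1: "2 * pi / harnack_eta n \<rho> \<sigma> \<le> 768 * (m * B\<^sup>2)" by simp
  have "4 * (pi\<^sup>2 / (2 * \<sigma>)) = 2 * pi\<^sup>2 * (1 / \<sigma>)" by simp
  also have "\<dots> \<le> 32 * B" using pi2 B s by (intro mult_mono) auto
  finally have t2: "4 * (pi\<^sup>2 / (2 * \<sigma>)) \<le> 32 * (m * B\<^sup>2)" using mB by linarith
  have T: "harnack_trunc n \<rho> \<sigma> \<le> 800 * (m * B\<^sup>2)" unfolding harnack_trunc_def using t1 t2 by linarith
  have "2 / pi\<^sup>2 * (2 * pi + 2 * harnack_trunc n \<rho> \<sigma>) \<le> 2 / 9 * (8 + 1600 * (m * B\<^sup>2))"
    using pi pi2 T harnack_trunc_bounds(1) by (intro mult_mono frac_le) auto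
  then have a: "2 / pi\<^sup>2 * (2 * pi + 2 * harnack_trunc n \<rho> \<sigma>) \<le> 400 * (m * B\<^sup>2)"
    by (rule order_trans) (use mB(1) in simp)
  have "3 * (1 / \<sigma> + 1) / harnack_eta n \<rho> \<sigma> = 3 * (1 / \<sigma> + 1) * (1 / harnack_eta n \<rho> \<sigma>)" by simp
  also have "\<dots> \<le> 3 * B * (96 * m * B\<^sup>2)"
    using B eta_le harnack_eta_bounds(1) by (intro mult_mono) auto
  finally have b: "3 * (1 / \<sigma> + 1) / harnack_eta n \<rho> \<sigma> \<le> 288 * (m * B ^ 3)"
    by (simp add: power2_eq_square power3_eq_cube mult_ac)
  have "1 + \<rho> + 1 / base_sigma n \<rho> \<sigma> \<le> B + 400 * (m * B\<^sup>2) + 288 * (m * B ^ 3)"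
    unfolding base_sigma_inverse using a b B(5) by linarith
  also have "\<dots> \<le> 1000 * (m * B ^ 3)" using mB B by linarith
  finally show ?thesis unfolding B_def m_def by (simp only: mult.assoc)
qed

text \<open>In \<open>1 + \<rho> + 1 / \<sigma>\<close> the range is linear and
  \<open>1 / disc_mesh\<close> quadratic, so the two factors of \<open>net_size\<close> have orders
  3 and 2.\<close>

lemma refinement_size_growth:
  "refinement_size \<rho> \<sigma> \<le> 10 ^ 8 * (1 + \<rho> + 1 / \<sigma>) ^ 5"
proof -
  define B where "B = 1 + \<rho> + 1 / \<sigma>"
  have s: "0 < 1 / \<sigma>" using \<sigma> by simp
  have B: "1 \<le> B" "\<rho> \<le> B" "1 / \<sigma> \<le> B" using less_trans[OF \<sigma>] s unfolding B_def by linarith+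
  have "1 + \<rho> \<le> B" using s unfolding B_def by linarith
  then have B': "2 + \<rho> \<le> 2 * B" using B(1) by linarith
  have pi: "pi < 4" "3 < pi" using pi_less_4 pi_gt3 by auto
  have pi2: "pi\<^sup>2 \<le> 16" using power_mono[of pi 4 2] pi by auto
  have d: "0 < disc_delta \<sigma>" using disc_delta_pos \<sigma> by simp
  have "1 / disc_delta \<sigma> \<le> 1 / (\<sigma> / (2 * pi + \<sigma>))"
    using disc_delta_bounds(1)[OF \<sigma>(1)] \<sigma> by (intro divide_left_mono mult_pos_pos d) (auto simp: add_pos_pos)
  also have "\<dots> = 2 * pi * (1 / \<sigma>) + 1" using \<sigma> by (simp add: field_simps)
  also have "\<dots> \<le> 8 * B + 1 * B" using pi B s by (intro add_mono mult_mono) auto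
  finally have d9: "1 / disc_delta \<sigma> \<le> 9 * B" by simp
  have "3 * (pi\<^sup>2 / (2 * \<sigma>)) = 3 / 2 * pi\<^sup>2 * (1 / \<sigma>)" by simp
  also have "\<dots> \<le> 24 * B" using pi2 B s by (intro mult_mono) auto
  finally have V: "log_range \<sigma> \<le> 33 * B" unfolding log_range_def using d9 by linarith
  have V0: "0 \<le> log_range \<sigma>" using log_range_pos \<sigma> by (simp add: less_imp_le)
  have "1 / disc_mesh \<rho> \<sigma> = (2 + \<rho>) * (1 / disc_delta \<sigma>)" by (simp add: disc_mesh_def disc_ratio_def)
  also have "\<dots> \<le> 2 * B * (9 * B)" using B B' d9 d less_trans[OF \<sigma>] by (intro mult_mono) auto
  finally have e: "1 / disc_mesh \<rho> \<sigma> \<le> 18 * B\<^sup>2" by (simp add: power2_eq_square)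
  have e0: "0 \<le> 1 / disc_mesh \<rho> \<sigma>" using d disc_ratio_bounds(1)[OF less_trans[OF \<sigma>]] by (simp add: disc_mesh_def)
  have pow: "1 \<le> B ^ k" for k using B by simp
  have "8 * log_range \<sigma> / disc_mesh \<rho> \<sigma> = 8 * log_range \<sigma> * (1 / disc_mesh \<rho> \<sigma>)" by simp
  also have "\<dots> \<le> 8 * (33 * B) * (18 * B\<^sup>2)" using V V0 e e0 B by (intro mult_mono) auto
  finally have x: "8 * log_range \<sigma> / disc_mesh \<rho> \<sigma> + 1 \<le> 5000 * B ^ 3"
    using pow[of 3] by (simp add: power2_eq_square power3_eq_cube)
  have "16 * pi / disc_mesh \<rho> \<sigma> = 16 * pi * (1 / disc_mesh \<rho> \<sigma>)" by simp
  also have "\<dots> \<le> 64 * (18 * B\<^sup>2)" using pi e e0 by (intro mult_mono) auto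
  finally have y: "16 * pi / disc_mesh \<rho> \<sigma> + 1 \<le> 2000 * B\<^sup>2" using pow[of 2] by linarith
  have "net_size (log_range \<sigma>) (disc_mesh \<rho> \<sigma>) \<le> 5000 * B ^ 3 * (2000 * B\<^sup>2)"
    unfolding net_size_def using x y B e0 by (intro mult_mono) auto
  also have "\<dots> = 10 ^ 7 * B ^ 5" by (simp add: power_add[symmetric])
  finally show ?thesis unfolding refinement_size_def B_def[symmetric] using pow[of 5] by simp
qed

end

text \<open>If the width is insufficient at a single point \<open>y\<close>, then \<open>u y\<close>
  is at most half the truncation level. Since the Harnack constant is below 2, truncation is then
  inactive at every point, and \<open>u\<close> is pinched between \<open>u y / \<kappa>\<close> and
  \<open>\<kappa> * u y\<close> on all of \<open>E'\<close>.\<close>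

lemma annulus_width_dichotomy:
  assumes \<sigma>: "0 < \<sigma>" "\<sigma> < \<rho>" and E: "is_ccell E" "cell_length E = n" "wide (ann_delta (base_sigma n \<rho> \<sigma>)) E"
    and pq: "holo_on (cell_set E) p" "holo_on (cell_set E) q"
      "\<And>x. x \<in> cell_set E \<Longrightarrow> 0 < cmod (p x) \<and> cmod (p x) < cmod (q x)"
  defines "E' \<equiv> shrink (disc_delta (base_sigma n \<rho> \<sigma>) / disc_delta \<sigma>) (ann_delta (base_sigma n \<rho> \<sigma>) / ann_delta \<sigma>) E"
  shows "(\<forall>x\<in>cell_set E'. cmod (p x) < (ann_delta \<sigma>)\<^sup>2 * cmod (q x)) \<or>
    (\<exists>v. v + pi\<^sup>2 / (4 * \<rho>) \<le> 3 * (pi\<^sup>2 / (2 * \<sigma>)) \<and>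
      (\<forall>x\<in>cell_set E'. v \<le> ln (cmod (q x) / cmod (p x)) \<and>
         ln (cmod (q x) / cmod (p x)) \<le> v + pi\<^sup>2 / (4 * \<rho>)))"
proof (cases "\<forall>x\<in>cell_set E'. cmod (p x) < (ann_delta \<sigma>)\<^sup>2 * cmod (q x)")
  case False
  let ?\<sigma>' = "base_sigma n \<rho> \<sigma>" and ?\<eta> = "harnack_eta n \<rho> \<sigma>" and ?T = "harnack_trunc n \<rho> \<sigma>"
  let ?L = "pi\<^sup>2 / (2 * \<sigma>)"
  define s where "s = disc_delta ?\<sigma>' / disc_delta \<sigma>"
  define t where "t = ann_delta ?\<sigma>' / ann_delta \<sigma>"
  define \<kappa> where "\<kappa> = harnack_factor ?\<eta> ^ (2 * n)"
  define u where "u = (\<lambda>x. ln (cmod (q x) / cmod (p x)))"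
  note \<sigma>' = base_sigma_bounds[OF \<sigma>, of n]
  have st: "0 < s" "s < 1" "0 < t" "t < 1"
    using disc_delta_pos[OF \<sigma>(1)] disc_delta_pos[OF \<sigma>'(1)] disc_delta_less[OF \<sigma>']
      ann_delta_pos[of \<sigma>] ann_delta_pos[of ?\<sigma>'] ann_delta_less[OF \<sigma>'] by (auto simp: s_def t_def)
  have "ann_delta ?\<sigma>' \<le> t"
    using ann_delta_pos[of \<sigma>] ann_delta_less_1[OF \<sigma>(1)] ann_delta_pos[of ?\<sigma>'] by (simp add: t_def pos_le_divide_eq mult_left_le)
  then have wt: "wide t E" using wide_mono[OF E(3)] ann_delta_pos[of ?\<sigma>'] by simp
  have E'eq: "E' = shrink s t E" by (simp add: E'_def s_def t_def)
  have H: "min (u x) ?T \<le> \<kappa> * u y" if "x \<in> cell_set E'" "y \<in> cell_set E'" for x y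
  proof -
    have "min (u x) ?T \<le> harnack_factor ?\<eta> ^ (2 * cell_length E) * u y"
      unfolding u_def
    proof (rule harnack_cell[OF E(1) wt pq st harnack_trunc_bounds(1)[OF \<sigma>]])
      show "2 * s / (1 - s) \<le> ?\<eta>" "2 * pi + 2 * ?T \<le> - ln t"
        unfolding s_def t_def using base_sigma_disc_ratio[OF \<sigma>] base_sigma_ann_ratio[OF \<sigma>] by blast+
    qed (use that E'eq harnack_trunc_bounds[OF \<sigma>, of n] harnack_eta_bounds[OF \<sigma>, of n] in auto)
    then show ?thesis by (simp add: \<kappa>_def E(2))
  qed
  have \<kappa>: "1 \<le> \<kappa>" "\<kappa> \<le> 1 + \<sigma> / (8 * \<rho>)" unfolding \<kappa>_def using harnack_factor_power_le[OF \<sigma>] by auto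
  have sub: "cell_set E' \<subseteq> cell_set E" unfolding E'eq using st by (intro shrink_subset) auto
  have upos: "0 < u x" if "x \<in> cell_set E'" for x
    using pq(3) sub that unfolding u_def by (intro ln_gt_zero) auto
  obtain y where y: "y \<in> cell_set E'" "(ann_delta \<sigma>)\<^sup>2 * cmod (q y) \<le> cmod (p y)" using False by force
  have L: "0 < ?L" using \<sigma> by simp
  have uy: "u y \<le> 2 * ?L"
  proof -
    have py: "0 < cmod (p y)" "0 < cmod (q y)" using pq(3) y(1) sub by force+
    have "(ann_delta \<sigma>)\<^sup>2 * exp (2 * ?L) = 1"
      by (simp add: ann_delta_def power2_eq_square flip: exp_add)
    then have "cmod (q y) = (ann_delta \<sigma>)\<^sup>2 * cmod (q y) * exp (2 * ?L)" by (simp add: mult_ac)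
    also have "\<dots> \<le> cmod (p y) * exp (2 * ?L)" using y(2) by (rule mult_right_mono) simp
    finally have "cmod (q y) / cmod (p y) \<le> exp (2 * ?L)" using py by (simp add: divide_le_eq mult.commute)
    then show ?thesis unfolding u_def using py by (metis divide_pos_pos ln_exp ln_mono)
  qed
  have k2: "\<kappa> < 2" using \<kappa>(2) \<sigma> by (smt (verit) divide_less_eq_1_pos)
  have T: "4 * ?L \<le> ?T" using harnack_trunc_bounds(3)[OF \<sigma>] .
  have "\<kappa> * u y \<le> \<kappa> * (2 * ?L)" using uy \<kappa> by (intro mult_left_mono) auto
  also have "\<dots> < 2 * (2 * ?L)" using k2 L by (intro mult_strict_right_mono) auto
  \<comment> \<open>With \<open>\<kappa> * u y\<close> below \<open>?T\<close>, an inequality for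
    \<open>min (u x) ?T\<close> can only be one for \<open>u x\<close>.\<close>
  finally have kT: "\<kappa> * u y < ?T" using T by linarith
  define v where "v = u y / \<kappa>"
  \<comment> \<open>\<open>\<kappa> - 1 / \<kappa>\<close> is at most
    \<open>\<sigma> / (4 * \<rho>)\<close> and \<open>u y\<close> at most
    \<open>pi\<^sup>2 / \<sigma>\<close>; their product is exactly the permitted variation. This
    fixes the size of \<open>harnack_eta\<close>.\<close>
  have gap: "\<kappa> * u y \<le> v + pi\<^sup>2 / (4 * \<rho>)"
  proof -
    have "\<kappa> * \<kappa> - 1 = (\<kappa> - 1) * (\<kappa> + 1)" by (simp add: algebra_simps)
    also have "\<dots> \<le> (\<kappa> - 1) * (2 * \<kappa>)" using \<kappa> by (intro mult_left_mono) auto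
    finally have "\<kappa> - 1 / \<kappa> \<le> 2 * (\<kappa> - 1)" using \<kappa>(1) by (simp add: field_simps)
    also have "\<dots> \<le> \<sigma> / (4 * \<rho>)" using \<kappa>(2) by simp
    finally have "(\<kappa> - 1 / \<kappa>) * u y \<le> \<sigma> / (4 * \<rho>) * (2 * ?L)"
      using uy upos[OF y(1)] \<sigma> by (intro mult_mono) auto
    also have "\<dots> = pi\<^sup>2 / (4 * \<rho>)" using \<sigma> by simp
    finally show ?thesis by (simp add: v_def left_diff_distrib)
  qed
  have "v \<le> u y" using \<kappa>(1) upos[OF y(1)] by (simp add: v_def divide_le_eq mult_le_cancel_left1)
  moreover have "pi\<^sup>2 / (4 * \<rho>) \<le> ?L" using \<sigma> by (intro divide_left_mono) auto
  ultimately have "v + pi\<^sup>2 / (4 * \<rho>) \<le> 3 * ?L" using uy by linarith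
  moreover have "v \<le> u x \<and> u x \<le> v + pi\<^sup>2 / (4 * \<rho>)" if x: "x \<in> cell_set E'" for x
  proof
    have "u y < ?T" using uy T L by linarith
    then have "u y \<le> \<kappa> * u x" using H[OF y(1) x] by simp
    then show "v \<le> u x" using \<kappa>(1) by (simp add: v_def divide_le_eq mult.commute)
    have "u x \<le> \<kappa> * u y" using H[OF x y(1)] kT by (simp add: min_def split: if_splits)
    then show "u x \<le> v + pi\<^sup>2 / (4 * \<rho>)" using gap by linarith
  qed
  ultimately show ?thesis unfolding u_def by blast
qed blast

section \<open>The refinement theorem\<close>

lemma cell_length_extension:
  assumes "is_extension \<rho> C C'"
  shows "cell_length C' = cell_length C"
proof -
  have "extends_cell \<rho> C C'" using assms by (simp add: is_extension_def)
  then show ?thesis by (induction \<rho> C C' rule: extends_cell.induct) auto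
qed

context sharp_filtration
begin

definition is_refinement ::
    "nat \<Rightarrow> nat \<Rightarrow> nat \<Rightarrow> real \<Rightarrow> ccell \<Rightarrow> real \<Rightarrow> complex list set \<Rightarrow>
      (ccell \<times> (complex list \<Rightarrow> complex list)) set \<Rightarrow> bool" where
  "is_refinement F D b \<sigma> C N X P \<longleftrightarrow> finite P \<and> real (card P) \<le> N \<and> (\<forall>q\<in>P. piece F D b \<sigma> C q) \<and>
     (\<forall>x\<in>X. \<exists>(E, f)\<in>P. x \<in> f ` cell_set (core \<sigma> E))"

lemma is_refinement_UN:
  assumes "finite P" "\<And>q. q \<in> P \<Longrightarrow> is_refinement F D b \<sigma> C N (X q) (Q q)"
  shows "is_refinement F D b \<sigma> C (real (card P) * N) (\<Union>q\<in>P. X q) (\<Union>q\<in>P. Q q)"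
proof -
  have "real (card (\<Union>q\<in>P. Q q)) \<le> real (\<Sum>q\<in>P. card (Q q))"
    using card_UN_le[OF assms(1), of Q] by (simp only: of_nat_le_iff)
  also have "\<dots> \<le> (\<Sum>q\<in>P. N)"
    unfolding of_nat_sum using assms(2) by (intro sum_mono) (auto simp: is_refinement_def)
  finally have "real (card (\<Union>q\<in>P. Q q)) \<le> real (card P) * N" by simp
  then show ?thesis using assms unfolding is_refinement_def by (intro conjI) (simp_all, blast+)
qed

text \<open>The piece is prepared with the small parameter \<open>base_sigma\<close> so that the
  Harnack inequality holds deep inside it; it is then relaxed to \<sigma>, and the fiber is refined
  over the relaxed cell.\<close>

lemma refine_piece:
  "\<exists>b'. \<forall>F D \<rho> \<sigma> C \<Phi> E f. 0 < \<sigma> \<longrightarrow> \<sigma> < \<rho> \<longrightarrow> cell_length C = n \<longrightarrow> is_ccell (C \<odot> \<Phi>) \<longrightarrow>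
     tame_cell F D 1 (C \<odot> \<Phi>) \<longrightarrow> piece F D b (base_sigma n \<rho> \<sigma>) C (E, f) \<longrightarrow>
     (\<exists>Q. is_refinement F D b' \<sigma> (C \<odot> \<Phi>) (refinement_size \<rho> \<sigma>)
        {f w @ [y] |w y. w \<in> cell_set (core (base_sigma n \<rho> \<sigma>) E) \<and> y \<in> fiber_set (core_fiber \<rho> \<Phi>) (f w)} Q)"
proof -
  obtain b1 where b1: "\<And>F D \<sigma>' \<sigma> s t C E f. \<lbrakk>0 < \<sigma>; 0 < s; s \<le> 1; 0 < t; t \<le> 1; cell_length C = n;
      piece F D b \<sigma>' C (E, f); ann_delta \<sigma>' = ann_delta \<sigma> * t\<rbrakk> \<Longrightarrow> piece F D b1 \<sigma> C (shrink s t E, f)"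
    using piece_shrink[of n b] by blast
  obtain b2 where b2: "\<And>F D \<sigma> C \<Phi> E f \<Psi> g. \<lbrakk>0 < \<sigma>; cell_length C = n; is_ccell (C \<odot> \<Phi>);
      tame_cell F D 1 (C \<odot> \<Phi>); piece F D b1 \<sigma> C (E, f); translated_subfiber \<sigma> (f ` cell_set E) \<Phi> (\<Psi>, g)\<rbrakk>
      \<Longrightarrow> piece F D b2 \<sigma> (C \<odot> \<Phi>) (E \<odot> pull_fiber f \<Psi>, snoc_map f (\<lambda>x. g (f x)))"
    using piece_snoc[of n b1] by blast
  show ?thesis
  proof (intro exI[of _ b2] allI impI)
    fix F D \<rho> \<sigma> C \<Phi> E f
    assume \<sigma>: "0 < \<sigma>" "\<sigma> < \<rho>" and n: "cell_length C = n" and C: "is_ccell (C \<odot> \<Phi>)"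
      and tC: "tame_cell F D 1 (C \<odot> \<Phi>)" and p: "piece F D b (base_sigma n \<rho> \<sigma>) C (E, f)"
    let ?\<sigma>' = "base_sigma n \<rho> \<sigma>"
    define s where "s = disc_delta ?\<sigma>' / disc_delta \<sigma>"
    define t where "t = ann_delta ?\<sigma>' / ann_delta \<sigma>"
    note \<sigma>' = base_sigma_bounds[OF \<sigma>, of n]
    note pos = disc_delta_pos[OF \<sigma>(1)] disc_delta_pos[OF \<sigma>'(1)] ann_delta_pos[of \<sigma>] ann_delta_pos[of ?\<sigma>']
    have st: "0 < s" "s \<le> 1" "0 < t" "t \<le> 1"
      using pos disc_delta_less[OF \<sigma>'] ann_delta_less[OF \<sigma>'] by (auto simp: s_def t_def)
    have ts: "ann_delta ?\<sigma>' = ann_delta \<sigma> * t" using pos by (simp add: t_def)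
    define E1 where "E1 = shrink s t E"
    have p1: "piece F D b1 \<sigma> C (E1, f)" unfolding E1_def by (rule b1[OF \<sigma>(1) st n p ts])
    \<comment> \<open>Relaxing the parameter keeps the core, so what the pieces of the base cover is
      still covered.\<close>
    have core: "core \<sigma> E1 = core ?\<sigma>' E"
      using pos by (simp add: E1_def shrink_shrink s_def t_def)
    have E: "is_ccell E" "cell_length E = n" "wide (ann_delta ?\<sigma>') E" "unit_translation E f"
      "f ` cell_set E \<subseteq> cell_set C" using p n by (auto simp: piece_def)
    have fo: "fiber_over (cell_set C) \<Phi>" using C by simp
    have sub1: "cell_set E1 \<subseteq> cell_set E" unfolding E1_def using shrink_subset[OF st] .
    \<comment> \<open>The fibers of the new pieces live over the relaxed extended cell, so the width
      conditions are required on its whole image and not merely on the image of the core.\<close>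
    define G where "G = f ` cell_set E1"
    have GC: "G \<subseteq> cell_set C" using sub1 E(5) by (auto simp: G_def)
    have "\<exists>I. fiber_cover \<sigma> G \<Phi> (refinement_size \<rho> \<sigma>) (fiber_set (core_fiber \<rho> \<Phi>)) I"
    proof (rule fiber_refinement[OF \<sigma>])
      show "R p \<noteq> 0" if "R \<in> radii \<Phi>" "p \<in> G" for R p using that fo GC by (auto simp: fiber_over_def)
      fix R1 R2 assume A: "\<Phi> = Annulus R1 R2"
      have R: "holo_on (cell_set C) R1" "holo_on (cell_set C) R2"
        "\<And>x. x \<in> cell_set C \<Longrightarrow> 0 < cmod (R1 x) \<and> cmod (R1 x) < cmod (R2 x)"
        using fo A by (auto simp: fiber_over_def)
      have comp: "holo_on (cell_set E) (\<lambda>x. h (f x))" if "holo_on (cell_set C) h" for h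
        by (rule holo_on_compose[OF that, of _ _ n])
           (use E unit_translation_holo[OF E(4)] unit_translation_length[OF E(4)] length_cell_set in auto)
      have "(\<forall>x\<in>cell_set E1. cmod (R1 (f x)) < (ann_delta \<sigma>)\<^sup>2 * cmod (R2 (f x))) \<or>
        (\<exists>v. v + pi\<^sup>2 / (4 * \<rho>) \<le> 3 * (pi\<^sup>2 / (2 * \<sigma>)) \<and>
          (\<forall>x\<in>cell_set E1. v \<le> ln (cmod (R2 (f x)) / cmod (R1 (f x))) \<and>
             ln (cmod (R2 (f x)) / cmod (R1 (f x))) \<le> v + pi\<^sup>2 / (4 * \<rho>)))"
        unfolding E1_def s_def t_def
        by (rule annulus_width_dichotomy[OF \<sigma> E(1-3) comp[OF R(1)] comp[OF R(2)]]) (use R(3) E(5) in blast)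
      then show "wide_fiber (ann_delta \<sigma>) G \<Phi> \<or>
        (\<exists>v. v + pi\<^sup>2 / (4 * \<rho>) \<le> 3 * (pi\<^sup>2 / (2 * \<sigma>)) \<and>
          (\<forall>p\<in>G. v \<le> ln (cmod (R2 p) / cmod (R1 p)) \<and>
             ln (cmod (R2 p) / cmod (R1 p)) \<le> v + pi\<^sup>2 / (4 * \<rho>)))"
        unfolding G_def wide_fiber_def A by auto
    qed
    then obtain I where I: "finite I" "real (card I) \<le> refinement_size \<rho> \<sigma>" "\<And>i. i \<in> I \<Longrightarrow> translated_subfiber \<sigma> G \<Phi> i"
      "\<And>p y. p \<in> G \<Longrightarrow> y \<in> fiber_set (core_fiber \<rho> \<Phi>) p \<Longrightarrow> \<exists>(\<Psi>, g)\<in>I. y - g p \<in> fiber_set (core_fiber \<sigma> \<Psi>) p"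
      unfolding fiber_cover_def by blast
    define mk where "mk = (\<lambda>(\<Psi>, g). (E1 \<odot> pull_fiber f \<Psi>, snoc_map f (\<lambda>x. g (f x))))"
    show "\<exists>Q. is_refinement F D b2 \<sigma> (C \<odot> \<Phi>) (refinement_size \<rho> \<sigma>)
        {f w @ [y] |w y. w \<in> cell_set (core ?\<sigma>' E) \<and> y \<in> fiber_set (core_fiber \<rho> \<Phi>) (f w)} Q"
      unfolding is_refinement_def
    proof (intro exI[of _ "mk ` I"] conjI ballI)
      show "finite (mk ` I)" using I by simp
      show "real (card (mk ` I)) \<le> refinement_size \<rho> \<sigma>" using card_image_le[OF I(1), of mk] I(2) by linarith
      show "piece F D b2 \<sigma> (C \<odot> \<Phi>) q" if q: "q \<in> mk ` I" for q
      proof -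
        obtain \<Psi> g where "(\<Psi>, g) \<in> I" "q = mk (\<Psi>, g)" using q by auto
        then show ?thesis using b2[OF \<sigma>(1) n C tC p1, of \<Psi> g] I(3) by (simp add: mk_def G_def)
      qed
      fix x assume "x \<in> {f w @ [y] |w y. w \<in> cell_set (core ?\<sigma>' E) \<and> y \<in> fiber_set (core_fiber \<rho> \<Phi>) (f w)}"
      then obtain w y where x: "x = f w @ [y]" and w: "w \<in> cell_set (core ?\<sigma>' E)"
        and y: "y \<in> fiber_set (core_fiber \<rho> \<Phi>) (f w)" by blast
      have "cell_set (core \<sigma> E1) \<subseteq> cell_set E1"
        using pos disc_delta_less_1[OF \<sigma>(1)] ann_delta_less_1[OF \<sigma>(1)] by (intro shrink_subset) auto
      then have wG: "f w \<in> G" using w core by (auto simp: G_def)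
      obtain \<Psi> g where i: "(\<Psi>, g) \<in> I" "y - g (f w) \<in> fiber_set (core_fiber \<sigma> \<Psi>) (f w)"
        using I(4)[OF wG y] by blast
      have "w @ [y - g (f w)] \<in> cell_set (core \<sigma> (E1 \<odot> pull_fiber f \<Psi>))"
        using w core i(2) by (simp add: shrink_pull fiber_set_pull)
      moreover have "f w @ [y] = snoc_map f (\<lambda>x. g (f x)) (w @ [y - g (f w)])" by (simp add: snoc_map_def)
      ultimately have "f w @ [y] \<in> snd (mk (\<Psi>, g)) ` cell_set (core \<sigma> (fst (mk (\<Psi>, g))))"
        unfolding mk_def by (simp del: shrink.simps)
      then show "\<exists>(E', h)\<in>mk ` I. x \<in> h ` cell_set (core \<sigma> E')"
        unfolding x using i(1) by (metis (no_types, lifting) case_prod_beta imageI)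
    qed
  qed
qed

text \<open>All values of \<sigma> are treated at once, because the induction hypothesis is applied
  to the base with \<open>base_sigma\<close> in place of \<sigma>. The given extension and \<rho>
  remain the same, and \<open>b\<close>, \<open>c\<close>, \<open>k\<close> depend on the length
  alone.\<close>

theorem refinement:
  "\<exists>b c k. 0 \<le> c \<and> (\<forall>F D \<rho> \<sigma> C C\<^sub>\<rho>. 0 < \<sigma> \<longrightarrow> \<sigma> < \<rho> \<longrightarrow> cell_length C = n \<longrightarrow> is_extension \<rho> C C\<^sub>\<rho> \<longrightarrow>
     tame_cell F D 1 C\<^sub>\<rho> \<longrightarrow> (\<exists>P. is_refinement F D b \<sigma> C\<^sub>\<rho> (c * (1 + \<rho> + 1 / \<sigma>) ^ k) (cell_set C) P))"
proof (induction n)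
  case 0
  show ?case
  proof (rule exI[of _ 1], rule exI[of _ 1], rule exI[of _ 0], intro conjI allI impI)
    fix F D and \<rho> \<sigma> :: real and C C\<^sub>\<rho>
    assume C0: "cell_length C = 0" and ext: "is_extension \<rho> C C\<^sub>\<rho>" and t: "tame_cell F D 1 C\<^sub>\<rho>"
    have C: "C = Unit" using C0 by (cases C) auto
    have C\<^sub>\<rho>: "C\<^sub>\<rho> = Unit" using ext C by (cases C\<^sub>\<rho>) (auto simp: is_extension_def)
    have "tame F D 1 0 {[]}" using tame_cell_set[OF t] C\<^sub>\<rho> by simp
    then have "piece F D 1 \<sigma> C\<^sub>\<rho> (Unit, \<lambda>z. z)"
      using t C\<^sub>\<rho> by (simp add: piece_def unit_translation_def)
    then show "\<exists>P. is_refinement F D 1 \<sigma> C\<^sub>\<rho> (1 * (1 + \<rho> + 1 / \<sigma>) ^ 0) (cell_set C) P"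
      unfolding is_refinement_def using C by (intro exI[of _ "{(Unit, \<lambda>z. z)}"]) simp
  qed simp
next
  case (Suc n)
  then obtain b c k where c: "0 \<le> c" and IH: "\<And>F D \<rho> \<sigma> C C\<^sub>\<rho>. \<lbrakk>0 < \<sigma>; \<sigma> < \<rho>; cell_length C = n; is_extension \<rho> C C\<^sub>\<rho>;
     tame_cell F D 1 C\<^sub>\<rho>\<rbrakk> \<Longrightarrow> \<exists>P. is_refinement F D b \<sigma> C\<^sub>\<rho> (c * (1 + \<rho> + 1 / \<sigma>) ^ k) (cell_set C) P" by blast
  obtain b' where b': "\<And>F D \<rho> \<sigma> C \<Phi> E f. \<lbrakk>0 < \<sigma>; \<sigma> < \<rho>; cell_length C = n; is_ccell (C \<odot> \<Phi>);
     tame_cell F D 1 (C \<odot> \<Phi>); piece F D b (base_sigma n \<rho> \<sigma>) C (E, f)\<rbrakk> \<Longrightarrow>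
     \<exists>Q. is_refinement F D b' \<sigma> (C \<odot> \<Phi>) (refinement_size \<rho> \<sigma>)
        {f w @ [y] |w y. w \<in> cell_set (core (base_sigma n \<rho> \<sigma>) E) \<and> y \<in> fiber_set (core_fiber \<rho> \<Phi>) (f w)} Q"
    using refine_piece[of n b] by blast
  \<comment> \<open>The number of pieces of the base times the number of fibers over each: the cubic
    growth of \<open>1 / base_sigma\<close> triples the exponent, and \<open>refinement_size\<close>
    adds 5 to it.\<close>
  define c' where "c' = c * (1000 * (real n + 1)) ^ k * 10 ^ 8"
  show ?case
  proof (rule exI[of _ b'], rule exI[of _ c'], rule exI[of _ "3 * k + 5"], intro conjI allI impI)
    show "0 \<le> c'" using c by (simp add: c'_def)
    fix F D \<rho> \<sigma> C' C\<^sub>\<rho>'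
    assume \<sigma>: "0 < \<sigma>" "\<sigma> < \<rho>" and n: "cell_length C' = Suc n" and ext: "is_extension \<rho> C' C\<^sub>\<rho>'"
      and t: "tame_cell F D 1 C\<^sub>\<rho>'"
    let ?\<sigma>' = "base_sigma n \<rho> \<sigma>"
    obtain C \<Phi> where C': "C' = C \<odot> \<Phi>" "cell_length C = n" using n by (cases C') auto
    obtain C\<^sub>\<rho> \<Phi>\<^sub>\<rho> where C\<^sub>\<rho>': "C\<^sub>\<rho>' = C\<^sub>\<rho> \<odot> \<Phi>\<^sub>\<rho>"
      using ext C' by (cases C\<^sub>\<rho>') (auto simp: is_extension_def)
    have ext': "is_extension \<rho> C C\<^sub>\<rho>" "fiber_extension (ext_delta \<rho> \<Phi>) (cell_set C) \<Phi> \<Phi>\<^sub>\<rho>" "is_ccell (C\<^sub>\<rho> \<odot> \<Phi>\<^sub>\<rho>)"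
      using ext by (auto simp: is_extension_def C' C\<^sub>\<rho>')
    have len: "cell_length C\<^sub>\<rho> = n" using cell_length_extension[OF ext'(1)] C'(2) by simp
    have tC: "tame_cell F D 1 C\<^sub>\<rho>" using tame_cell_base[OF ext'(3)] t C\<^sub>\<rho>' by simp
    have "?\<sigma>' < \<rho>" using base_sigma_bounds(2)[OF \<sigma>, of n] \<sigma>(2) by simp
    from IH[OF base_sigma_bounds(1)[OF \<sigma>] this C'(2) ext'(1) tC]
    obtain P where P: "is_refinement F D b ?\<sigma>' C\<^sub>\<rho> (c * (1 + \<rho> + 1 / ?\<sigma>') ^ k) (cell_set C) P" by blast
    let ?X = "\<lambda>(E, f). {f w @ [y] |w y. w \<in> cell_set (core ?\<sigma>' E) \<and> y \<in> fiber_set (core_fiber \<rho> \<Phi>\<^sub>\<rho>) (f w)}"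
    have "\<forall>q\<in>P. \<exists>Q. is_refinement F D b' \<sigma> C\<^sub>\<rho>' (refinement_size \<rho> \<sigma>) (?X q) Q"
      using b'[OF \<sigma> len ext'(3)] t P unfolding C\<^sub>\<rho>' is_refinement_def[of F D b] by auto
    from bchoice[OF this] obtain Q
      where Q: "\<forall>q\<in>P. is_refinement F D b' \<sigma> C\<^sub>\<rho>' (refinement_size \<rho> \<sigma>) (?X q) (Q q)" ..
    have U: "is_refinement F D b' \<sigma> C\<^sub>\<rho>' (real (card P) * refinement_size \<rho> \<sigma>) (\<Union>q\<in>P. ?X q) (\<Union>q\<in>P. Q q)"
      using P Q by (intro is_refinement_UN) (auto simp: is_refinement_def[of F D b])
    let ?B = "1 + \<rho> + 1 / \<sigma>"
    have B: "0 \<le> ?B" using \<sigma> by simp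
    have "real (card P) * refinement_size \<rho> \<sigma> \<le> real (card P) * (10 ^ 8 * ?B ^ 5)"
      using refinement_size_growth[OF \<sigma>] by (intro mult_left_mono) auto
    also have "\<dots> \<le> c * (1000 * (real n + 1) * ?B ^ 3) ^ k * (10 ^ 8 * ?B ^ 5)"
    proof (rule mult_right_mono)
      have "0 \<le> 1 + \<rho> + 1 / ?\<sigma>'" using \<sigma> base_sigma_bounds(1)[OF \<sigma>, of n] by simp
      then have "c * (1 + \<rho> + 1 / ?\<sigma>') ^ k \<le> c * (1000 * (real n + 1) * ?B ^ 3) ^ k"
        using c base_sigma_growth[OF \<sigma>, of n] by (intro mult_left_mono power_mono) auto
      then show "real (card P) \<le> c * (1000 * (real n + 1) * ?B ^ 3) ^ k"
        using P unfolding is_refinement_def by linarith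
    qed (use B in simp)
    also have "\<dots> = c' * ?B ^ (3 * k + 5)"
      by (simp only: c'_def power_mult_distrib power_add power_mult[symmetric]) (simp only: mult_ac)
    finally have card: "real (card P) * refinement_size \<rho> \<sigma> \<le> c' * ?B ^ (3 * k + 5)" .
    have "cell_set C' \<subseteq> (\<Union>q\<in>P. ?X q)"
    proof
      fix x' assume "x' \<in> cell_set C'"
      then obtain x y where x': "x' = x @ [y]" "x \<in> cell_set C" "y \<in> fiber_set \<Phi> x" using C' by auto
      obtain E f w where q: "(E, f) \<in> P" "w \<in> cell_set (core ?\<sigma>' E)" "x = f w"
        using P x'(2) unfolding is_refinement_def by blast
      have "y \<in> fiber_set (core_fiber \<rho> \<Phi>\<^sub>\<rho>) (f w)"
        using x'(3) fiber_set_extension[OF ext'(2) x'(2)] \<sigma> q(3) by auto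
      then show "x' \<in> (\<Union>q\<in>P. ?X q)" using q x'(1) by (intro UN_I[OF q(1)]) auto
    qed
    then have "is_refinement F D b' \<sigma> C\<^sub>\<rho>' (c' * ?B ^ (3 * k + 5)) (cell_set C') (\<Union>q\<in>P. Q q)"
      using U card unfolding is_refinement_def by (meson order_trans subsetD)
    then show "\<exists>P. is_refinement F D b' \<sigma> C\<^sub>\<rho>' (c' * ?B ^ (3 * k + 5)) (cell_set C') P" by blast
  qed
qed

end

section \<open>Passage to polynomial bounds and to constants depending on the format\<close>

lemma poly2_power: "\<exists>p. \<forall>x y. poly2 p x y = c * (1 + x + y) ^ k"
\<comment> \<open>In \<open>poly2\<close> the outer variable is \<open>y\<close> and the
  coefficients are polynomials in \<open>x\<close>, so \<open>[:[:1, 1:], 1:]\<close> represents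
  \<open>1 + x + y\<close>.\<close>
proof (intro exI[of _ "smult [:c:] ([:[:1, 1:], 1:] ^ k)"] allI)
  fix x y
  show "poly2 (smult [:c:] ([:[:1, 1:], 1:] ^ k)) x y = c * (1 + x + y) ^ k"
    by (simp add: poly2_def poly_power algebra_simps)
qed

theorem mainTheorem3:
  fixes Def :: "nat \<Rightarrow> real list set set"
    and S :: "nat \<Rightarrow> nat \<Rightarrow> nat \<Rightarrow> real list set set"
  assumes "ominimal_expansion Def"
    and "FD_filtration Def S"
    and "sharply_ominimal S"
    and "sharply_compatible S"
    and "sharp_cell_decomposition Def S"
  shows "\<exists>(p :: nat \<Rightarrow> real poly poly) (K :: nat \<Rightarrow> nat) (q :: nat \<Rightarrow> real poly).
    \<forall>(l::nat) (F::nat) (D::nat) (\<rho>::real) (\<sigma>::real) C C\<^sub>\<rho>.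
      0 < \<sigma> \<longrightarrow> \<sigma> < \<rho> \<longrightarrow> cell_length C = l \<longrightarrow> is_extension \<rho> C C\<^sub>\<rho> \<longrightarrow> cell_in S F D C\<^sub>\<rho> \<longrightarrow>
      (\<exists>N B B\<^sub>\<sigma> f.
        cellular_cover \<rho> \<sigma> C C\<^sub>\<rho> N B B\<^sub>\<sigma> f \<and>
        real N \<le> poly2 (p l) \<rho> (1 / \<sigma>) \<and>
        (\<forall>j<N. translate_map (B\<^sub>\<sigma> j) (f j) \<and>
           (\<exists>F' D'. F' \<le> K F \<and> real D' \<le> poly (q F) (real D) \<and>
              map_in S F' D' (B\<^sub>\<sigma> j) C\<^sub>\<rho> (f j))))"
proof -
  have mono: "\<And>n F F' D D'. F \<le> F' \<Longrightarrow> D \<le> D' \<Longrightarrow> S n F D \<subseteq> S n F' D'"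
    and un: "\<And>n. (\<Union>F D. S n F D) = Def n" and fmt: "\<And>n F D. S n F D \<noteq> {} \<Longrightarrow> n \<le> F"
    using assms(2) unfolding FD_filtration_def by blast+
  have Rn: "\<And>n. Def n \<subseteq> Pow (Rn n)" 
    using assms(1)[unfolded ominimal_expansion_def, THEN conjunct1] by blast
  interpret sharp_filtration S
  proof
    show "F \<le> F' \<Longrightarrow> D \<le> D' \<Longrightarrow> S n F D \<subseteq> S n F' D'" for F F' D D' n by (rule mono)
    show "sharply_compatible S" by fact
    show "A \<subseteq> Rn n" if "A \<in> S n F D" for A n F D using that un[of n] Rn[of n] by blast
  qed
  define good where "good = (\<lambda>n b (c::real) k. \<forall>F D \<rho> \<sigma> C C\<^sub>\<rho>. 0 < \<sigma> \<longrightarrow> \<sigma> < \<rho> \<longrightarrow>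
     cell_length C = n \<longrightarrow> is_extension \<rho> C C\<^sub>\<rho> \<longrightarrow> tame_cell F D 1 C\<^sub>\<rho> \<longrightarrow>
     (\<exists>P. is_refinement F D b \<sigma> C\<^sub>\<rho> (c * (1 + \<rho> + 1 / \<sigma>) ^ k) (cell_set C) P))"
  have "\<exists>b c k. good n b c k" for n
    unfolding good_def using refinement[of n] by (elim exE conjE) (intro exI)
  then obtain b c k where good: "\<And>n. good n (b n) (c n) (k n)" by metis
  obtain p where p: "\<And>n x y. poly2 (p n) x y = c n * (1 + x + y) ^ k n"
    using choice[of "\<lambda>n p. \<forall>x y. poly2 p x y = c n * (1 + x + y) ^ k n"] poly2_power by blast
  \<comment> \<open>A cell of length \<open>l\<close> has format at least \<open>2 * l\<close>, so
    summing over \<open>l \<le> F\<close> turns a constant depending on the length into one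
    depending on the format. \<open>Suc\<close> makes it positive, which places the target cell
    itself within the bound.\<close>
  define m where "m = (\<lambda>F. Suc (\<Sum>l\<le>F. b l))"
  show ?thesis
  \<comment> \<open>The linear polynomial evaluates to \<open>m F * (D + 1)\<close>, the degree
    bound built into \<open>rtame\<close>.\<close>
  proof (intro exI[of _ p] exI[of _ "\<lambda>F. F + m F"] exI[of _ "\<lambda>F. [:real (m F), real (m F):]"] allI impI)
    fix l F D \<rho> \<sigma> C C\<^sub>\<rho>
    assume \<sigma>: "0 < \<sigma>" "\<sigma> < \<rho>" and l: "cell_length C = l" and ext: "is_extension \<rho> C C\<^sub>\<rho>" and inS: "cell_in S F D C\<^sub>\<rho>"
    have len: "cell_length C\<^sub>\<rho> = l" using cell_length_extension[OF ext] l by simp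
    have "2 * l \<le> F" using inS fmt len unfolding cell_in_def by blast
    then have "b l \<le> (\<Sum>l\<le>F. b l)" by (intro member_le_sum) auto
    then have bm: "b l \<le> m F" by (simp add: m_def)
    have t: "tame_cell F D 1 C\<^sub>\<rho>" unfolding tame_cell_def by (rule cell_in_mono[OF inS]) auto
    from good[of l, unfolded good_def, rule_format, OF \<sigma> l ext t]
    obtain P where P: "finite P" "real (card P) \<le> c l * (1 + \<rho> + 1 / \<sigma>) ^ k l" "\<And>q. q \<in> P \<Longrightarrow> piece F D (b l) \<sigma> C\<^sub>\<rho> q"
      "\<And>x. x \<in> cell_set C \<Longrightarrow> \<exists>(E, f)\<in>P. x \<in> f ` cell_set (core \<sigma> E)"
      unfolding is_refinement_def by (elim exE conjE) (rule that, auto)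
    obtain h where "bij_betw h {0..<card P} P" using ex_bij_betw_nat_finite[OF P(1)] by blast
    then have h: "h ` {..<card P} = P" by (simp add: bij_betw_def lessThan_atLeast0)
    define B\<^sub>\<sigma> where "B\<^sub>\<sigma> = (\<lambda>j. fst (h j))"
    define f where "f = (\<lambda>j. snd (h j))"
    have pc: "piece F D (b l) \<sigma> C\<^sub>\<rho> (B\<^sub>\<sigma> j, f j)" if "j < card P" for j
      using P(3)[of "h j"] h that by (auto simp: B\<^sub>\<sigma>_def f_def)
    have cover: "cellular_cover \<rho> \<sigma> C C\<^sub>\<rho> (card P) (\<lambda>j. core \<sigma> (B\<^sub>\<sigma> j)) B\<^sub>\<sigma> f"
      unfolding cellular_cover_def
    proof (intro conjI allI impI ext)
      fix j assume "j < card P"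
      then have E: "is_ccell (B\<^sub>\<sigma> j)" "cell_length (B\<^sub>\<sigma> j) = l" "wide (ann_delta \<sigma>) (B\<^sub>\<sigma> j)"
        "unit_translation (B\<^sub>\<sigma> j) (f j)" "f j ` cell_set (B\<^sub>\<sigma> j) \<subseteq> cell_set C\<^sub>\<rho>"
        using pc len by (auto simp: piece_def)
      show "cell_length (core \<sigma> (B\<^sub>\<sigma> j)) = cell_length C" using E(2) l by simp
      show "is_extension \<sigma> (core \<sigma> (B\<^sub>\<sigma> j)) (B\<^sub>\<sigma> j)" by (rule is_extension_core[OF \<sigma>(1) E(1,3)])
      show "cellular_map (B\<^sub>\<sigma> j) (f j)" by (rule unit_translation_cellular(1)[OF E(4)])
      show "f j ` cell_set (B\<^sub>\<sigma> j) \<subseteq> cell_set C\<^sub>\<rho>" by (rule E(5))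
    next
      show "cell_set C \<subseteq> (\<Union>j<card P. f j ` cell_set (core \<sigma> (B\<^sub>\<sigma> j)))"
      proof
        fix x assume "x \<in> cell_set C"
        then obtain E g where "(E, g) \<in> P" "x \<in> g ` cell_set (core \<sigma> E)" using P(4) by blast
        moreover then obtain j where "j < card P" "h j = (E, g)" using h by (metis imageE lessThan_iff)
        ultimately show "x \<in> (\<Union>j<card P. f j ` cell_set (core \<sigma> (B\<^sub>\<sigma> j)))"
          by (intro UN_I[of j]) (auto simp: B\<^sub>\<sigma>_def f_def)
      qed
    qed
    show "\<exists>N B B\<^sub>\<sigma> f. cellular_cover \<rho> \<sigma> C C\<^sub>\<rho> N B B\<^sub>\<sigma> f \<and> real N \<le> poly2 (p l) \<rho> (1 / \<sigma>) \<and>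
        (\<forall>j<N. translate_map (B\<^sub>\<sigma> j) (f j) \<and>
           (\<exists>F' D'. F' \<le> F + m F \<and> real D' \<le> poly [:real (m F), real (m F):] (real D) \<and>
              map_in S F' D' (B\<^sub>\<sigma> j) C\<^sub>\<rho> (f j)))"
    proof (rule exI[of _ "card P"], rule exI[of _ "\<lambda>j. core \<sigma> (B\<^sub>\<sigma> j)"], rule exI[of _ B\<^sub>\<sigma>], rule exI[of _ f],
        intro conjI allI impI cover)
      show "real (card P) \<le> poly2 (p l) \<rho> (1 / \<sigma>)" using P(2) p by simp
      fix j assume j: "j < card P"
      have E: "cell_length (B\<^sub>\<sigma> j) = l" "unit_translation (B\<^sub>\<sigma> j) (f j)" "tame_cell F D (b l) (B\<^sub>\<sigma> j)"
        "tame F D (b l) (l + l) {z @ f j z |z. z \<in> cell_set (B\<^sub>\<sigma> j)}"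
        using pc[OF j] len by (auto simp: piece_def)
      show "translate_map (B\<^sub>\<sigma> j) (f j)" by (rule unit_translation_cellular(2)[OF E(2)])
      have "map_in S (F + m F) (m F * (D + 1)) (B\<^sub>\<sigma> j) C\<^sub>\<rho> (f j)"
        unfolding map_in_def
      proof (intro conjI)
        show "realify ` {z @ f j z |z. z \<in> cell_set (B\<^sub>\<sigma> j)}
            \<in> S (2 * (cell_length (B\<^sub>\<sigma> j) + cell_length C\<^sub>\<rho>)) (F + m F) (m F * (D + 1))"
          using tame_mono[OF E(4) bm] E(1) len by (simp add: tame_def rtame_def)
        show "cell_in S (F + m F) (m F * (D + 1)) (B\<^sub>\<sigma> j)"
          using tame_cell_mono[OF E(3) bm] by (simp add: tame_cell_def)
        show "cell_in S (F + m F) (m F * (D + 1)) C\<^sub>\<rho>"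
          by (rule cell_in_mono[OF inS]) (auto simp: m_def)
      qed
      then show "\<exists>F' D'. F' \<le> F + m F \<and> real D' \<le> poly [:real (m F), real (m F):] (real D) \<and>
          map_in S F' D' (B\<^sub>\<sigma> j) C\<^sub>\<rho> (f j)"
        by (intro exI[of _ "F + m F"] exI[of _ "m F * (D + 1)"]) (simp add: algebra_simps)
    qed
  qed
qed

end
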